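(* Fix $\beta>0$ and $h\in\mathbb{R}$, and suppose there is a number $q<1$ and a constant $C_0$ depending only on $\beta,h$ such that for every $N$, $$\mathbb{E}\langle (R_{12}-q)^4\rangle \le \frac{C_0}{N^2}.$$ For $1\le i\le N$ let $$r_i := \frac{1}{\sqrt{N}}\sum_{j\ne i} g_{ij}\langle\sigma_j\rangle - \beta(1-q)\langle\sigma_i\rangle,\qquad p_i := \frac{e^{\beta r_i+h}}{e^{\beta r_i+h}+e^{-\beta r_i-h}},$$ and let $\nu_i$ be the random probability measure on $\mathbb{R}$ with density $$p_i\,\phi_{r_i+\beta(1-q),\,1-q} + (1-p_i)\,\phi_{r_i-\beta(1-q),\,1-q}.$$ Let $\ell_i := \frac{1}{\sqrt N}\sum_{j\ne i} g_{ij}\sigma_j$ be the local field at site $i$. Then there is a constant $C(\beta,h)$ depending only on $\beta$ and $h$ (and the constants in the hypothesis) such that for every $N$, every bounded measurable $u:\mathbb{R}\to\mathbb{R}$ and every $1\le i\le N$, $$\mathbb{E}\Bigl(\langle u(\ell_i)\rangle - \int_{\mathbb{R}} u(x)\,\nu_i(dx)\Bigr)^2 \le \frac{C(\beta,h)\,\|u\|_\infty^2}{\sqrt N}.$$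
   Context: Sherrington–Kirkpatrick model: for a positive integer $N$, let $\Sigma_N=\{-1,1\}^N$ and let $g=(g_{ij})_{1\le i<j\le N}$ be i.i.d. standard Gaussian random variables (the disorder); set $g_{ji}:=g_{ij}$. Given $g$, the Gibbs measure on $\Sigma_N$ is $G_N(\sigma)=Z_N^{-1}\exp\bigl(\frac{\beta}{\sqrt N}\sum_{1\le i<j\le N} g_{ij}\sigma_i\sigma_j + h\sum_{i=1}^N\sigma_i\bigr)$, with $Z_N$ the normalizing constant. Replicas $\sigma^1,\sigma^2,\dots$ are independent samples from $G_N$ given $g$, and for a function $f$ of the disorder and of replicas, $\langle f(\sigma^1,\dots,\sigma^k)\rangle := \sum_{\sigma^1,\dots,\sigma^k} f(\sigma^1,\dots,\sigma^k)G_N(\sigma^1)\cdots G_N(\sigma^k)$ (quenched average, $g$ fixed). $\mathbb{E}$ denotes expectation over the disorder. The overlap is $R_{12}=\frac1N\sum_{i=1}^N\sigma^1_i\sigma^2_i$. For $\mu\in\mathbb{R}$, $s>0$, $\phi_{\mu,s^2}(x)=\frac{1}{\sqrt{2\pi}s}e^{-(x-\mu)^2/(2s^2)}$ is the Gaussian density with mean $\mu$ and variance $s^2$. *)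

theory Defs
  imports "HOL-Probability.Probability"
begin

definition spins :: "nat \<Rightarrow> (nat \<Rightarrow> real) set" where
  "spins N = PiE {1..N} (\<lambda>_. {-1, 1})"

definition pairs :: "nat \<Rightarrow> (nat \<times> nat) set" where
  "pairs N = {(i, j). 1 \<le> i \<and> i < j \<and> j \<le> N}"

definition disorder :: "nat \<Rightarrow> (nat \<times> nat \<Rightarrow> real) measure" where
  "disorder N = PiM (pairs N) (\<lambda>_. density lborel std_normal_density)"

definition gs :: "(nat \<times> nat \<Rightarrow> real) \<Rightarrow> nat \<Rightarrow> nat \<Rightarrow> real" where
  "gs g i j = g (min i j, max i j)"

definition hamil :: "nat \<Rightarrow> real \<Rightarrow> real \<Rightarrow> (nat \<times> nat \<Rightarrow> real) \<Rightarrow> (nat \<Rightarrow> real) \<Rightarrow> real" where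
  "hamil N \<beta> h g \<sigma> = \<beta> / sqrt (real N) * (\<Sum>(i,j)\<in>pairs N. g (i,j) * \<sigma> i * \<sigma> j)
     + h * (\<Sum>i\<in>{1..N}. \<sigma> i)"

definition partition_fn :: "nat \<Rightarrow> real \<Rightarrow> real \<Rightarrow> (nat \<times> nat \<Rightarrow> real) \<Rightarrow> real" where
  "partition_fn N \<beta> h g = (\<Sum>\<sigma>\<in>spins N. exp (hamil N \<beta> h g \<sigma>))"

definition gibbs :: "nat \<Rightarrow> real \<Rightarrow> real \<Rightarrow> (nat \<times> nat \<Rightarrow> real) \<Rightarrow> (nat \<Rightarrow> real) \<Rightarrow> real" where
  "gibbs N \<beta> h g \<sigma> = exp (hamil N \<beta> h g \<sigma>) / partition_fn N \<beta> h g"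

definition gavg :: "nat \<Rightarrow> real \<Rightarrow> real \<Rightarrow> (nat \<times> nat \<Rightarrow> real) \<Rightarrow> ((nat \<Rightarrow> real) \<Rightarrow> real) \<Rightarrow> real" where
  "gavg N \<beta> h g f = (\<Sum>\<sigma>\<in>spins N. f \<sigma> * gibbs N \<beta> h g \<sigma>)"

definition gavg2 :: "nat \<Rightarrow> real \<Rightarrow> real \<Rightarrow> (nat \<times> nat \<Rightarrow> real) \<Rightarrow>
    ((nat \<Rightarrow> real) \<Rightarrow> (nat \<Rightarrow> real) \<Rightarrow> real) \<Rightarrow> real" where
  "gavg2 N \<beta> h g f = (\<Sum>\<sigma>1\<in>spins N. \<Sum>\<sigma>2\<in>spins N.
      f \<sigma>1 \<sigma>2 * gibbs N \<beta> h g \<sigma>1 * gibbs N \<beta> h g \<sigma>2)"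

definition overlap :: "nat \<Rightarrow> (nat \<Rightarrow> real) \<Rightarrow> (nat \<Rightarrow> real) \<Rightarrow> real" where
  "overlap N \<sigma>1 \<sigma>2 = (\<Sum>i\<in>{1..N}. \<sigma>1 i * \<sigma>2 i) / real N"

definition local_field :: "nat \<Rightarrow> (nat \<times> nat \<Rightarrow> real) \<Rightarrow> nat \<Rightarrow> (nat \<Rightarrow> real) \<Rightarrow> real" where
  "local_field N g i \<sigma> = (\<Sum>j\<in>{1..N} - {i}. gs g i j * \<sigma> j) / sqrt (real N)"

definition cavity_r :: "nat \<Rightarrow> real \<Rightarrow> real \<Rightarrow> real \<Rightarrow> (nat \<times> nat \<Rightarrow> real) \<Rightarrow> nat \<Rightarrow> real" where
  "cavity_r N \<beta> h q g i =
     (\<Sum>j\<in>{1..N} - {i}. gs g i j * gavg N \<beta> h g (\<lambda>\<sigma>. \<sigma> j)) / sqrt (real N)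
     - \<beta> * (1 - q) * gavg N \<beta> h g (\<lambda>\<sigma>. \<sigma> i)"

definition cavity_p :: "nat \<Rightarrow> real \<Rightarrow> real \<Rightarrow> real \<Rightarrow> (nat \<times> nat \<Rightarrow> real) \<Rightarrow> nat \<Rightarrow> real" where
  "cavity_p N \<beta> h q g i =
     (let r = cavity_r N \<beta> h q g i in
      exp (\<beta> * r + h) / (exp (\<beta> * r + h) + exp (- \<beta> * r - h)))"

text \<open>Density of nu_i; normal_density takes the standard deviation, so variance 1-q
  corresponds to standard deviation sqrt(1-q).\<close>
definition nu_density :: "nat \<Rightarrow> real \<Rightarrow> real \<Rightarrow> real \<Rightarrow> (nat \<times> nat \<Rightarrow> real) \<Rightarrow> nat \<Rightarrow> real \<Rightarrow> real" where
  "nu_density N \<beta> h q g i x =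
     (let r = cavity_r N \<beta> h q g i; p = cavity_p N \<beta> h q g i in
      p * normal_density (r + \<beta> * (1 - q)) (sqrt (1 - q)) x
      + (1 - p) * normal_density (r - \<beta> * (1 - q)) (sqrt (1 - q)) x)"

definition sup_norm :: "(real \<Rightarrow> real) \<Rightarrow> real" where
  "sup_norm u = (SUP x. \<bar>u x\<bar>)"

end

theory Submission
  imports Defs
begin

text \<open>
  The proof is a cavity argument. Removing the spin \<open>\<sigma>\<^sub>i\<close> leaves a measure that is independent of
  the couplings \<open>g\<^sub>i\<^sub>j\<close>, so that conditionally on everything else the local fields of two replicas,
  together with the mean field \<open>r\<close> of the cavity measure, are jointly Gaussian with covariances given
  by overlaps. When the overlaps are close to \<open>q\<close>, a pair of local fields is close in law to
  \<open>r + sqrt (1 - q) \<xi>, r + sqrt (1 - q) \<xi>'\<close> with a common \<open>r\<close>. As these covariance matrices are nondegenerate,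
  this holds for merely measurable test functions of exponential growth, with an error linear in the
  overlap deviation, which is of order \<open>1 / sqrt N\<close>. Expanding the square in two replicas, the average
  of a test function under the cavity measure is therefore its average under the normal law with mean
  \<open>r\<close> and variance \<open>1 - q\<close>. Putting \<open>\<sigma>\<^sub>i\<close> back tilts this normal law by \<open>cosh (\<beta> x + h)\<close>, which
  gives exactly the two-component mixture \<open>\<nu>\<^sub>i\<close>, except that \<open>r\<close> appears in place of \<open>r\<^sub>i\<close>; the
  difference \<open>r\<^sub>i - r\<close> is an explicit cavity average whose second moment is again of order \<open>1 / sqrt N\<close>.
\<close>

section \<open>Centred Gaussian laws on the plane\<close>

text \<open>Planar Gaussian laws are built from two independent normals instead of a density,
  because the true covariance may be singular: the two replicas may coincide, and for
  \<open>N = 1\<close> all fields vanish. Only the reference matrix with diagonal \<open>1\<close>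
  and off-diagonal \<open>q\<close> has to be invertible; nonnegativity of the mean overlap excludes
  \<open>q < 0\<close>, and \<open>q < 1\<close> is given. All terms of the squared error are
  Gaussian averages of the same function \<open>f x * f y\<close>: smoothing with variance
  \<open>1 - q\<close> merely enlarges a diagonal entry. They therefore share one limit and cancel.
  Putting the spin back divides by a cavity average of \<open>cosh\<close>, which is at least
  \<open>1\<close>, so small denominators never occur. The subtracted term in
  \<open>cavity_r\<close> is Gaussian integration by parts: for a normal law with mean
  \<open>r\<close> and variance \<open>1 - q\<close>, the averages of
  \<open>(x - r) * cosh (\<beta> * x + h)\<close> and of
  \<open>\<beta> * (1 - q) * sinh (\<beta> * x + h)\<close> agree. The hypothesis concerns the Gibbs
  measure. Changing to the cavity measure turns the fourth moment of order \<open>1 / N^2\<close>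
  into a second moment of order \<open>1 / N\<close>; the errors are linear in the overlap
  deviation, which gives \<open>1 / sqrt N\<close>.\<close>

definition gauss :: "real measure" where
  "gauss = density lborel std_normal_density"

lemma sets_gauss [simp, measurable_cong]: "sets gauss = sets borel"
  by (simp add: gauss_def)

lemma prob_space_gauss: "prob_space gauss"
  unfolding gauss_def by (rule prob_space_normal_density) simp

interpretation gauss: prob_space gauss
  by (rule prob_space_gauss)

interpretation gauss_pair: pair_prob_space gauss gauss ..

interpretation gauss_fam: product_prob_space "\<lambda>_. gauss" I for I
  by (rule product_prob_spaceI) (rule prob_space_gauss)

lemma nn_integral_gauss:
  assumes [measurable]: "f \<in> borel_measurable borel"
  shows "(\<integral>\<^sup>+x. f x \<partial>gauss) = (\<integral>\<^sup>+x. ennreal (std_normal_density x) * f x \<partial>lborel)"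
  unfolding gauss_def by (subst nn_integral_density) auto

lemma nn_integral_gauss_pair:
  assumes [measurable]: "F \<in> borel_measurable (borel \<Otimes>\<^sub>M borel)"
  shows "(\<integral>\<^sup>+x. \<integral>\<^sup>+y. F (x, y) \<partial>gauss \<partial>gauss)
    = (\<integral>\<^sup>+x. \<integral>\<^sup>+y. ennreal (std_normal_density x * std_normal_density y) * F (x, y) \<partial>lborel \<partial>lborel)"
  by (simp add: nn_integral_gauss ennreal_mult mult.assoc flip: nn_integral_cmult)

lemma std_normal_density_rotate:
  fixes c s x y :: real
  assumes "c\<^sup>2 + s\<^sup>2 = 1"
  shows "std_normal_density (c * x + s * y) * std_normal_density (c * y - s * x)
    = std_normal_density x * std_normal_density y"
proof -
  have "(c * x + s * y)\<^sup>2 + (c * y - s * x)\<^sup>2 = (c\<^sup>2 + s\<^sup>2) * (x\<^sup>2 + y\<^sup>2)"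
    by algebra
  then show ?thesis
    using assms by (simp add: std_normal_density_def field_simps flip: exp_add)
qed

text \<open>The rotation is written as two shears, so that one-dimensional affine substitutions suffice.\<close>

lemma nn_integral_gauss_rotate:
  fixes c s :: real
  assumes cs: "c\<^sup>2 + s\<^sup>2 = 1" "c \<ge> 0"
    and F [measurable]: "F \<in> borel_measurable (borel \<Otimes>\<^sub>M borel)"
  shows "(\<integral>\<^sup>+x. \<integral>\<^sup>+y. F (c * x - s * y, s * x + c * y) \<partial>gauss \<partial>gauss)
    = (\<integral>\<^sup>+x. \<integral>\<^sup>+y. F (x, y) \<partial>gauss \<partial>gauss)"
proof (cases "s = 0")
  case True
  \<comment> \<open>The shears divide by \<open>s\<close>; for \<open>s = 0\<close> the sign of
    \<open>c\<close> leaves only the identity rotation.\<close>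
  then have "c = 1" using cs by (simp add: power2_eq_1_iff)
  then show ?thesis using True by simp
next
  case False
  let ?\<phi> = std_normal_density
  have id1: "c * x - s * (c * x / s - z / s) = z" for x z :: real
    using False by (simp add: field_simps)
  have id2: "s * x + c * (c * x / s - z / s) = x / s - c * z / s" for x z :: real
  proof -
    have "s * x + c * (c * x / s - z / s) = ((c\<^sup>2 + s\<^sup>2) * x - c * z) / s"
      using False by (simp add: field_simps power2_eq_square)
    then show ?thesis using cs by (simp add: diff_divide_distrib)
  qed
  have "(\<integral>\<^sup>+x. \<integral>\<^sup>+y. F (c * x - s * y, s * x + c * y) \<partial>gauss \<partial>gauss)
    = (\<integral>\<^sup>+x. \<integral>\<^sup>+y. ennreal (?\<phi> x * ?\<phi> y) * F (c * x - s * y, s * x + c * y) \<partial>lborel \<partial>lborel)"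
    by (rule nn_integral_gauss_pair[of "\<lambda>(x, y). F (c * x - s * y, s * x + c * y)", simplified]) measurable
  \<comment> \<open>First shear, with \<open>x\<close> fixed: \<open>y = (c * x - z) / s\<close>
    turns the first argument of \<open>F\<close> into \<open>z\<close>.\<close>
  also have "\<dots> = (\<integral>\<^sup>+x. \<integral>\<^sup>+z. ennreal \<bar>- 1 / s\<bar> * (ennreal (?\<phi> x * ?\<phi> (c * x / s + (- 1 / s) * z))
      * F (c * x - s * (c * x / s + (- 1 / s) * z), s * x + c * (c * x / s + (- 1 / s) * z))) \<partial>lborel \<partial>lborel)"
  proof (rule nn_integral_cong)
    fix x :: real
    show "(\<integral>\<^sup>+y. ennreal (?\<phi> x * ?\<phi> y) * F (c * x - s * y, s * x + c * y) \<partial>lborel)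
      = (\<integral>\<^sup>+z. ennreal \<bar>- 1 / s\<bar> * (ennreal (?\<phi> x * ?\<phi> (c * x / s + (- 1 / s) * z))
      * F (c * x - s * (c * x / s + (- 1 / s) * z), s * x + c * (c * x / s + (- 1 / s) * z))) \<partial>lborel)"
      using False
      by (subst nn_integral_real_affine[where c="- 1 / s" and t="c * x / s"]) (auto simp: nn_integral_cmult)
  qed
  also have "\<dots> = (\<integral>\<^sup>+x. \<integral>\<^sup>+z. ennreal \<bar>1 / s\<bar> * (ennreal (?\<phi> x * ?\<phi> (c * x / s - z / s))
      * F (z, x / s - c * z / s)) \<partial>lborel \<partial>lborel)"
    using id1 id2 by simp
  also have "\<dots> = (\<integral>\<^sup>+z. \<integral>\<^sup>+x. ennreal \<bar>1 / s\<bar> * (ennreal (?\<phi> x * ?\<phi> (c * x / s - z / s))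
      * F (z, x / s - c * z / s)) \<partial>lborel \<partial>lborel)"
    by (rule lborel_pair.Fubini'[symmetric]) simp
  \<comment> \<open>Second shear, with \<open>z\<close> fixed: \<open>x = c * z + s * t\<close>
    turns the second argument into \<open>t\<close>; the two Jacobians cancel.\<close>
  also have "\<dots> = (\<integral>\<^sup>+z. \<integral>\<^sup>+t. ennreal (?\<phi> z * ?\<phi> t) * F (z, t) \<partial>lborel \<partial>lborel)"
  proof (rule nn_integral_cong)
    fix z :: real
    have e1: "c * (c * z + s * t) / s - z / s = c * t - s * z" for t
    proof -
      have "c * (c * z + s * t) / s - z / s = ((c\<^sup>2 + s\<^sup>2) * z - z - s\<^sup>2 * z + c * s * t) / s"
        using False by (simp add: field_simps power2_eq_square)
      also have "\<dots> = c * t - s * z"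
        using False by (simp add: cs(1)) (simp add: field_simps power2_eq_square)
      finally show ?thesis .
    qed
    have e2: "(c * z + s * t) / s - c * z / s = t" for t
      using False by (simp add: field_simps)
    have "(\<integral>\<^sup>+x. ennreal \<bar>1 / s\<bar> * (ennreal (?\<phi> x * ?\<phi> (c * x / s - z / s))
      * F (z, x / s - c * z / s)) \<partial>lborel)
      = (\<integral>\<^sup>+t. ennreal \<bar>s\<bar> * (ennreal \<bar>1 / s\<bar> * (ennreal (?\<phi> (c * z + s * t) *
         ?\<phi> (c * (c * z + s * t) / s - z / s)) * F (z, (c * z + s * t) / s - c * z / s))) \<partial>lborel)"
      using False
      by (subst nn_integral_real_affine[where c=s and t="c * z"]) (auto simp: nn_integral_cmult)
    also have "\<dots> = (\<integral>\<^sup>+t. ennreal (?\<phi> z * ?\<phi> t) * F (z, t) \<partial>lborel)"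
      using False cs
      by (intro nn_integral_cong)
        (simp add: e1 e2 std_normal_density_rotate flip: mult.assoc ennreal_mult)
    finally show "(\<integral>\<^sup>+x. ennreal \<bar>1 / s\<bar> * (ennreal (?\<phi> x * ?\<phi> (c * x / s - z / s))
      * F (z, x / s - c * z / s)) \<partial>lborel) = (\<integral>\<^sup>+t. ennreal (?\<phi> z * ?\<phi> t) * F (z, t) \<partial>lborel)" .
  qed
  also have "\<dots> = (\<integral>\<^sup>+x. \<integral>\<^sup>+y. F (x, y) \<partial>gauss \<partial>gauss)"
    by (rule nn_integral_gauss_pair[symmetric]) simp
  finally show ?thesis .
qed

text \<open>Rotating the plane so that \<open>(u, v)\<close> points along the first axis leaves a
  function of one variable; the other variable integrates to \<open>1\<close>.\<close>

lemma nn_integral_gauss_sum2: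
  fixes u v :: real
  assumes "u \<ge> 0" and [measurable]: "f \<in> borel_measurable borel"
  shows "(\<integral>\<^sup>+x. \<integral>\<^sup>+y. f (u * x + v * y) \<partial>gauss \<partial>gauss) = (\<integral>\<^sup>+x. f (sqrt (u\<^sup>2 + v\<^sup>2) * x) \<partial>gauss)"
proof (cases "u = 0 \<and> v = 0")
  case True
  then show ?thesis by (simp add: gauss.emeasure_space_1[simplified])
next
  case False
  define \<rho> where "\<rho> = sqrt (u\<^sup>2 + v\<^sup>2)"
  have \<rho>: "\<rho> > 0" "\<rho>\<^sup>2 = u\<^sup>2 + v\<^sup>2"
    using False by (auto simp: \<rho>_def sum_power2_gt_zero_iff)
  have cs: "(u / \<rho>)\<^sup>2 + (v / \<rho>)\<^sup>2 = 1"
    using \<rho>(1) by (simp add: power_divide \<rho>(2)[symmetric] flip: add_divide_distrib)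
  have eq: "u * (u / \<rho> * x - v / \<rho> * y) + v * (v / \<rho> * x + u / \<rho> * y) = \<rho> * x" for x y
  proof -
    have "u * (u / \<rho> * x - v / \<rho> * y) + v * (v / \<rho> * x + u / \<rho> * y) = (u\<^sup>2 + v\<^sup>2) * x / \<rho>"
      using \<rho>(1) by (simp add: field_simps power2_eq_square)
    also have "\<dots> = \<rho>\<^sup>2 * x / \<rho>" by (simp only: \<rho>(2))
    finally show ?thesis using \<rho>(1) by (simp add: power2_eq_square)
  qed
  have "(\<integral>\<^sup>+x. \<integral>\<^sup>+y. f (u * x + v * y) \<partial>gauss \<partial>gauss)
    = (\<integral>\<^sup>+x. \<integral>\<^sup>+y. f (u * (u / \<rho> * x - v / \<rho> * y) + v * (v / \<rho> * x + u / \<rho> * y)) \<partial>gauss \<partial>gauss)"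
    using nn_integral_gauss_rotate[OF cs, of "\<lambda>(x, y). f (u * x + v * y)"] \<rho> assms by simp
  then show ?thesis
    unfolding eq by (simp add: \<rho>_def gauss.emeasure_space_1[simplified])
qed

text \<open>The centred Gaussian law on the plane with covariance matrix \<open>((a, c), (c, b))\<close>.
  For \<open>a = 0\<close> we must have \<open>c = 0\<close>, and then the divisions by \<open>0\<close> give the right value.\<close>

definition bigauss :: "real \<Rightarrow> real \<Rightarrow> real \<Rightarrow> (real \<times> real) measure" where
  "bigauss a c b = distr (gauss \<Otimes>\<^sub>M gauss) (borel \<Otimes>\<^sub>M borel)
     (\<lambda>(x, y). (sqrt a * x, c / sqrt a * x + sqrt (b - c\<^sup>2 / a) * y))"

lemma sets_bigauss [simp, measurable_cong]: "sets (bigauss a c b) = sets (borel \<Otimes>\<^sub>M borel)"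
  by (simp add: bigauss_def)

lemma prob_space_bigauss: "prob_space (bigauss a c b)"
  unfolding bigauss_def by (rule gauss_pair.P.prob_space_distr) measurable

lemma nn_integral_bigauss:
  assumes [measurable]: "F \<in> borel_measurable (borel \<Otimes>\<^sub>M borel)"
  shows "(\<integral>\<^sup>+z. F z \<partial>bigauss a c b)
    = (\<integral>\<^sup>+x. \<integral>\<^sup>+y. F (sqrt a * x, c / sqrt a * x + sqrt (b - c\<^sup>2 / a) * y) \<partial>gauss \<partial>gauss)"
  unfolding bigauss_def by (subst nn_integral_distr) (auto simp: gauss.nn_integral_fst[symmetric])

text \<open>Independent noise along \<open>(u, v)\<close> adds a rank-one matrix to the covariance.
  In the representation of \<open>bigauss\<close>, a rotation of \<open>(x, z)\<close> makes the
  first coordinate depend on \<open>x\<close> alone; what remains of \<open>z\<close> in the second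
  coordinate is merged with \<open>y\<close>. This is the induction step for linear
  functionals.\<close>

lemma nn_integral_gauss_three:
  fixes a c b u v :: real
  assumes "a \<ge> 0" "b \<ge> 0" "c\<^sup>2 \<le> a * b"
    and F [measurable]: "F \<in> borel_measurable (borel \<Otimes>\<^sub>M borel)"
  shows "(\<integral>\<^sup>+z. \<integral>\<^sup>+p. F (fst p + u * z, snd p + v * z) \<partial>bigauss a c b \<partial>gauss)
    = (\<integral>\<^sup>+p. F p \<partial>bigauss (a + u\<^sup>2) (c + u * v) (b + v\<^sup>2))"
proof -
  define \<alpha> \<beta> \<delta> where "\<alpha> = sqrt a" "\<beta> = c / sqrt a" "\<delta> = sqrt (b - c\<^sup>2 / a)"
  have \<alpha>: "\<alpha> \<ge> 0" "\<alpha>\<^sup>2 = a" "\<alpha> * \<beta> = c"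
    using assms by (auto simp: \<alpha>_\<beta>_\<delta>_def)
  have "c\<^sup>2 / a \<le> b"
    using assms by (cases "a = 0") (auto simp: field_simps)
  then have \<delta>: "\<delta> \<ge> 0" "\<delta>\<^sup>2 = b - c\<^sup>2 / a"
    by (auto simp: \<alpha>_\<beta>_\<delta>_def)
  have b: "\<beta>\<^sup>2 + \<delta>\<^sup>2 = b"
    using assms unfolding \<delta> by (simp add: \<alpha>_\<beta>_\<delta>_def power_divide)
  have *: "(\<integral>\<^sup>+z. \<integral>\<^sup>+p. F (fst p + u * z, snd p + v * z) \<partial>bigauss a c b \<partial>gauss)
    = (\<integral>\<^sup>+z. \<integral>\<^sup>+x. \<integral>\<^sup>+y. F (\<alpha> * x + u * z, \<beta> * x + \<delta> * y + v * z) \<partial>gauss \<partial>gauss \<partial>gauss)"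
    by (intro nn_integral_cong, subst nn_integral_bigauss) (auto simp: \<alpha>_\<beta>_\<delta>_def)
  show ?thesis
  proof (cases "a + u\<^sup>2 = 0")
    \<comment> \<open>The first coordinate vanishes identically, so there is no direction to rotate
      onto and only the second coordinate has to be summed.\<close>
    case True
    then have 0: "a = 0" "u = 0" using assms by (auto simp: add_nonneg_eq_0_iff)
    then have "\<alpha> = 0" "\<beta> = 0" "c = 0" using assms by (auto simp: \<alpha>_\<beta>_\<delta>_def)
    then have "(\<integral>\<^sup>+z. \<integral>\<^sup>+p. F (fst p + u * z, snd p + v * z) \<partial>bigauss a c b \<partial>gauss)
      = (\<integral>\<^sup>+z. \<integral>\<^sup>+y. F (0, \<delta> * y + v * z) \<partial>gauss \<partial>gauss)"
      unfolding * using 0 by (simp add: gauss.emeasure_space_1[simplified])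
    also have "\<dots> = (\<integral>\<^sup>+y. \<integral>\<^sup>+z. F (0, \<delta> * y + v * z) \<partial>gauss \<partial>gauss)"
      by (rule gauss_pair.Fubini') simp
    also have "\<dots> = (\<integral>\<^sup>+y. F (0, sqrt (\<delta>\<^sup>2 + v\<^sup>2) * y) \<partial>gauss)"
      by (rule nn_integral_gauss_sum2) (use \<delta> in auto)
    also have "\<dots> = (\<integral>\<^sup>+p. F p \<partial>bigauss (a + u\<^sup>2) (c + u * v) (b + v\<^sup>2))"
      using 0 b \<open>c = 0\<close> \<open>\<beta> = 0\<close>
      by (subst nn_integral_bigauss) (auto simp: gauss.emeasure_space_1[simplified])
    finally show ?thesis .
  next
    case False
    define \<rho> where "\<rho> = sqrt (a + u\<^sup>2)"
    have \<rho>: "\<rho> > 0" "\<rho>\<^sup>2 = \<alpha>\<^sup>2 + u\<^sup>2"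
      using False assms \<alpha> by (auto simp: \<rho>_def add_nonneg_pos less_le)
    \<comment> \<open>Coordinates of \<open>(\<beta>, v)\<close> in the orthonormal basis whose
      first vector is \<open>(\<alpha>, u) / \<rho>\<close>.\<close>
    define \<beta>' v' where "\<beta>' = (\<alpha> * \<beta> + u * v) / \<rho>" "v' = (v * \<alpha> - \<beta> * u) / \<rho>"
    have cs: "(\<alpha> / \<rho>)\<^sup>2 + (u / \<rho>)\<^sup>2 = 1"
      using \<rho>(1) by (simp add: power_divide \<rho>(2)[symmetric] flip: add_divide_distrib)
    have e1: "\<alpha> * (\<alpha> / \<rho> * x - u / \<rho> * z) + u * (u / \<rho> * x + \<alpha> / \<rho> * z) = \<rho> * x" for x z
    proof -
      have "\<alpha> * (\<alpha> / \<rho> * x - u / \<rho> * z) + u * (u / \<rho> * x + \<alpha> / \<rho> * z) = (\<alpha>\<^sup>2 + u\<^sup>2) * x / \<rho>"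
        using \<rho>(1) by (simp add: field_simps power2_eq_square)
      also have "\<dots> = \<rho>\<^sup>2 * x / \<rho>" by (simp only: \<rho>(2))
      finally show ?thesis using \<rho>(1) by (simp add: power2_eq_square)
    qed
    have e2: "\<beta> * (\<alpha> / \<rho> * x - u / \<rho> * z) + \<delta> * y + v * (u / \<rho> * x + \<alpha> / \<rho> * z)
        = \<beta>' * x + (\<delta> * y + v' * z)" for x y z
      using \<rho>(1) by (simp add: \<beta>'_v'_def field_simps)
    \<comment> \<open>Lagrange's identity: the rotation preserves the length of
      \<open>(\<beta>, v)\<close>, so the second variance comes out as
      \<open>b + v^2\<close>.\<close>
    have "\<beta>'\<^sup>2 + v'\<^sup>2 = ((\<alpha>\<^sup>2 + u\<^sup>2) * (\<beta>\<^sup>2 + v\<^sup>2)) / \<rho>\<^sup>2"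
      unfolding \<beta>'_v'_def power_divide add_divide_distrib[symmetric]
      by (rule arg_cong2[where f="(/)"]) (auto simp: algebra_simps power2_eq_square)
    then have sq: "\<beta>'\<^sup>2 + v'\<^sup>2 = \<beta>\<^sup>2 + v\<^sup>2"
      unfolding \<rho>(2)[symmetric] using \<rho>(1) by simp
    have "(\<integral>\<^sup>+z. \<integral>\<^sup>+p. F (fst p + u * z, snd p + v * z) \<partial>bigauss a c b \<partial>gauss)
      = (\<integral>\<^sup>+x. \<integral>\<^sup>+z. \<integral>\<^sup>+y. F (\<alpha> * x + u * z, \<beta> * x + \<delta> * y + v * z) \<partial>gauss \<partial>gauss \<partial>gauss)"
      unfolding * by (rule gauss_pair.Fubini') simp
    also have "\<dots> = (\<integral>\<^sup>+x. \<integral>\<^sup>+z. \<integral>\<^sup>+y. F (\<rho> * x, \<beta>' * x + (\<delta> * y + v' * z)) \<partial>gauss \<partial>gauss \<partial>gauss)"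
      by (rule nn_integral_gauss_rotate[OF cs, symmetric,
            of "\<lambda>(x, z). \<integral>\<^sup>+y. F (\<alpha> * x + u * z, \<beta> * x + \<delta> * y + v * z) \<partial>gauss",
            unfolded prod.case e1 e2])
        (use \<rho> \<alpha> in auto)
    also have "\<dots> = (\<integral>\<^sup>+x. \<integral>\<^sup>+y. \<integral>\<^sup>+z. F (\<rho> * x, \<beta>' * x + (\<delta> * y + v' * z)) \<partial>gauss \<partial>gauss \<partial>gauss)"
      by (intro nn_integral_cong gauss_pair.Fubini') simp
    also have "\<dots> = (\<integral>\<^sup>+x. \<integral>\<^sup>+y. F (\<rho> * x, \<beta>' * x + sqrt (\<delta>\<^sup>2 + v'\<^sup>2) * y) \<partial>gauss \<partial>gauss)"
    proof (rule nn_integral_cong)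
      fix x
      show "(\<integral>\<^sup>+y. \<integral>\<^sup>+z. F (\<rho> * x, \<beta>' * x + (\<delta> * y + v' * z)) \<partial>gauss \<partial>gauss)
          = (\<integral>\<^sup>+y. F (\<rho> * x, \<beta>' * x + sqrt (\<delta>\<^sup>2 + v'\<^sup>2) * y) \<partial>gauss)"
        by (rule nn_integral_gauss_sum2[where f="\<lambda>t. F (\<rho> * x, \<beta>' * x + t)"]) (use \<delta> in auto)
    qed
    also have "\<dots> = (\<integral>\<^sup>+p. F p \<partial>bigauss (a + u\<^sup>2) (c + u * v) (b + v\<^sup>2))"
    proof -
      have "\<beta>' = (c + u * v) / sqrt (a + u\<^sup>2)"
        using \<alpha> by (simp add: \<beta>'_v'_def \<rho>_def)
      moreover from this have "\<beta>'\<^sup>2 = (c + u * v)\<^sup>2 / (a + u\<^sup>2)"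
        using assms by (simp add: power_divide)
      moreover have "\<delta>\<^sup>2 + v'\<^sup>2 = b + v\<^sup>2 - \<beta>'\<^sup>2"
        using sq b by simp
      ultimately show ?thesis
        by (subst nn_integral_bigauss) (auto simp: \<rho>_def)
    qed
    finally show ?thesis .
  qed
qed

section \<open>Joint laws of two linear functionals of independent normals\<close>

text \<open>Induction on \<open>J\<close>: each new coordinate is an independent normal entering
  along \<open>(p i, r i)\<close>. The admissibility condition on the covariance of the earlier
  coordinates is the Cauchy-Schwarz inequality.\<close>

lemma nn_integral_linear_functionals:
  fixes p r :: "'a \<Rightarrow> real"
  assumes "finite J" and F: "F \<in> borel_measurable (borel \<Otimes>\<^sub>M borel)"
  shows "(\<integral>\<^sup>+g. F (\<Sum>j\<in>J. p j * g j, \<Sum>j\<in>J. r j * g j) \<partial>PiM J (\<lambda>_. gauss))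
    = (\<integral>\<^sup>+z. F z \<partial>bigauss (\<Sum>j\<in>J. (p j)\<^sup>2) (\<Sum>j\<in>J. p j * r j) (\<Sum>j\<in>J. (r j)\<^sup>2))"
  using assms
proof (induction J arbitrary: F rule: finite_induct)
  case empty
  then show ?case
    by (subst nn_integral_bigauss) (auto simp: gauss_fam.nn_integral_empty gauss.emeasure_space_1[simplified]
        prob_space.emeasure_space_1[OF prob_space_PiM[OF prob_space_gauss]])
next
  case (insert i J)
  note [measurable] = insert.prems
  have upd: "(\<Sum>j\<in>J. q j * (g(i := y)) j) = (\<Sum>j\<in>J. q j * g j)" for q g y
    using insert.hyps by (intro sum.cong) auto
  have "(\<integral>\<^sup>+g. F (\<Sum>j\<in>insert i J. p j * g j, \<Sum>j\<in>insert i J. r j * g j) \<partial>PiM (insert i J) (\<lambda>_. gauss))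
    = (\<integral>\<^sup>+y. \<integral>\<^sup>+g. F ((\<Sum>j\<in>J. p j * g j) + p i * y, (\<Sum>j\<in>J. r j * g j) + r i * y) \<partial>PiM J (\<lambda>_. gauss) \<partial>gauss)"
    using insert.hyps
    by (subst gauss_fam.product_nn_integral_insert_rev) (auto simp: upd add.commute[of "p i * _"] add.commute[of "r i * _"] simp del: fun_upd_apply, simp)
  also have "\<dots> = (\<integral>\<^sup>+y. \<integral>\<^sup>+z. F (fst z + p i * y, snd z + r i * y)
      \<partial>bigauss (\<Sum>j\<in>J. (p j)\<^sup>2) (\<Sum>j\<in>J. p j * r j) (\<Sum>j\<in>J. (r j)\<^sup>2) \<partial>gauss)"
    by (intro nn_integral_cong insert.IH[of "\<lambda>z. F (fst z + p i * y, snd z + r i * y)" for y, simplified]) measurable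
  also have "\<dots> = (\<integral>\<^sup>+z. F z \<partial>bigauss ((\<Sum>j\<in>J. (p j)\<^sup>2) + (p i)\<^sup>2)
      ((\<Sum>j\<in>J. p j * r j) + p i * r i) ((\<Sum>j\<in>J. (r j)\<^sup>2) + (r i)\<^sup>2))"
    by (rule nn_integral_gauss_three) (auto simp: sum_nonneg Cauchy_Schwarz_ineq_sum insert.prems)
  finally show ?case using insert.hyps by (simp add: add.commute)
qed

lemma distr_linear_functionals:
  fixes p r :: "'a \<Rightarrow> real"
  assumes "finite J"
  shows "distr (PiM J (\<lambda>_. gauss)) (borel \<Otimes>\<^sub>M borel) (\<lambda>g. (\<Sum>j\<in>J. p j * g j, \<Sum>j\<in>J. r j * g j))
    = bigauss (\<Sum>j\<in>J. (p j)\<^sup>2) (\<Sum>j\<in>J. p j * r j) (\<Sum>j\<in>J. (r j)\<^sup>2)" (is "?L = ?R")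
proof (rule measure_eqI)
  fix A assume "A \<in> sets ?L"
  then have A [measurable]: "A \<in> sets (borel \<Otimes>\<^sub>M borel)" by simp
  have "emeasure ?L A = (\<integral>\<^sup>+z. indicator A z \<partial>?L)" by simp
  also have "\<dots> = (\<integral>\<^sup>+g. indicator A (\<Sum>j\<in>J. p j * g j, \<Sum>j\<in>J. r j * g j) \<partial>PiM J (\<lambda>_. gauss))"
    by (subst nn_integral_distr) auto
  also have "\<dots> = emeasure ?R A"
    by (subst nn_integral_linear_functionals) (use assms in auto)
  finally show "emeasure ?L A = emeasure ?R A" .
qed simp

text \<open>As an identity of measures, the addition of noise also becomes available for signed
  integrands.\<close>

lemma distr_bigauss_add_noise:
  assumes "a \<ge> 0" "b \<ge> 0" "c\<^sup>2 \<le> a * b"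
  shows "distr (bigauss a c b \<Otimes>\<^sub>M gauss) (borel \<Otimes>\<^sub>M borel)
      (\<lambda>(p, z). (fst p + u * z, snd p + v * z)) = bigauss (a + u\<^sup>2) (c + u * v) (b + v\<^sup>2)" (is "?L = ?R")
proof (rule measure_eqI)
  interpret B: prob_space "bigauss a c b" by (rule prob_space_bigauss)
  interpret P: pair_prob_space "bigauss a c b" gauss ..
  fix A assume "A \<in> sets ?L"
  then have A [measurable]: "A \<in> sets (borel \<Otimes>\<^sub>M borel)" by simp
  have "emeasure ?L A = (\<integral>\<^sup>+z. indicator A z \<partial>?L)" by simp
  also have "\<dots> = (\<integral>\<^sup>+w. indicator A (fst (fst w) + u * snd w, snd (fst w) + v * snd w) \<partial>(bigauss a c b \<Otimes>\<^sub>M gauss))"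
    by (subst nn_integral_distr) (auto simp: case_prod_beta)
  also have "\<dots> = (\<integral>\<^sup>+z. \<integral>\<^sup>+p. indicator A (fst p + u * z, snd p + v * z) \<partial>bigauss a c b \<partial>gauss)"
    by (subst P.nn_integral_snd[symmetric]) auto
  also have "\<dots> = emeasure ?R A"
    by (subst nn_integral_gauss_three) (use assms in auto)
  finally show "emeasure ?L A = emeasure ?R A" .
qed simp

section \<open>Exponential moments\<close>

text \<open>Completing the square: the weight \<open>exp (t * x)\<close> shifts the mean of the
  standard normal law to \<open>t\<close>, at the price of the factor
  \<open>exp (t^2 / 2)\<close>.\<close>

lemma integral_gauss_exp_mult:
  assumes [measurable]: "f \<in> borel_measurable borel"
    and "has_bochner_integral lborel (\<lambda>x. normal_density t 1 x * f x) v"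
  shows "has_bochner_integral gauss (\<lambda>x. f x * exp (t * x)) (exp (t\<^sup>2 / 2) * v)"
proof -
  have eq: "std_normal_density x * (f x * exp (t * x)) = exp (t\<^sup>2 / 2) * (normal_density t 1 x * f x)" for x
  proof -
    have "- x\<^sup>2 / 2 + t * x = t\<^sup>2 / 2 + (- (x - t)\<^sup>2 / 2)"
      by (simp add: power2_eq_square field_simps)
    then have "exp (- x\<^sup>2 / 2) * exp (t * x) = exp (t\<^sup>2 / 2) * exp (- (x - t)\<^sup>2 / 2)"
      by (simp flip: exp_add)
    then show ?thesis by (simp add: normal_density_def)
  qed
  have "has_bochner_integral lborel (\<lambda>x. std_normal_density x * (f x * exp (t * x))) (exp (t\<^sup>2 / 2) * v)"
    unfolding eq using assms(2) by (rule has_bochner_integral_mult_right)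
  then show ?thesis
    unfolding gauss_def by (intro has_bochner_integral_density) auto
qed

lemma has_bochner_integral_gauss_exp:
  "has_bochner_integral gauss (\<lambda>x. exp (t * x)) (exp (t\<^sup>2 / 2))"
  using integral_gauss_exp_mult[of "\<lambda>_. 1" t 1] by (simp add: has_bochner_integral_iff)

text \<open>The total mass of the shifted law, that is, the moment generating function.\<close>

lemma has_bochner_integral_gauss_square_exp:
  "has_bochner_integral gauss (\<lambda>x. (\<alpha> * x - k)\<^sup>2 * exp (t * x)) (exp (t\<^sup>2 / 2) * (\<alpha>\<^sup>2 + (\<alpha> * t - k)\<^sup>2))"
proof (rule integral_gauss_exp_mult)
  have 0: "has_bochner_integral lborel (normal_density t 1) 1"
    by (simp add: has_bochner_integral_iff)
  have 1: "has_bochner_integral lborel (\<lambda>x. normal_density t 1 x * (x - t)) 0"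
    using normal_moment_odd[of 1 t 0] by simp
  have 2: "has_bochner_integral lborel (\<lambda>x. normal_density t 1 x * (x - t)\<^sup>2) 1"
    using normal_moment_even[of 1 t 1] by simp
  have eq: "normal_density t 1 x * (\<alpha> * x - k)\<^sup>2 = \<alpha>\<^sup>2 * (normal_density t 1 x * (x - t)\<^sup>2)
    + 2 * \<alpha> * (\<alpha> * t - k) * (normal_density t 1 x * (x - t)) + (\<alpha> * t - k)\<^sup>2 * normal_density t 1 x" for x
    by (simp add: power2_eq_square algebra_simps)
  have "has_bochner_integral lborel (\<lambda>x. normal_density t 1 x * (\<alpha> * x - k)\<^sup>2)
    (\<alpha>\<^sup>2 * 1 + 2 * \<alpha> * (\<alpha> * t - k) * 0 + (\<alpha> * t - k)\<^sup>2 * 1)"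
    unfolding eq
    by (intro has_bochner_integral_add has_bochner_integral_mult_right 0 1 2)
  then show "has_bochner_integral lborel (\<lambda>x. normal_density t 1 x * (\<alpha> * x - k)\<^sup>2) (\<alpha>\<^sup>2 + (\<alpha> * t - k)\<^sup>2)"
    by simp
qed measurable

text \<open>Moments of \<open>bigauss\<close> reduce to one-dimensional ones whenever the integrand
  factors in the two independent variables behind it; nonnegativity of the factors allows Tonelli's
  theorem.\<close>

lemma has_bochner_integral_bigauss_product:
  fixes f g :: "real \<Rightarrow> real" and h :: "real \<times> real \<Rightarrow> real"
  assumes f: "has_bochner_integral gauss f v" "\<And>x. 0 \<le> f x"
    and g: "has_bochner_integral gauss g w" "\<And>x. 0 \<le> g x"
    and h [measurable]: "h \<in> borel_measurable (borel \<Otimes>\<^sub>M borel)"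
    and eq: "\<And>x y. h (sqrt a * x, c / sqrt a * x + sqrt (b - c\<^sup>2 / a) * y) = f x * g y"
  shows "has_bochner_integral (bigauss a c b) h (v * w)"
proof -
  have m [measurable]: "f \<in> borel_measurable borel" "g \<in> borel_measurable borel"
    using f(1) g(1) by (auto dest!: borel_measurable_has_bochner_integral simp: measurable_cong_sets[OF sets_gauss refl])
  have "0 \<le> integral\<^sup>L gauss f" using f(2) by (intro integral_nonneg_AE AE_I2)
  moreover have "0 \<le> integral\<^sup>L gauss g" using g(2) by (intro integral_nonneg_AE AE_I2)
  ultimately have nn: "0 \<le> v" "0 \<le> w"
    using f(1) g(1) by (simp_all add: has_bochner_integral_iff)
  have int: "(\<integral>\<^sup>+x. f x \<partial>gauss) = v" "(\<integral>\<^sup>+x. g x \<partial>gauss) = w"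
    using f g by (auto simp: has_bochner_integral_iff nn_integral_eq_integral)
  have "has_bochner_integral (gauss \<Otimes>\<^sub>M gauss) (\<lambda>(x, y). f x * g y) (v * w)"
  proof (rule has_bochner_integral_nn_integral)
    have "(\<integral>\<^sup>+p. ennreal (case p of (x, y) \<Rightarrow> f x * g y) \<partial>(gauss \<Otimes>\<^sub>M gauss))
        = (\<integral>\<^sup>+x. \<integral>\<^sup>+y. ennreal (f x) * ennreal (g y) \<partial>gauss \<partial>gauss)"
      using f g by (subst gauss.nn_integral_fst[symmetric]) (auto simp: ennreal_mult)
    also have "\<dots> = ennreal (v * w)"
      using nn by (simp add: nn_integral_cmult nn_integral_multc int ennreal_mult)
    finally show "(\<integral>\<^sup>+p. ennreal (case p of (x, y) \<Rightarrow> f x * g y) \<partial>(gauss \<Otimes>\<^sub>M gauss)) = ennreal (v * w)" .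
  qed (use f g nn in auto)
  then show ?thesis
    unfolding bigauss_def has_bochner_integral_iff
    by (simp add: integral_distr integrable_distr_eq case_prod_beta' flip: eq)
qed

lemma bigauss_parameters:
  assumes "a \<ge> 0" "b \<ge> 0" "c\<^sup>2 \<le> a * b"
  shows "sqrt a * (c / sqrt a) = c" "(c / sqrt a)\<^sup>2 + (sqrt (b - c\<^sup>2 / a))\<^sup>2 = b"
proof -
  show "sqrt a * (c / sqrt a) = c" using assms by auto
  have "c\<^sup>2 / a \<le> b"
    using assms by (cases "a = 0") (auto simp: field_simps)
  then show "(c / sqrt a)\<^sup>2 + (sqrt (b - c\<^sup>2 / a))\<^sup>2 = b"
    using assms by (simp add: power_divide)
qed

lemma has_bochner_integral_bigauss_exp:
  assumes "a \<ge> 0" "b \<ge> 0" "c\<^sup>2 \<le> a * b"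
  shows "has_bochner_integral (bigauss a c b) (\<lambda>z. exp (s * fst z + t * snd z))
    (exp ((s\<^sup>2 * a + 2 * s * t * c + t\<^sup>2 * b) / 2))"
proof -
  define \<alpha> \<beta> \<delta> where "\<alpha> = sqrt a" "\<beta> = c / sqrt a" "\<delta> = sqrt (b - c\<^sup>2 / a)"
  have p: "\<alpha>\<^sup>2 = a" "\<alpha> * \<beta> = c" "\<beta>\<^sup>2 + \<delta>\<^sup>2 = b"
    using bigauss_parameters[of a b c] assms unfolding \<alpha>_\<beta>_\<delta>_def by auto
  have \<beta>: "c / \<alpha> = \<beta>" by (simp add: \<alpha>_\<beta>_\<delta>_def)
  have "has_bochner_integral (bigauss a c b) (\<lambda>z. exp (s * fst z + t * snd z))
    (exp ((s * \<alpha> + t * \<beta>)\<^sup>2 / 2) * exp ((t * \<delta>)\<^sup>2 / 2))"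
    by (rule has_bochner_integral_bigauss_product[OF has_bochner_integral_gauss_exp _ has_bochner_integral_gauss_exp])
      (auto simp: \<alpha>_\<beta>_\<delta>_def(1,3)[symmetric] \<beta> algebra_simps simp del: times_divide_eq_left simp flip: exp_add)
  moreover have "(s * \<alpha> + t * \<beta>)\<^sup>2 + (t * \<delta>)\<^sup>2 = s\<^sup>2 * a + 2 * s * t * c + t\<^sup>2 * b"
    unfolding p[symmetric] by (simp add: power2_eq_square algebra_simps)
  ultimately show ?thesis
    by (simp flip: exp_add add_divide_distrib)
qed

text \<open>The weight \<open>exp (snd z)\<close> shifts the mean of \<open>fst z\<close> to its
  covariance \<open>c\<close> with \<open>snd z\<close> and keeps its variance
  \<open>a\<close>.\<close>

lemma has_bochner_integral_bigauss_square_exp: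
  assumes "a \<ge> 0" "b \<ge> 0" "c\<^sup>2 \<le> a * b"
  shows "has_bochner_integral (bigauss a c b) (\<lambda>z. (fst z - k)\<^sup>2 * exp (snd z))
    (exp (b / 2) * (a + (c - k)\<^sup>2))"
proof -
  define \<alpha> \<beta> \<delta> where "\<alpha> = sqrt a" "\<beta> = c / sqrt a" "\<delta> = sqrt (b - c\<^sup>2 / a)"
  have p: "\<alpha>\<^sup>2 = a" "\<alpha> * \<beta> = c" "\<beta>\<^sup>2 + \<delta>\<^sup>2 = b"
    using bigauss_parameters[of a b c] assms unfolding \<alpha>_\<beta>_\<delta>_def by auto
  have \<beta>: "c / \<alpha> = \<beta>" by (simp add: \<alpha>_\<beta>_\<delta>_def)
  have "has_bochner_integral (bigauss a c b) (\<lambda>z. (fst z - k)\<^sup>2 * exp (snd z))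
    (exp (\<beta>\<^sup>2 / 2) * (\<alpha>\<^sup>2 + (\<alpha> * \<beta> - k)\<^sup>2) * exp (\<delta>\<^sup>2 / 2))"
    by (rule has_bochner_integral_bigauss_product[OF has_bochner_integral_gauss_square_exp _ has_bochner_integral_gauss_exp])
      (auto simp: \<alpha>_\<beta>_\<delta>_def(1,3)[symmetric] \<beta> exp_add simp del: times_divide_eq_left)
  moreover have "exp (\<beta>\<^sup>2 / 2) * (\<alpha>\<^sup>2 + (\<alpha> * \<beta> - k)\<^sup>2) * exp (\<delta>\<^sup>2 / 2) = exp (b / 2) * (a + (c - k)\<^sup>2)"
    unfolding p[symmetric] by (simp add: exp_add add_divide_distrib)
  ultimately show ?thesis by simp
qed

text \<open>The integrand equals one of the four exponentials with signs and is bounded by their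
  sum. The variance of each exponent is at most \<open>8 * p^2\<close>, because
  \<open>2 * |c|\<close> is at most \<open>a + b\<close>; half of it enters the moment. The range up
  to \<open>2\<close> leaves room for a variance enlarged by \<open>1 - q\<close>.\<close>

lemma bigauss_abs_exp:
  assumes "0 \<le> a" "a \<le> 2" "0 \<le> b" "b \<le> 2" "c\<^sup>2 \<le> a * b"
  shows "integrable (bigauss a c b) (\<lambda>z. exp (p * (\<bar>fst z\<bar> + \<bar>snd z\<bar>)))"
    and "(\<integral>z. exp (p * (\<bar>fst z\<bar> + \<bar>snd z\<bar>)) \<partial>bigauss a c b) \<le> 4 * exp (4 * p\<^sup>2)"
proof -
  define M where "M = (\<lambda>s t z::real \<times> real. exp (s * fst z + t * snd z))"
  define B where "B = (\<lambda>z. M p p z + M p (- p) z + M (- p) p z + M (- p) (- p) z)"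
  have int: "integrable (bigauss a c b) (M s t)" for s t
    using has_bochner_integral_bigauss_exp[of a b c s t] assms
    by (auto simp: has_bochner_integral_iff M_def)
  have le: "exp (p * (\<bar>fst z\<bar> + \<bar>snd z\<bar>)) \<le> B z" for z :: "real \<times> real"
  proof -
    have "exp (p * (\<bar>fst z\<bar> + \<bar>snd z\<bar>)) \<in> {M p p z, M p (- p) z, M (- p) p z, M (- p) (- p) z}"
      by (auto simp: M_def abs_if algebra_simps)
    then show ?thesis unfolding B_def by (auto simp: M_def add_nonneg_nonneg intro: order.strict_implies_order)
  qed
  have intB: "integrable (bigauss a c b) B"
    unfolding B_def by (intro Bochner_Integration.integrable_add int)
  show i: "integrable (bigauss a c b) (\<lambda>z. exp (p * (\<bar>fst z\<bar> + \<bar>snd z\<bar>)))"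
    by (rule Bochner_Integration.integrable_bound[OF intB]) (auto intro!: order_trans[OF le])
  have "2 * \<bar>c\<bar> \<le> a + b"
  proof -
    have "(2 * \<bar>c\<bar>)\<^sup>2 \<le> (a + b)\<^sup>2 - (a - b)\<^sup>2"
      using assms(5) by (simp add: power_mult_distrib) (simp add: power2_eq_square algebra_simps)
    also have "\<dots> \<le> (a + b)\<^sup>2" by simp
    finally show ?thesis by (rule power2_le_imp_le) (use assms in simp)
  qed
  then have c: "2 * \<bar>c\<bar> \<le> 4" using assms by simp
  have M: "(\<integral>z. M s t z \<partial>bigauss a c b) \<le> exp (4 * p\<^sup>2)" if "\<bar>s\<bar> = \<bar>p\<bar>" "\<bar>t\<bar> = \<bar>p\<bar>" for s t
  proof -
    have "s\<^sup>2 = p\<^sup>2" "t\<^sup>2 = p\<^sup>2" using that by (simp_all add: power2_eq_iff abs_eq_iff)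
    then have eq: "s\<^sup>2 * a + 2 * s * t * c + t\<^sup>2 * b = p\<^sup>2 * a + 2 * (s * t * c) + p\<^sup>2 * b" by simp
    have "s * t * c \<le> p\<^sup>2 * \<bar>c\<bar>"
    proof -
      have "s * t * c \<le> \<bar>s * t * c\<bar>" by simp
      also have "\<dots> = p\<^sup>2 * \<bar>c\<bar>" using that by (simp add: abs_mult power2_eq_square)
      finally show ?thesis .
    qed
    moreover have "p\<^sup>2 * \<bar>c\<bar> \<le> p\<^sup>2 * 2" "p\<^sup>2 * a \<le> p\<^sup>2 * 2" "p\<^sup>2 * b \<le> p\<^sup>2 * 2"
      by (rule mult_left_mono; use assms c in simp)+
    ultimately have "(s\<^sup>2 * a + 2 * s * t * c + t\<^sup>2 * b) / 2 \<le> 4 * p\<^sup>2" unfolding eq by argo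
    then show ?thesis
      using has_bochner_integral_bigauss_exp[of a b c s t] assms
      by (auto simp: has_bochner_integral_iff M_def)
  qed
  have "(\<integral>z. exp (p * (\<bar>fst z\<bar> + \<bar>snd z\<bar>)) \<partial>bigauss a c b) \<le> (\<integral>z. B z \<partial>bigauss a c b)"
    by (intro integral_mono i intB le)
  also have "\<dots> = (\<integral>z. M p p z \<partial>bigauss a c b) + (\<integral>z. M p (- p) z \<partial>bigauss a c b)
    + (\<integral>z. M (- p) p z \<partial>bigauss a c b) + (\<integral>z. M (- p) (- p) z \<partial>bigauss a c b)"
    unfolding B_def by (simp add: int)
  also have "\<dots> \<le> 4 * exp (4 * p\<^sup>2)"
    using M[of p p] M[of p "- p"] M[of "- p" p] M[of "- p" "- p"] by simp
  finally show "(\<integral>z. exp (p * (\<bar>fst z\<bar> + \<bar>snd z\<bar>)) \<partial>bigauss a c b) \<le> 4 * exp (4 * p\<^sup>2)" .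
qed

section \<open>Densities of nondegenerate planar laws, and elementary inequalities\<close>

lemma nn_integral_gauss_affine:
  assumes [measurable]: "f \<in> borel_measurable borel" and "\<sigma> > 0"
  shows "(\<integral>\<^sup>+x. f (\<mu> + \<sigma> * x) \<partial>gauss) = (\<integral>\<^sup>+x. ennreal (normal_density \<mu> \<sigma> x) * f x \<partial>lborel)"
proof -
  have eq: "\<sigma> * normal_density \<mu> \<sigma> (\<mu> + \<sigma> * x) = std_normal_density x" for x
    using assms(2) by (simp add: normal_density_def real_sqrt_mult power_mult_distrib)
  have "(\<integral>\<^sup>+x. ennreal (normal_density \<mu> \<sigma> x) * f x \<partial>lborel)
    = (\<integral>\<^sup>+x. ennreal \<sigma> * (ennreal (normal_density \<mu> \<sigma> (\<mu> + \<sigma> * x)) * f (\<mu> + \<sigma> * x)) \<partial>lborel)"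
    using assms(2) by (subst nn_integral_real_affine[where c=\<sigma> and t=\<mu>]) (auto simp: nn_integral_cmult)
  also have "\<dots> = (\<integral>\<^sup>+x. f (\<mu> + \<sigma> * x) \<partial>gauss)"
    using assms(2) by (simp add: nn_integral_gauss eq flip: mult.assoc ennreal_mult)
  finally show ?thesis by simp
qed

lemma distr_gauss_affine:
  assumes "\<sigma> > 0"
  shows "distr gauss borel (\<lambda>x. \<mu> + \<sigma> * x) = density lborel (normal_density \<mu> \<sigma>)" (is "?L = ?R")
proof (rule measure_eqI)
  fix A assume "A \<in> sets ?L"
  then have A [measurable]: "A \<in> sets borel" by simp
  have "emeasure ?L A = (\<integral>\<^sup>+z. indicator A z \<partial>?L)" by simp
  also have "\<dots> = (\<integral>\<^sup>+x. indicator A (\<mu> + \<sigma> * x) \<partial>gauss)"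
    by (subst nn_integral_distr) auto
  also have "\<dots> = (\<integral>\<^sup>+x. ennreal (normal_density \<mu> \<sigma> x) * indicator A x \<partial>lborel)"
    by (rule nn_integral_gauss_affine[OF _ assms]) measurable
  also have "\<dots> = emeasure ?R A"
    by (simp add: emeasure_density)
  finally show "emeasure ?L A = emeasure ?R A" .
qed simp

text \<open>The marginal density of the first coordinate times the conditional density of the
  second, whose mean is the regression \<open>c / a * x\<close> and whose variance is the Schur
  complement \<open>b - c^2 / a\<close>. Thus only one-dimensional normal densities have to be
  compared.\<close>

definition bigauss_density :: "real \<Rightarrow> real \<Rightarrow> real \<Rightarrow> real \<times> real \<Rightarrow> real" where
  "bigauss_density a c b z =
     normal_density 0 (sqrt a) (fst z) * normal_density (c / a * fst z) (sqrt (b - c\<^sup>2 / a)) (snd z)"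

lemma measurable_bigauss_density [measurable]:
  "bigauss_density a c b \<in> borel_measurable (borel \<Otimes>\<^sub>M borel)"
  unfolding bigauss_density_def normal_density_def by measurable

lemma bigauss_eq_density:
  assumes "a > 0" "b - c\<^sup>2 / a > 0"
  shows "bigauss a c b = density (lborel \<Otimes>\<^sub>M lborel) (bigauss_density a c b)" (is "?L = ?R")
proof (rule measure_eqI)
  fix A assume "A \<in> sets ?L"
  then have A [measurable]: "A \<in> sets (borel \<Otimes>\<^sub>M borel)" by simp
  have mn [measurable]: "(\<lambda>x. normal_density (f x) \<sigma> (g x)) \<in> borel_measurable M"
    if "f \<in> borel_measurable M" "g \<in> borel_measurable M" for f g :: "'z \<Rightarrow> real" and \<sigma> and M :: "'z measure"
    using that unfolding normal_density_def by measurable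
  let ?d = "sqrt (b - c\<^sup>2 / a)"
  have "emeasure ?L A = (\<integral>\<^sup>+z. indicator A z \<partial>?L)" by simp
  also have "\<dots> = (\<integral>\<^sup>+x. \<integral>\<^sup>+y. indicator A (sqrt a * x, c / sqrt a * x + ?d * y) \<partial>gauss \<partial>gauss)"
    by (subst nn_integral_bigauss) auto
  also have "\<dots> = (\<integral>\<^sup>+x. \<integral>\<^sup>+y. ennreal (normal_density (c / sqrt a * x) ?d y) * indicator A (sqrt a * x, y) \<partial>lborel \<partial>gauss)"
    using assms by (intro nn_integral_cong nn_integral_gauss_affine) auto
  also have "\<dots> = (\<integral>\<^sup>+x. \<integral>\<^sup>+y. ennreal (normal_density (c / a * (0 + sqrt a * x)) ?d y) * indicator A (0 + sqrt a * x, y) \<partial>lborel \<partial>gauss)"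
  proof -
    have "c / a * (sqrt a * x) = c / sqrt a * x" for x
      using assms by (simp add: field_simps)
    then show ?thesis by simp
  qed
  also have "\<dots> = (\<integral>\<^sup>+x. ennreal (normal_density 0 (sqrt a) x) *
      (\<integral>\<^sup>+y. ennreal (normal_density (c / a * x) ?d y) * indicator A (x, y) \<partial>lborel) \<partial>lborel)"
    using assms by (intro nn_integral_gauss_affine) auto
  also have "\<dots> = (\<integral>\<^sup>+x. \<integral>\<^sup>+y. ennreal (bigauss_density a c b (x, y)) * indicator A (x, y) \<partial>lborel \<partial>lborel)"
    by (intro nn_integral_cong, subst nn_integral_cmult[symmetric])
      (auto simp: bigauss_density_def ennreal_mult mult.assoc)
  also have "\<dots> = (\<integral>\<^sup>+z. ennreal (bigauss_density a c b z) * indicator A z \<partial>(lborel \<Otimes>\<^sub>M lborel))"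
    by (subst lborel.nn_integral_fst[symmetric]) auto
  also have "\<dots> = emeasure ?R A"
    by (subst emeasure_density) auto
  finally show "emeasure ?L A = emeasure ?R A" .
qed (simp add: bigauss_def sets_pair_measure_cong[OF sets_lborel sets_lborel])

text \<open>The tangent inequality used in both directions. With the sum of both exponentials on the
  right, a difference of densities is dominated by the two densities themselves.\<close>

lemma abs_exp_diff_le:
  fixes s t :: real
  shows "\<bar>exp s - exp t\<bar> \<le> \<bar>s - t\<bar> * (exp s + exp t)"
proof -
  have *: "exp s - exp t \<le> (s - t) * exp s" for s t :: real
  proof -
    have "exp s * (1 + (t - s)) \<le> exp s * exp (t - s)"
      by (intro mult_left_mono exp_ge_add_one_self) auto
    then show ?thesis by (simp add: algebra_simps flip: exp_add)
  qed
  have "exp s - exp t \<le> \<bar>s - t\<bar> * (exp s + exp t)"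
    by (rule order_trans[OF *]) (auto intro!: mult_mono)
  moreover have "exp t - exp s \<le> \<bar>s - t\<bar> * (exp s + exp t)"
    by (rule order_trans[OF *]) (auto intro!: mult_mono)
  ultimately show ?thesis by simp
qed

text \<open>The normalising constant is moved into the exponent, so that densities of different
  variance can be compared through \<open>abs_exp_diff_le\<close>.\<close>

lemma normal_density_eq_exp:
  assumes "d > 0"
  shows "normal_density \<mu> (sqrt d) x = exp (- (x - \<mu>)\<^sup>2 / (2 * d) - ln d / 2 - ln (2 * pi) / 2)"
proof -
  have "exp (- (x - \<mu>)\<^sup>2 / (2 * d) - ln d / 2 - ln (2 * pi) / 2)
      = exp (- (x - \<mu>)\<^sup>2 / (2 * d)) / (exp (ln d / 2) * exp (ln (2 * pi) / 2))"
    by (simp add: exp_diff)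
  also have "exp (ln d / 2) = sqrt d"
    using assms by (simp add: ln_sqrt[symmetric])
  also have "exp (ln (2 * pi) / 2) = sqrt (2 * pi)"
    by (simp add: ln_sqrt[symmetric])
  finally show ?thesis using assms by (simp add: normal_density_def real_sqrt_mult)
qed

lemma abs_ln_diff_le:
  fixes x y m :: real
  assumes "0 < m" "m \<le> x" "m \<le> y"
  shows "\<bar>ln x - ln y\<bar> \<le> \<bar>x - y\<bar> / m"
proof -
  have *: "ln x - ln y \<le> \<bar>x - y\<bar> / m" if "m \<le> x" "m \<le> y" for x y
  proof -
    have "ln x - ln y \<le> (x - y) / y"
      using assms that by (intro ln_diff_le) auto
    also have "\<dots> \<le> \<bar>x - y\<bar> / m"
      using assms that by (intro frac_le) auto
    finally show ?thesis .
  qed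
  from *[of x y] *[of y x] assms show ?thesis by (simp add: abs_le_iff abs_minus_commute)
qed

lemma one_plus_squares_le_exp:
  fixes x y :: real
  shows "1 + x\<^sup>2 + y\<^sup>2 \<le> 2 * exp (\<bar>x\<bar> + \<bar>y\<bar>)"
proof -
  have "1 + (\<bar>x\<bar> + \<bar>y\<bar>) + (\<bar>x\<bar> + \<bar>y\<bar>)\<^sup>2 / 2 \<le> exp (\<bar>x\<bar> + \<bar>y\<bar>)"
    by (rule exp_lower_Taylor_quadratic) simp
  moreover have "x\<^sup>2 + y\<^sup>2 \<le> (\<bar>x\<bar> + \<bar>y\<bar>)\<^sup>2"
    by (simp add: power2_sum)
  moreover have "0 \<le> \<bar>x\<bar> + \<bar>y\<bar>" by simp
  ultimately show ?thesis by linarith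
qed

section \<open>Comparison of covariance matrices\<close>

lemma bigauss_bound:
  fixes F :: "real \<times> real \<Rightarrow> real"
  assumes "0 \<le> a" "a \<le> 2" "0 \<le> b" "b \<le> 2" "c\<^sup>2 \<le> a * b"
    and F [measurable]: "F \<in> borel_measurable (borel \<Otimes>\<^sub>M borel)"
    and bound: "\<And>z. \<bar>F z\<bar> \<le> K * exp (p * (\<bar>fst z\<bar> + \<bar>snd z\<bar>))"
  shows "integrable (bigauss a c b) F"
    and "\<bar>\<integral>z. F z \<partial>bigauss a c b\<bar> \<le> K * (4 * exp (4 * p\<^sup>2))"
proof -
  \<comment> \<open>The growth bound at the origin makes \<open>K\<close> nonnegative.\<close>
  have K: "0 \<le> K" using order_trans[OF abs_ge_zero bound[of "(0, 0)"]] by simp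
  have iE: "integrable (bigauss a c b) (\<lambda>z. K * exp (p * (\<bar>fst z\<bar> + \<bar>snd z\<bar>)))"
    using bigauss_abs_exp(1)[OF assms(1-5)] by simp
  show "integrable (bigauss a c b) F"
    using K by (intro Bochner_Integration.integrable_bound[OF iE]) (auto simp: abs_mult bound)
  have "\<bar>\<integral>z. F z \<partial>bigauss a c b\<bar> \<le> (\<integral>z. \<bar>F z\<bar> \<partial>bigauss a c b)"
    by (rule integral_abs_bound)
  also have "\<dots> \<le> (\<integral>z. K * exp (p * (\<bar>fst z\<bar> + \<bar>snd z\<bar>)) \<partial>bigauss a c b)"
    by (rule integral_mono'[OF iE]) (use K in \<open>auto simp: bound\<close>)
  also have "\<dots> = K * (\<integral>z. exp (p * (\<bar>fst z\<bar> + \<bar>snd z\<bar>)) \<partial>bigauss a c b)" by simp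
  also have "\<dots> \<le> K * (4 * exp (4 * p\<^sup>2))"
    by (rule mult_left_mono[OF bigauss_abs_exp(2)[OF assms(1-5)] K])
  finally show "\<bar>\<integral>z. F z \<partial>bigauss a c b\<bar> \<le> K * (4 * exp (4 * p\<^sup>2))" .
qed

text \<open>\<open>D\<close> is the determinant of the reference matrix, which is also its
  conditional variance. The threshold \<open>D / 8\<close> is small enough that the error
  \<open>5 * \<Delta>\<close> leaves more than a quarter of this variance.\<close>

lemma bigauss_near:
  fixes a b c q D \<Delta> :: real
  assumes q: "\<bar>q\<bar> < 1" and D: "D = 1 - q\<^sup>2"
    and \<Delta>: "\<Delta> = \<bar>a - 1\<bar> + \<bar>c - q\<bar> + \<bar>b - 1\<bar>" "\<Delta> < D / 8"
  shows "7 / 8 \<le> a" "\<bar>c / a - q\<bar> \<le> 2 * \<Delta>" "\<bar>c / a\<bar> \<le> 2"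
    "\<bar>b - c\<^sup>2 / a - D\<bar> \<le> 5 * \<Delta>" "D / 4 \<le> b - c\<^sup>2 / a"
proof -
  have D01: "0 < D" "D \<le> 1" using q D by (auto simp: abs_square_less_1)
  then have \<Delta>8: "\<Delta> \<le> 1 / 8" using \<Delta> by simp
  show a: "7 / 8 \<le> a" using \<Delta>8 \<Delta>(1) by linarith
  have eq: "c / a - q = (c - q + q * (1 - a)) / a"
    using a by (simp add: field_simps)
  have "\<bar>c - q + q * (1 - a)\<bar> \<le> \<bar>c - q\<bar> + \<bar>q\<bar> * \<bar>1 - a\<bar>"
    by (metis abs_mult abs_triangle_ineq)
  also have "\<dots> \<le> \<bar>c - q\<bar> + 1 * \<bar>1 - a\<bar>"
    using q by (intro add_left_mono mult_right_mono) auto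
  also have "\<dots> \<le> \<Delta>" unfolding \<Delta>(1) by (simp add: abs_minus_commute)
  finally have "\<bar>c / a - q\<bar> \<le> \<Delta> / a"
    unfolding eq abs_divide using a by (simp add: divide_right_mono)
  also have "\<dots> \<le> \<Delta> / (1/2)"
    using a \<Delta>(1) by (intro divide_left_mono) auto
  finally show \<kappa>: "\<bar>c / a - q\<bar> \<le> 2 * \<Delta>" by simp
  then show \<kappa>2: "\<bar>c / a\<bar> \<le> 2" using q \<Delta>8 by linarith
  have eq2: "b - c\<^sup>2 / a - D = (b - 1) - ((c - q) * (c / a) + q * (c / a - q))"
    unfolding D by (simp add: power2_eq_square algebra_simps diff_divide_distrib)
  have s: "\<bar>(c - q) * (c / a)\<bar> \<le> \<bar>c - q\<bar> * 2"
    unfolding abs_mult using \<kappa>2 by (intro mult_left_mono) auto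
  have t: "\<bar>q * (c / a - q)\<bar> \<le> 1 * (2 * \<Delta>)"
    unfolding abs_mult using \<kappa> q by (intro mult_mono) auto
  have "\<bar>b - 1 - (s + t)\<bar> \<le> u + v + \<bar>b - 1\<bar>" if "\<bar>s\<bar> \<le> u" "\<bar>t\<bar> \<le> v" for s t u v
    using that by simp
  from this[OF s t] have "\<bar>b - c\<^sup>2 / a - D\<bar> \<le> \<bar>c - q\<bar> * 2 + 1 * (2 * \<Delta>) + \<bar>b - 1\<bar>"
    unfolding eq2 .
  also have "\<dots> \<le> 5 * \<Delta>" unfolding \<Delta>(1) by simp
  finally show d: "\<bar>b - c\<^sup>2 / a - D\<bar> \<le> 5 * \<Delta>" .
  show "D / 4 \<le> b - c\<^sup>2 / a" using d \<Delta>(2) by linarith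
qed

text \<open>The changes of the variance and of the regression coefficient are separated. The first
  costs \<open>8 * 20 / 2\<close>, from the bound \<open>8 * (x^2 + y^2)\<close> on the form and
  \<open>20 * \<Delta> / D^2\<close> on the reciprocals; the second costs \<open>8 / 2\<close>.
  Together this is \<open>84\<close>.\<close>

lemma quadratic_form_diff:
  fixes x y \<kappa> q d D \<Delta> :: real
  assumes q: "\<bar>q\<bar> \<le> 1" and \<kappa>: "\<bar>\<kappa> - q\<bar> \<le> 2 * \<Delta>" "\<bar>\<kappa>\<bar> \<le> 2"
    and D: "0 < D" "D \<le> 1" and d: "\<bar>d - D\<bar> \<le> 5 * \<Delta>" "D / 4 \<le> d"
  shows "\<bar>(y - \<kappa> * x)\<^sup>2 / (2 * d) - (y - q * x)\<^sup>2 / (2 * D)\<bar> \<le> 84 / D\<^sup>2 * \<Delta> * (x\<^sup>2 + y\<^sup>2)"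
proof -
  have \<Delta>: "0 \<le> \<Delta>" using \<kappa> by linarith
  have d0: "d > 0" using D d by linarith
  have 1: "\<bar>1 / d - 1 / D\<bar> \<le> 20 / D\<^sup>2 * \<Delta>"
  proof -
    have "1 / d - 1 / D = (D - d) / (d * D)" using d0 D by (simp add: field_simps)
    also have "\<bar>\<dots>\<bar> = \<bar>d - D\<bar> / (d * D)" using d0 D by (simp add: abs_mult abs_minus_commute)
    also have "\<dots> \<le> (5 * \<Delta>) / (D / 4 * D)"
      using d D d0 \<Delta> by (intro frac_le mult_right_mono) auto
    finally show ?thesis using D by (simp add: power2_eq_square field_simps)
  qed
  have 2: "(y - \<kappa> * x)\<^sup>2 \<le> 8 * (x\<^sup>2 + y\<^sup>2)"
  proof -
    have "(y - \<kappa> * x)\<^sup>2 \<le> 2 * (y\<^sup>2 + (\<kappa> * x)\<^sup>2)"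
      using sum_squares_bound[of y "- (\<kappa> * x)"] by (simp add: power2_eq_square algebra_simps)
    moreover have "\<kappa>\<^sup>2 \<le> 2\<^sup>2" using \<kappa>(2) abs_le_square_iff[of \<kappa> 2] by simp
    then have "(\<kappa> * x)\<^sup>2 \<le> 4 * x\<^sup>2"
      unfolding power_mult_distrib by (intro mult_right_mono) auto
    ultimately show ?thesis by (simp add: power2_eq_square) (smt (verit) zero_le_square)
  qed
  have 3: "\<bar>(y - \<kappa> * x)\<^sup>2 - (y - q * x)\<^sup>2\<bar> \<le> 8 * \<Delta> * (x\<^sup>2 + y\<^sup>2)"
  proof -
    have xy: "2 * (\<bar>x\<bar> * \<bar>y\<bar>) \<le> x\<^sup>2 + y\<^sup>2"
      using sum_squares_bound[of "\<bar>x\<bar>" "\<bar>y\<bar>"] by simp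
    have "(y - \<kappa> * x)\<^sup>2 - (y - q * x)\<^sup>2 = (q - \<kappa>) * (x * (2 * y - (\<kappa> + q) * x))"
      by (simp add: power2_eq_square algebra_simps)
    also have "\<bar>\<dots>\<bar> = \<bar>\<kappa> - q\<bar> * \<bar>x * (2 * y - (\<kappa> + q) * x)\<bar>"
      by (simp add: abs_mult abs_minus_commute)
    also have "\<dots> \<le> (2 * \<Delta>) * (4 * (x\<^sup>2 + y\<^sup>2))"
    proof (rule mult_mono)
      have "\<bar>x * (2 * y - (\<kappa> + q) * x)\<bar> = \<bar>2 * (x * y) - (\<kappa> + q) * x\<^sup>2\<bar>"
        by (rule arg_cong[where f=abs]) (simp add: power2_eq_square algebra_simps)
      also have "\<dots> \<le> 2 * (\<bar>x\<bar> * \<bar>y\<bar>) + \<bar>\<kappa> + q\<bar> * x\<^sup>2"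
        by (rule order_trans[OF abs_triangle_ineq4]) (simp add: abs_mult)
      also have "\<dots> \<le> (x\<^sup>2 + y\<^sup>2) + 3 * x\<^sup>2"
        using q \<kappa>(2) by (intro add_mono xy mult_right_mono) auto
      also have "\<dots> \<le> 4 * (x\<^sup>2 + y\<^sup>2)" by simp
      finally show "\<bar>x * (2 * y - (\<kappa> + q) * x)\<bar> \<le> 4 * (x\<^sup>2 + y\<^sup>2)" .
    qed (use \<kappa> \<Delta> in auto)
    finally show ?thesis by (simp add: algebra_simps)
  qed
  have D2: "1 / D \<le> 1 / D\<^sup>2"
    using D by (auto simp: field_simps power2_eq_square)
  have "(y - \<kappa> * x)\<^sup>2 / (2 * d) - (y - q * x)\<^sup>2 / (2 * D)
    = (y - \<kappa> * x)\<^sup>2 * (1 / d - 1 / D) / 2 + ((y - \<kappa> * x)\<^sup>2 - (y - q * x)\<^sup>2) * (1 / D) / 2"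
    using d0 D by (simp add: field_simps)
  also have "\<bar>\<dots>\<bar> \<le> (y - \<kappa> * x)\<^sup>2 * \<bar>1 / d - 1 / D\<bar> / 2 + \<bar>(y - \<kappa> * x)\<^sup>2 - (y - q * x)\<^sup>2\<bar> * (1 / D) / 2"
    using D by (intro order_trans[OF abs_triangle_ineq]) (simp add: abs_mult)
  also have "\<dots> \<le> 8 * (x\<^sup>2 + y\<^sup>2) * (20 / D\<^sup>2 * \<Delta>) / 2 + 8 * \<Delta> * (x\<^sup>2 + y\<^sup>2) * (1 / D\<^sup>2) / 2"
    using D by (intro add_mono divide_right_mono mult_mono 1 2 3 D2 mult_nonneg_nonneg \<Delta>) auto
  also have "\<dots> = 84 / D\<^sup>2 * \<Delta> * (x\<^sup>2 + y\<^sup>2)"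
    using D by (simp add: divide_simps)
  finally show ?thesis .
qed

text \<open>Both densities are exponentials, so their difference is controlled by that of the
  exponents, which is \<open>\<Delta>\<close> times a quadratic polynomial. Absorbing the polynomial
  into an exponential raises the growth rate of the later integrands by one.\<close>

lemma bigauss_density_diff:
  assumes q: "\<bar>q\<bar> < 1" and D: "D = 1 - q\<^sup>2"
    and \<Delta>: "\<Delta> = \<bar>a - 1\<bar> + \<bar>c - q\<bar> + \<bar>b - 1\<bar>" "\<Delta> < D / 8"
  shows "\<bar>bigauss_density a c b z - bigauss_density 1 q 1 z\<bar>
    \<le> 200 / D\<^sup>2 * \<Delta> * exp (\<bar>fst z\<bar> + \<bar>snd z\<bar>) * (bigauss_density a c b z + bigauss_density 1 q 1 z)"
proof -
  obtain x y where z: "z = (x, y)" by (cases z)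
  note near = bigauss_near[OF q D \<Delta>]
  have D01: "0 < D" "D \<le> 1" using q D by (auto simp: abs_square_less_1)
  have \<Delta>0: "0 \<le> \<Delta>" using \<Delta> by simp
  define d where "d = b - c\<^sup>2 / a"
  have d0: "d > 0" using near(5) D01 unfolding d_def by linarith
  have a0: "a > 0" using near(1) by simp
  define e where "e = - x\<^sup>2 / (2 * a) - ln a / 2 - ln (2 * pi) / 2
    + (- (y - c / a * x)\<^sup>2 / (2 * d) - ln d / 2 - ln (2 * pi) / 2)"
  define e0 where "e0 = - x\<^sup>2 / 2 - ln (2 * pi) / 2
    + (- (y - q * x)\<^sup>2 / (2 * D) - ln D / 2 - ln (2 * pi) / 2)"
  have p: "bigauss_density a c b z = exp e"
    unfolding bigauss_density_def z e_def exp_add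
    using a0 d0 by (simp add: normal_density_eq_exp flip: d_def)
  have p0: "bigauss_density 1 q 1 z = exp e0"
    unfolding bigauss_density_def z e0_def exp_add
    using D01 normal_density_eq_exp[of 1 0 x] by (simp add: normal_density_eq_exp flip: D)
  have A: "\<bar>x\<^sup>2 / (2 * a) - x\<^sup>2 / 2\<bar> \<le> \<Delta> * (x\<^sup>2 + y\<^sup>2)"
  proof -
    have "x\<^sup>2 / (2 * a) - x\<^sup>2 / 2 = x\<^sup>2 * ((1 - a) / (2 * a))" using a0 by (simp add: field_simps)
    also have "\<bar>\<dots>\<bar> = x\<^sup>2 * (\<bar>a - 1\<bar> / (2 * a))" using a0 by (simp add: abs_mult abs_minus_commute)
    also have "\<dots> \<le> x\<^sup>2 * (\<Delta> / 1)"
      using near(1) \<Delta> by (intro mult_left_mono frac_le) auto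
    also have "\<dots> \<le> \<Delta> * (x\<^sup>2 + y\<^sup>2)" using \<Delta>0 by (simp add: algebra_simps)
    finally show ?thesis .
  qed
  have B: "\<bar>(y - c / a * x)\<^sup>2 / (2 * d) - (y - q * x)\<^sup>2 / (2 * D)\<bar> \<le> 84 / D\<^sup>2 * \<Delta> * (x\<^sup>2 + y\<^sup>2)"
    using near q D01 unfolding d_def by (intro quadratic_form_diff) auto
  have L1: "\<bar>ln a\<bar> \<le> 2 * \<Delta>"
  proof -
    have "\<bar>ln a - ln 1\<bar> \<le> \<bar>a - 1\<bar> / (1/2)"
      by (rule abs_ln_diff_le) (use near in auto)
    also have "\<dots> \<le> 2 * \<Delta>" unfolding \<Delta>(1) by simp
    finally show ?thesis by simp
  qed
  have L2: "\<bar>ln d - ln D\<bar> \<le> 20 / D * \<Delta>"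
  proof -
    have "\<bar>ln d - ln D\<bar> \<le> \<bar>d - D\<bar> / (D / 4)"
      by (rule abs_ln_diff_le) (use near D01 in \<open>auto simp: d_def\<close>)
    also have "\<dots> \<le> (5 * \<Delta>) / (D / 4)"
      using near(4) D01 unfolding d_def by (intro divide_right_mono) auto
    finally show ?thesis by simp
  qed
  have Dinv: "1 \<le> 1 / D\<^sup>2" "1 / D \<le> 1 / D\<^sup>2"
    using D01 by (auto simp: field_simps power2_eq_square mult_le_one)
  have T1: "\<Delta> * (x\<^sup>2 + y\<^sup>2) \<le> 1 / D\<^sup>2 * (\<Delta> * (x\<^sup>2 + y\<^sup>2))"
    using mult_right_mono[OF Dinv(1), of "\<Delta> * (x\<^sup>2 + y\<^sup>2)"] \<Delta>0 by simp
  have T2: "\<Delta> \<le> 1 / D\<^sup>2 * \<Delta>" "1 / D * \<Delta> \<le> 1 / D\<^sup>2 * \<Delta>"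
    using mult_right_mono[OF Dinv(1) \<Delta>0] mult_right_mono[OF Dinv(2) \<Delta>0] by simp_all
  have ee: "e - e0 = - (x\<^sup>2 / (2 * a) - x\<^sup>2 / 2) - ((y - c / a * x)\<^sup>2 / (2 * d) - (y - q * x)\<^sup>2 / (2 * D))
      - ln a / 2 - (ln d - ln D) / 2"
    unfolding e_def e0_def by (simp add: field_simps)
  have *: "\<bar>- A' - B' - C' / 2 - E' / 2\<bar> \<le> u + v + w + t"
    if "\<bar>A'\<bar> \<le> u" "\<bar>B'\<bar> \<le> v" "\<bar>C'\<bar> \<le> 2 * w" "\<bar>E'\<bar> \<le> 2 * t" for A' B' C' E' u v w t :: real
    using that unfolding abs_le_iff by linarith
  have "\<bar>e - e0\<bar> \<le> \<Delta> * (x\<^sup>2 + y\<^sup>2) + 84 / D\<^sup>2 * \<Delta> * (x\<^sup>2 + y\<^sup>2) + \<Delta> + 10 / D * \<Delta>"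
    unfolding ee by (intro * A B L1) (use L2 in simp)
  \<comment> \<open>The coefficients are \<open>1 + 84\<close> for the quadratic part and
    \<open>1 + 10\<close> for the constant part, once all powers of \<open>1 / D\<close> are raised
    to the second.\<close>
  also have "\<dots> \<le> 100 / D\<^sup>2 * \<Delta> * (1 + x\<^sup>2 + y\<^sup>2)"
  proof -
    have nn: "0 \<le> 1 / D\<^sup>2 * \<Delta>" "0 \<le> 1 / D\<^sup>2 * (\<Delta> * (x\<^sup>2 + y\<^sup>2))" using \<Delta>0 by auto
    have r: "84 / D\<^sup>2 * \<Delta> * (x\<^sup>2 + y\<^sup>2) = 84 * (1 / D\<^sup>2 * (\<Delta> * (x\<^sup>2 + y\<^sup>2)))"
       "10 / D * \<Delta> = 10 * (1 / D * \<Delta>)"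
       "100 / D\<^sup>2 * \<Delta> * (1 + x\<^sup>2 + y\<^sup>2) = 100 * (1 / D\<^sup>2 * \<Delta>) + 100 * (1 / D\<^sup>2 * (\<Delta> * (x\<^sup>2 + y\<^sup>2)))"
      by (simp_all add: algebra_simps add_divide_distrib)
    show ?thesis unfolding r using T1 T2 nn by linarith
  qed
  also have "\<dots> \<le> 100 / D\<^sup>2 * \<Delta> * (2 * exp (\<bar>x\<bar> + \<bar>y\<bar>))"
    using \<Delta>0 by (intro mult_left_mono one_plus_squares_le_exp) auto
  finally have "\<bar>e - e0\<bar> \<le> 200 / D\<^sup>2 * \<Delta> * exp (\<bar>fst z\<bar> + \<bar>snd z\<bar>)"
    by (simp add: z)
  then show ?thesis
    unfolding p p0 by (intro order_trans[OF abs_exp_diff_le] mult_right_mono) auto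
qed

text \<open>Lipschitz continuity in the covariance at the single point \<open>(1, q, 1)\<close>,
  uniform over all measurable test functions of growth rate \<open>p\<close>. Packaged as a
  predicate, it lets \<open>C\<close> be chosen before \<open>N\<close>, the disorder and the test
  function.\<close>

definition bigauss_lip :: "real \<Rightarrow> real \<Rightarrow> real \<Rightarrow> bool" where
  "bigauss_lip q p C \<longleftrightarrow> C \<ge> 0 \<and> (\<forall>a b c K F. 0 \<le> a \<longrightarrow> a \<le> 2 \<longrightarrow> 0 \<le> b \<longrightarrow> b \<le> 2 \<longrightarrow> c\<^sup>2 \<le> a * b \<longrightarrow>
     F \<in> borel_measurable (borel \<Otimes>\<^sub>M borel) \<longrightarrow> (\<forall>z. \<bar>F z\<bar> \<le> K * exp (p * (\<bar>fst z\<bar> + \<bar>snd z\<bar>))) \<longrightarrow>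
     \<bar>(\<integral>z. F z \<partial>bigauss a c b) - (\<integral>z. F z \<partial>bigauss 1 q 1)\<bar> \<le> C * K * (\<bar>a - 1\<bar> + \<bar>c - q\<bar> + \<bar>b - 1\<bar>))"

text \<open>Far from the reference covariance matrix the trivial bound suffices; near it, both laws have
  densities of comparable size.\<close>

lemma bigauss_lip_exists:
  fixes q p :: real
  assumes q: "\<bar>q\<bar> < 1"
  obtains C where "bigauss_lip q p C"
proof -
  define D where D: "D = 1 - q\<^sup>2"
  have D01: "0 < D" "D \<le> 1" using q D by (auto simp: abs_square_less_1)
  \<comment> \<open>The first summand serves the far case: the trivial bound with \<open>8\<close>
    times the factor \<open>8 * \<Delta> / D\<close>, which is at least \<open>1\<close>. The second
    serves the near case: \<open>200 / D^2\<close> times two exponential moments of rate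
    \<open>p + 1\<close>, each at most \<open>4 * exp (4 * (p + 1)^2)\<close>.\<close>
  define C where "C = 64 * exp (4 * p\<^sup>2) / D + 1600 / D\<^sup>2 * exp (4 * (p + 1)\<^sup>2)"
  have C0: "C \<ge> 0" using D01 by (simp add: C_def)
  have "\<bar>(\<integral>z. F z \<partial>bigauss a c b) - (\<integral>z. F z \<partial>bigauss 1 q 1)\<bar> \<le> C * K * (\<bar>a - 1\<bar> + \<bar>c - q\<bar> + \<bar>b - 1\<bar>)"
    if H: "0 \<le> a" "a \<le> 2" "0 \<le> b" "b \<le> 2" "c\<^sup>2 \<le> a * b"
      and F [measurable]: "F \<in> borel_measurable (borel \<Otimes>\<^sub>M borel)"
      and bound: "\<And>z. \<bar>F z\<bar> \<le> K * exp (p * (\<bar>fst z\<bar> + \<bar>snd z\<bar>))" for a b c K F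
  proof -
    define \<Delta> where \<Delta>: "\<Delta> = \<bar>a - 1\<bar> + \<bar>c - q\<bar> + \<bar>b - 1\<bar>"
    have \<Delta>0: "0 \<le> \<Delta>" by (simp add: \<Delta>)
    have K: "0 \<le> K" using order_trans[OF abs_ge_zero bound[of "(0, 0)"]] by simp
    have q1: "q\<^sup>2 \<le> 1 * 1" using q by (simp add: abs_square_le_1)
    note B = bigauss_bound[OF H F bound] bigauss_bound[of 1 1 q, OF _ _ _ _ q1 F bound, simplified]
    show ?thesis
    proof (cases "\<Delta> < D / 8")
      case False
      then have "1 \<le> 8 * \<Delta> / D" using D01 by (simp add: field_simps)
      then have "8 * exp (4 * p\<^sup>2) * K * 1 \<le> 8 * exp (4 * p\<^sup>2) * K * (8 * \<Delta> / D)"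
        using K by (intro mult_left_mono) auto
      moreover have "\<bar>(\<integral>z. F z \<partial>bigauss a c b) - (\<integral>z. F z \<partial>bigauss 1 q 1)\<bar> \<le> 8 * exp (4 * p\<^sup>2) * K"
        using B(2) B(4) by (simp add: algebra_simps)
      moreover have "8 * exp (4 * p\<^sup>2) * K * (8 * \<Delta> / D) \<le> C * K * \<Delta>"
        using K \<Delta>0 D01 by (simp add: C_def algebra_simps)
      ultimately show ?thesis by (simp add: \<Delta>)
    next
      case True
      note near = bigauss_near[OF q D \<Delta> True]
      define M where "M = (lborel :: real measure) \<Otimes>\<^sub>M (lborel :: real measure)"
      have sM [simp, measurable_cong]: "sets M = sets (borel \<Otimes>\<^sub>M borel)"
        by (simp add: M_def sets_pair_measure_cong[OF sets_lborel sets_lborel])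
      have pos: "0 \<le> bigauss_density a c b z" for a c b z
        by (simp add: bigauss_density_def)
      have dens: "bigauss a c b = density M (bigauss_density a c b)"
          "bigauss 1 q 1 = density M (bigauss_density 1 q 1)"
        unfolding M_def using near D01 D by (auto intro!: bigauss_eq_density)
      have dens_int: "(\<integral>z. G z \<partial>bigauss a c b) = (\<integral>z. bigauss_density a c b z * G z \<partial>M)"
        "(\<integral>z. G z \<partial>bigauss 1 q 1) = (\<integral>z. bigauss_density 1 q 1 z * G z \<partial>M)"
        "integrable (bigauss a c b) G \<longleftrightarrow> integrable M (\<lambda>z. bigauss_density a c b z * G z)"
        "integrable (bigauss 1 q 1) G \<longleftrightarrow> integrable M (\<lambda>z. bigauss_density 1 q 1 z * G z)"
        if [measurable]: "G \<in> borel_measurable (borel \<Otimes>\<^sub>M borel)" for G :: "real \<times> real \<Rightarrow> real"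
        unfolding dens by (simp_all add: integral_density integrable_density pos)
      define E where "E = (\<lambda>z. exp ((p + 1) * (\<bar>fst z\<bar> + \<bar>snd z :: real\<bar>)))"
      have Em [measurable]: "E \<in> borel_measurable (borel \<Otimes>\<^sub>M borel)" unfolding E_def by measurable
      have E: "integrable (bigauss a c b) E" "(\<integral>z. E z \<partial>bigauss a c b) \<le> 4 * exp (4 * (p + 1)\<^sup>2)"
          "integrable (bigauss 1 q 1) E" "(\<integral>z. E z \<partial>bigauss 1 q 1) \<le> 4 * exp (4 * (p + 1)\<^sup>2)"
        unfolding E_def using bigauss_abs_exp[OF H] bigauss_abs_exp[OF _ _ _ _ q1] by auto
      define L where "L = 200 / D\<^sup>2 * \<Delta> * K"
      have L0: "0 \<le> L" unfolding L_def using \<Delta>0 K D01 by auto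
      have ptw: "\<bar>bigauss_density a c b z * F z - bigauss_density 1 q 1 z * F z\<bar>
        \<le> L * (bigauss_density a c b z * E z + bigauss_density 1 q 1 z * E z)" for z
      proof -
        have "\<bar>bigauss_density a c b z * F z - bigauss_density 1 q 1 z * F z\<bar>
          = \<bar>bigauss_density a c b z - bigauss_density 1 q 1 z\<bar> * \<bar>F z\<bar>"
          by (simp add: left_diff_distrib flip: abs_mult)
        also have "\<dots> \<le> (200 / D\<^sup>2 * \<Delta> * exp (\<bar>fst z\<bar> + \<bar>snd z\<bar>) * (bigauss_density a c b z + bigauss_density 1 q 1 z))
           * (K * exp (p * (\<bar>fst z\<bar> + \<bar>snd z\<bar>)))"
          using \<Delta>0 pos by (intro mult_mono bigauss_density_diff[OF q D \<Delta> True] bound)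
            (auto intro!: mult_nonneg_nonneg add_nonneg_nonneg)
        also have "\<dots> = L * (bigauss_density a c b z * E z + bigauss_density 1 q 1 z * E z)"
        proof -
          have "E z = exp (\<bar>fst z\<bar> + \<bar>snd z\<bar>) * exp (p * (\<bar>fst z\<bar> + \<bar>snd z\<bar>))"
            unfolding E_def by (simp add: exp_add[symmetric] algebra_simps)
          then show ?thesis by (simp add: L_def distrib_left distrib_right mult_ac add_divide_distrib)
        qed
        finally show ?thesis .
      qed
      have "\<bar>(\<integral>z. F z \<partial>bigauss a c b) - (\<integral>z. F z \<partial>bigauss 1 q 1)\<bar>
        = \<bar>\<integral>z. bigauss_density a c b z * F z - bigauss_density 1 q 1 z * F z \<partial>M\<bar>"
        using B(1) B(3) by (simp add: dens_int)
      also have "\<dots> \<le> (\<integral>z. \<bar>bigauss_density a c b z * F z - bigauss_density 1 q 1 z * F z\<bar> \<partial>M)"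
        by (rule integral_abs_bound)
      also have "\<dots> \<le> (\<integral>z. L * (bigauss_density a c b z * E z + bigauss_density 1 q 1 z * E z) \<partial>M)"
        using E(1,3) B(1) B(3) ptw by (intro integral_mono) (auto simp: dens_int)
      also have "\<dots> = L * ((\<integral>z. E z \<partial>bigauss a c b) + (\<integral>z. E z \<partial>bigauss 1 q 1))"
        using E(1,3) by (simp add: dens_int)
      also have "\<dots> \<le> L * (4 * exp (4 * (p + 1)\<^sup>2) + 4 * exp (4 * (p + 1)\<^sup>2))"
        by (intro mult_left_mono add_mono E L0)
      also have "\<dots> \<le> C * K * \<Delta>"
        using K \<Delta>0 D01 by (simp add: C_def L_def algebra_simps)
      finally show ?thesis by (simp add: \<Delta>)
    qed
  qed
  with C0 have "bigauss_lip q p C" unfolding bigauss_lip_def by blast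
  then show ?thesis by (rule that)
qed

section \<open>Replicas of a linear Gaussian field\<close>

definition gauss_smooth :: "real \<Rightarrow> (real \<Rightarrow> real) \<Rightarrow> real \<Rightarrow> real" where
  "gauss_smooth s f x = (\<integral>z. f (x + s * z) \<partial>gauss)"

lemma measurable_gauss_smooth [measurable (raw)]:
  assumes [measurable]: "f \<in> borel_measurable borel" "g \<in> borel_measurable M"
  shows "(\<lambda>x. gauss_smooth s f (g x)) \<in> borel_measurable M"
  unfolding gauss_smooth_def by measurable

lemma gauss_smooth_eq:
  assumes [measurable]: "f \<in> borel_measurable borel" and "s > 0"
  shows "gauss_smooth s f x = (\<integral>y. f y * normal_density x s y \<partial>lborel)"
proof -
  have "gauss_smooth s f x = (\<integral>y. f y \<partial>distr gauss borel (\<lambda>z. x + s * z))"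
    unfolding gauss_smooth_def by (rule integral_distr[symmetric]) auto
  also have "\<dots> = (\<integral>y. f y \<partial>density lborel (normal_density x s))"
    using distr_gauss_affine[OF assms(2)] by simp
  also have "\<dots> = (\<integral>y. f y * normal_density x s y \<partial>lborel)"
    by (subst integral_density) (auto simp: mult.commute)
  finally show ?thesis .
qed

text \<open>Read from right to left: with \<open>u = 0\<close> or \<open>v = 0\<close> the inner
  integral smooths a single coordinate, so replacing \<open>f\<close> by its smoothing amounts to
  enlarging one variance and keeping the covariance.\<close>

lemma bigauss_noise:
  fixes F :: "real \<times> real \<Rightarrow> real"
  assumes "a \<ge> 0" "b \<ge> 0" "c\<^sup>2 \<le> a * b" and F [measurable]: "F \<in> borel_measurable (borel \<Otimes>\<^sub>M borel)"
    and int: "integrable (bigauss (a + u\<^sup>2) (c + u * v) (b + v\<^sup>2)) F"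
  shows "integrable (bigauss a c b) (\<lambda>p. \<integral>z. F (fst p + u * z, snd p + v * z) \<partial>gauss)"
    and "(\<integral>p. F p \<partial>bigauss (a + u\<^sup>2) (c + u * v) (b + v\<^sup>2))
      = (\<integral>p. (\<integral>z. F (fst p + u * z, snd p + v * z) \<partial>gauss) \<partial>bigauss a c b)"
proof -
  interpret B: prob_space "bigauss a c b" by (rule prob_space_bigauss)
  interpret P: pair_prob_space "bigauss a c b" gauss ..
  note eq = distr_bigauss_add_noise[OF assms(1-3), of u v, symmetric]
  have i: "integrable (bigauss a c b \<Otimes>\<^sub>M gauss) (\<lambda>w. F (fst (fst w) + u * snd w, snd (fst w) + v * snd w))"
    using int unfolding eq by (subst (asm) integrable_distr_eq) (auto simp: case_prod_beta')
  show "integrable (bigauss a c b) (\<lambda>p. \<integral>z. F (fst p + u * z, snd p + v * z) \<partial>gauss)"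
    using P.integrable_fst'[OF i] by simp
  show "(\<integral>p. F p \<partial>bigauss (a + u\<^sup>2) (c + u * v) (b + v\<^sup>2))
      = (\<integral>p. (\<integral>z. F (fst p + u * z, snd p + v * z) \<partial>gauss) \<partial>bigauss a c b)"
    using P.integral_fst'[OF i] unfolding eq
    by (subst integral_distr) (auto simp: case_prod_beta')
qed

text \<open>The Gaussian part of the argument, freed from spins. Once all other couplings are
  frozen, the cavity weights \<open>G\<close> are deterministic and the only randomness lies in the
  normals indexed by \<open>J\<close>. The vectors \<open>t \<sigma>\<close> share one length
  because spins have modulus one.\<close>

locale linear_replicas =
  fixes J :: "'j set" and S :: "'s set" and G :: "'s \<Rightarrow> real" and t :: "'s \<Rightarrow> 'j \<Rightarrow> real" and a q :: real
  assumes J: "finite J" and S: "finite S"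
    and G: "\<And>\<sigma>. \<sigma> \<in> S \<Longrightarrow> 0 \<le> G \<sigma>" "(\<Sum>\<sigma>\<in>S. G \<sigma>) = 1"
    and t: "\<And>\<sigma>. \<sigma> \<in> S \<Longrightarrow> (\<Sum>j\<in>J. (t \<sigma> j)\<^sup>2) = a"
    and a: "0 \<le> a" "a \<le> 1" and q: "0 \<le> q" "q < 1"
begin

definition dotp :: "('j \<Rightarrow> real) \<Rightarrow> ('j \<Rightarrow> real) \<Rightarrow> real" where
  "dotp x y = (\<Sum>j\<in>J. x j * y j)"

definition m :: "'j \<Rightarrow> real" where "m j = (\<Sum>\<sigma>\<in>S. G \<sigma> * t \<sigma> j)"

definition \<rho> :: real where
  "\<rho> = (\<Sum>\<sigma>\<in>S. \<Sum>\<tau>\<in>S. G \<sigma> * G \<tau> * \<bar>dotp (t \<sigma>) (t \<tau>) - q\<bar>)"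

abbreviation M :: "('j \<Rightarrow> real) measure" where "M \<equiv> PiM J (\<lambda>_. gauss)"

lemma measurable_dotp [measurable]: "dotp x \<in> borel_measurable M"
  unfolding dotp_def by measurable

lemma dotp_commute: "dotp x y = dotp y x"
  by (simp add: dotp_def mult.commute)

lemma dotp_add_left: "dotp (\<lambda>j. x j + y j) z = dotp x z + dotp y z"
  and dotp_diff_left: "dotp (\<lambda>j. x j - y j) z = dotp x z - dotp y z"
  and dotp_scale_left: "dotp (\<lambda>j. k * x j) z = k * dotp x z"
  by (simp_all add: dotp_def sum.distrib sum_subtractf sum_distrib_left algebra_simps)

lemma dotp_add_right: "dotp z (\<lambda>j. x j + y j) = dotp z x + dotp z y"
  and dotp_diff_right: "dotp z (\<lambda>j. x j - y j) = dotp z x - dotp z y"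
  and dotp_scale_right: "dotp z (\<lambda>j. k * x j) = k * dotp z x"
  by (simp_all add: dotp_commute[of z] dotp_add_left dotp_diff_left dotp_scale_left)

lemma dotp_m_left: "dotp m z = (\<Sum>\<sigma>\<in>S. G \<sigma> * dotp (t \<sigma>) z)"
  unfolding dotp_def m_def sum_distrib_right sum_distrib_left
  by (subst sum.swap) (simp add: mult.assoc)

lemma dotp_t_m: "dotp (t \<sigma>) m = (\<Sum>\<tau>\<in>S. G \<tau> * dotp (t \<sigma>) (t \<tau>))"
  by (simp add: dotp_commute[of "t \<sigma>"] dotp_m_left)

lemma dotp_cauchy_schwarz: "(dotp x y)\<^sup>2 \<le> dotp x x * dotp y y"
  using Cauchy_Schwarz_ineq_sum[of x y J] by (simp add: dotp_def power2_eq_square)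

lemma dotp_nonneg: "0 \<le> dotp x x"
  by (auto simp: dotp_def intro: sum_nonneg)

lemma dotp_t_t: "\<sigma> \<in> S \<Longrightarrow> dotp (t \<sigma>) (t \<sigma>) = a"
  using t by (simp add: dotp_def power2_eq_square)

lemma abs_dotp_le1:
  assumes "dotp x x \<le> 1" "dotp y y \<le> 1"
  shows "\<bar>dotp x y\<bar> \<le> 1"
proof -
  have "(dotp x y)\<^sup>2 \<le> 1 * 1"
    by (rule order_trans[OF dotp_cauchy_schwarz]) (intro mult_mono assms dotp_nonneg, simp)
  then show ?thesis by (simp add: abs_square_le_1)
qed

lemma weighted_average_diff_le:
  assumes "\<And>\<sigma>. \<sigma> \<in> S \<Longrightarrow> \<bar>x \<sigma> - k\<bar> \<le> e \<sigma>"
  shows "\<bar>(\<Sum>\<sigma>\<in>S. G \<sigma> * x \<sigma>) - k\<bar> \<le> (\<Sum>\<sigma>\<in>S. G \<sigma> * e \<sigma>)"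
proof -
  have "(\<Sum>\<sigma>\<in>S. G \<sigma> * x \<sigma>) - k = (\<Sum>\<sigma>\<in>S. G \<sigma> * (x \<sigma> - k))"
    using G(2) by (simp add: right_diff_distrib sum_subtractf flip: sum_distrib_right)
  also have "\<bar>\<dots>\<bar> \<le> (\<Sum>\<sigma>\<in>S. \<bar>G \<sigma> * (x \<sigma> - k)\<bar>)" by (rule sum_abs)
  also have "\<dots> \<le> (\<Sum>\<sigma>\<in>S. G \<sigma> * e \<sigma>)"
    using assms G(1) by (intro sum_mono) (auto simp: abs_mult intro!: mult_left_mono)
  finally show ?thesis .
qed

text \<open>Passing from a replica to the barycentre \<open>m\<close> only averages overlap
  deviations, so by convexity everything involving \<open>m\<close> remains controlled by
  \<open>\<rho>\<close>.\<close>

lemma dotp_t_m_diff: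
  "\<bar>dotp (t \<sigma>) m - q\<bar> \<le> (\<Sum>\<tau>\<in>S. G \<tau> * \<bar>dotp (t \<sigma>) (t \<tau>) - q\<bar>)"
  unfolding dotp_t_m by (rule weighted_average_diff_le) simp

lemma sum_dotp_t_m_diff: "(\<Sum>\<sigma>\<in>S. G \<sigma> * \<bar>dotp (t \<sigma>) m - q\<bar>) \<le> \<rho>"
  unfolding \<rho>_def
  by (intro sum_mono order_trans[OF mult_left_mono[OF dotp_t_m_diff]])
    (auto simp: G sum_distrib_left mult.assoc)

lemma dotp_m_m_diff: "\<bar>dotp m m - q\<bar> \<le> \<rho>"
  unfolding dotp_m_left[of m]
  by (rule order_trans[OF weighted_average_diff_le sum_dotp_t_m_diff]) simp

lemma \<rho>_nonneg: "0 \<le> \<rho>"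
  using dotp_m_m_diff by linarith

text \<open>The barycentre of vectors of length at most one. This keeps the enlarged variance
  \<open>dotp m m + (1 - q)\<close> within the range \<open>2\<close> allowed in
  \<open>bigauss_lip\<close>.\<close>

lemma dotp_m_m_le: "dotp m m \<le> 1"
proof -
  have *: "dotp (t \<sigma>) (t \<tau>) \<le> 1" if "\<sigma> \<in> S" "\<tau> \<in> S" for \<sigma> \<tau>
    using abs_dotp_le1[of "t \<sigma>" "t \<tau>"] that a by (auto simp: dotp_t_t)
  have avg: "(\<Sum>\<sigma>\<in>S. G \<sigma> * x \<sigma>) \<le> 1" if "\<And>\<sigma>. \<sigma> \<in> S \<Longrightarrow> x \<sigma> \<le> 1" for x
  proof -
    have "(\<Sum>\<sigma>\<in>S. G \<sigma> * x \<sigma>) \<le> (\<Sum>\<sigma>\<in>S. G \<sigma> * 1)"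
      using that G by (intro sum_mono mult_left_mono) auto
    then show ?thesis using G by simp
  qed
  show ?thesis
    unfolding dotp_m_left[of m] dotp_t_m by (intro avg *)
qed

lemma distr_dotp: "distr M (borel \<Otimes>\<^sub>M borel) (\<lambda>g. (dotp x g, dotp y g)) = bigauss (dotp x x) (dotp x y) (dotp y y)"
  using distr_linear_functionals[OF J, of x y] by (simp add: dotp_def power2_eq_square)

lemma dotp_integral:
  fixes F :: "real \<times> real \<Rightarrow> real"
  assumes [measurable]: "F \<in> borel_measurable (borel \<Otimes>\<^sub>M borel)"
  shows "(\<integral>g. F (dotp x g, dotp y g) \<partial>M) = (\<integral>z. F z \<partial>bigauss (dotp x x) (dotp x y) (dotp y y))"
    and "integrable (bigauss (dotp x x) (dotp x y) (dotp y y)) F \<Longrightarrow> integrable M (\<lambda>g. F (dotp x g, dotp y g))"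
  unfolding distr_dotp[symmetric] by (simp_all add: integral_distr integrable_distr_eq)

text \<open>The weights have total mass one, so constants survive, the replica term averages to
  \<open>\<rho>\<close>, and each of the two barycentre terms averages to at most
  \<open>\<rho>\<close>.\<close>

lemma double_sum_bound:
  assumes I: "\<And>\<sigma> \<tau>. \<sigma> \<in> S \<Longrightarrow> \<tau> \<in> S \<Longrightarrow> I \<sigma> \<tau> \<le> k0 + k1 * \<bar>dotp (t \<sigma>) (t \<tau>) - q\<bar>
      + k2 * \<bar>dotp (t \<sigma>) m - q\<bar> + k2 * \<bar>dotp (t \<tau>) m - q\<bar>" and k: "0 \<le> k2"
  shows "(\<Sum>\<sigma>\<in>S. \<Sum>\<tau>\<in>S. G \<sigma> * G \<tau> * I \<sigma> \<tau>) \<le> k0 + (k1 + 2 * k2) * \<rho>"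
proof -
  let ?e = "\<lambda>\<sigma>. \<bar>dotp (t \<sigma>) m - q\<bar>"
  have "(\<Sum>\<sigma>\<in>S. \<Sum>\<tau>\<in>S. G \<sigma> * G \<tau> * I \<sigma> \<tau>)
    \<le> (\<Sum>\<sigma>\<in>S. \<Sum>\<tau>\<in>S. G \<sigma> * G \<tau> * (k0 + k1 * \<bar>dotp (t \<sigma>) (t \<tau>) - q\<bar> + k2 * ?e \<sigma> + k2 * ?e \<tau>))"
    using G by (intro sum_mono mult_left_mono I) auto
  also have "\<dots> = (\<Sum>\<sigma>\<in>S. \<Sum>\<tau>\<in>S. G \<sigma> * (G \<tau> * k0)) + k1 * \<rho>
      + (\<Sum>\<sigma>\<in>S. \<Sum>\<tau>\<in>S. G \<sigma> * (G \<tau> * (k2 * ?e \<sigma>))) + (\<Sum>\<sigma>\<in>S. \<Sum>\<tau>\<in>S. G \<sigma> * (G \<tau> * (k2 * ?e \<tau>)))"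
    by (simp add: \<rho>_def distrib_left sum.distrib sum_distrib_left mult_ac)
  also have "(\<Sum>\<sigma>\<in>S. \<Sum>\<tau>\<in>S. G \<sigma> * (G \<tau> * k0)) = k0"
    using G(2) by (simp flip: sum_distrib_left sum_distrib_right)
  also have "(\<Sum>\<sigma>\<in>S. \<Sum>\<tau>\<in>S. G \<sigma> * (G \<tau> * (k2 * ?e \<sigma>))) = k2 * (\<Sum>\<sigma>\<in>S. G \<sigma> * ?e \<sigma>)"
  proof -
    have "(\<Sum>\<sigma>\<in>S. \<Sum>\<tau>\<in>S. G \<sigma> * (G \<tau> * (k2 * ?e \<sigma>))) = (\<Sum>\<sigma>\<in>S. G \<sigma> * (k2 * ?e \<sigma>)) * (\<Sum>\<tau>\<in>S. G \<tau>)"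
      unfolding sum_product by (simp add: mult_ac)
    then show ?thesis using G(2) by (simp add: sum_distrib_left mult_ac)
  qed
  also have "(\<Sum>\<sigma>\<in>S. \<Sum>\<tau>\<in>S. G \<sigma> * (G \<tau> * (k2 * ?e \<tau>))) = k2 * (\<Sum>\<sigma>\<in>S. G \<sigma> * ?e \<sigma>)"
  proof -
    have "(\<Sum>\<sigma>\<in>S. \<Sum>\<tau>\<in>S. G \<sigma> * (G \<tau> * (k2 * ?e \<tau>))) = (\<Sum>\<sigma>\<in>S. G \<sigma>) * (\<Sum>\<tau>\<in>S. G \<tau> * (k2 * ?e \<tau>))"
      by (simp add: sum_product)
    then show ?thesis using G(2) by (simp add: sum_distrib_left mult_ac)
  qed
  finally have "(\<Sum>\<sigma>\<in>S. \<Sum>\<tau>\<in>S. G \<sigma> * G \<tau> * I \<sigma> \<tau>) \<le> k0 + k1 * \<rho> + 2 * (k2 * (\<Sum>\<sigma>\<in>S. G \<sigma> * ?e \<sigma>))"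
    by simp
  also have "\<dots> \<le> k0 + k1 * \<rho> + 2 * (k2 * \<rho>)"
    using sum_dotp_t_m_diff k by (simp add: mult_left_mono)
  finally show ?thesis by (simp add: algebra_simps)
qed

lemma square_sum_eq:
  "((\<Sum>\<sigma>\<in>S. G \<sigma> * x \<sigma>) :: real)\<^sup>2 = (\<Sum>\<sigma>\<in>S. \<Sum>\<tau>\<in>S. G \<sigma> * G \<tau> * (x \<sigma> * x \<tau>))"
  by (simp add: power2_eq_square sum_product mult_ac)

text \<open>With \<open>h\<close> the smoothed \<open>f\<close>, expanding the square over two
  replicas yields the products \<open>f f\<close>, \<open>f h\<close> (twice, with a minus sign) and
  \<open>h h\<close>. Each expectation is an integral of \<open>F\<close>, that is
  \<open>f x * f y\<close>, at a covariance near \<open>(1, q, 1)\<close>; the common limit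
  \<open>T0\<close> cancels.\<close>

lemma replica_average_approx:
  assumes lip: "bigauss_lip q p C" and f [measurable]: "f \<in> borel_measurable borel"
    and bound: "\<And>x. \<bar>f x\<bar> \<le> K * exp (p * \<bar>x\<bar>)"
  shows "integrable M (\<lambda>g. ((\<Sum>\<sigma>\<in>S. G \<sigma> * f (dotp (t \<sigma>) g)) - gauss_smooth (sqrt (1 - q)) f (dotp m g))\<^sup>2)" (is ?int)
    and "(\<integral>g. ((\<Sum>\<sigma>\<in>S. G \<sigma> * f (dotp (t \<sigma>) g)) - gauss_smooth (sqrt (1 - q)) f (dotp m g))\<^sup>2 \<partial>M)
      \<le> 8 * C * K\<^sup>2 * (\<bar>a - 1\<bar> + \<rho>)" (is ?bd)
proof -
  define s where "s = sqrt (1 - q)"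
  have s2: "s\<^sup>2 = 1 - q" using q by (simp add: s_def)
  define h where "h = gauss_smooth s f"
  have [measurable]: "h \<in> borel_measurable borel" unfolding h_def by measurable
  define F where "F = (\<lambda>z :: real \<times> real. f (fst z) * f (snd z))"
  have Fm [measurable]: "F \<in> borel_measurable (borel \<Otimes>\<^sub>M borel)" unfolding F_def by measurable
  have K: "0 \<le> K" using order_trans[OF abs_ge_zero bound[of 0]] by simp
  have Fb: "\<bar>F z\<bar> \<le> K\<^sup>2 * exp (p * (\<bar>fst z\<bar> + \<bar>snd z\<bar>))" for z
  proof -
    have "\<bar>F z\<bar> \<le> (K * exp (p * \<bar>fst z\<bar>)) * (K * exp (p * \<bar>snd z\<bar>))"
      unfolding F_def abs_mult using K by (intro mult_mono bound) auto
    then show ?thesis by (simp add: power2_eq_square exp_add algebra_simps)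
  qed
  define T0 where "T0 = (\<integral>z. F z \<partial>bigauss 1 q 1)"
  define C' where "C' = C * K\<^sup>2"
  have C'0: "0 \<le> C'" using lip by (simp add: C'_def bigauss_lip_def)
  have L: "\<bar>(\<integral>z. F z \<partial>bigauss a' c b) - T0\<bar> \<le> C' * (\<bar>a' - 1\<bar> + \<bar>c - q\<bar> + \<bar>b - 1\<bar>)"
    if "0 \<le> a'" "a' \<le> 2" "0 \<le> b" "b \<le> 2" "c\<^sup>2 \<le> a' * b" for a' c b
    using lip that Fb Fm unfolding bigauss_lip_def T0_def C'_def by blast
  note iF = bigauss_bound(1)[OF _ _ _ _ _ Fm Fb]
  define v where "v = dotp m m"
  have v: "0 \<le> v" "v \<le> 1" "\<bar>v - q\<bar> \<le> \<rho>"
    using dotp_nonneg dotp_m_m_le dotp_m_m_diff by (auto simp: v_def)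
  have b: "0 \<le> v + s\<^sup>2" "v + s\<^sup>2 \<le> 2" "\<bar>v + s\<^sup>2 - 1\<bar> = \<bar>v - q\<bar>"
    using v q by (auto simp: s2)

  \<comment> \<open>Two replicas: covariance
    \<open>(a, dotp (t \<sigma>) (t \<tau>), a)\<close>.\<close>
  have T1: "integrable M (\<lambda>g. f (dotp (t \<sigma>) g) * f (dotp (t \<tau>) g))"
    "\<bar>(\<integral>g. f (dotp (t \<sigma>) g) * f (dotp (t \<tau>) g) \<partial>M) - T0\<bar> \<le> C' * (2 * \<bar>a - 1\<bar> + \<bar>dotp (t \<sigma>) (t \<tau>) - q\<bar>)"
    if "\<sigma> \<in> S" "\<tau> \<in> S" for \<sigma> \<tau>
  proof -
    have cs: "(dotp (t \<sigma>) (t \<tau>))\<^sup>2 \<le> a * a"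
      using dotp_cauchy_schwarz[of "t \<sigma>" "t \<tau>"] that by (simp add: dotp_t_t)
    have "integrable (bigauss a (dotp (t \<sigma>) (t \<tau>)) a) F"
      using a cs by (intro iF) auto
    then show "integrable M (\<lambda>g. f (dotp (t \<sigma>) g) * f (dotp (t \<tau>) g))"
      using dotp_integral(2)[OF Fm, of "t \<sigma>" "t \<tau>"] that by (simp add: dotp_t_t F_def)
    have "\<bar>(\<integral>z. F z \<partial>bigauss a (dotp (t \<sigma>) (t \<tau>)) a) - T0\<bar> \<le> C' * (\<bar>a - 1\<bar> + \<bar>dotp (t \<sigma>) (t \<tau>) - q\<bar> + \<bar>a - 1\<bar>)"
      using a cs by (intro L) auto
    then show "\<bar>(\<integral>g. f (dotp (t \<sigma>) g) * f (dotp (t \<tau>) g) \<partial>M) - T0\<bar> \<le> C' * (2 * \<bar>a - 1\<bar> + \<bar>dotp (t \<sigma>) (t \<tau>) - q\<bar>)"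
      using dotp_integral(1)[OF Fm, of "t \<sigma>" "t \<tau>"] that by (simp add: dotp_t_t F_def algebra_simps)
  qed

  define F1 where "F1 = (\<lambda>z :: real \<times> real. f (fst z) * h (snd z))"
  have F1m [measurable]: "F1 \<in> borel_measurable (borel \<Otimes>\<^sub>M borel)" unfolding F1_def by measurable
  have F1: "(\<integral>z. F (fst p + 0 * z, snd p + s * z) \<partial>gauss) = F1 p" for p
    by (simp add: F_def F1_def h_def gauss_smooth_def)
  \<comment> \<open>A replica against the smoothed barycentre: noise of variance
    \<open>1 - q\<close> in the second coordinate alone gives
    \<open>(a, dotp (t \<sigma>) m, v + s^2)\<close>.\<close>
  have T2: "integrable M (\<lambda>g. f (dotp (t \<sigma>) g) * h (dotp m g))"
    "\<bar>(\<integral>g. f (dotp (t \<sigma>) g) * h (dotp m g) \<partial>M) - T0\<bar> \<le> C' * (\<bar>a - 1\<bar> + \<bar>dotp (t \<sigma>) m - q\<bar> + \<rho>)"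
    if "\<sigma> \<in> S" for \<sigma>
  proof -
    let ?c = "dotp (t \<sigma>) m"
    have cs: "?c\<^sup>2 \<le> a * v"
      using dotp_cauchy_schwarz[of "t \<sigma>" m] that by (simp add: dotp_t_t v_def)
    then have cs': "?c\<^sup>2 \<le> a * (v + s\<^sup>2)"
      using a by (simp add: distrib_left add_increasing2)
    have i: "integrable (bigauss (a + 0\<^sup>2) (?c + 0 * s) (v + s\<^sup>2)) F"
      using a b cs' by (intro iF) auto
    note noise = bigauss_noise[OF a(1) v(1) cs Fm i, unfolded F1]
    show "integrable M (\<lambda>g. f (dotp (t \<sigma>) g) * h (dotp m g))"
      using dotp_integral(2)[OF F1m, of "t \<sigma>" m] noise(1) that by (simp add: dotp_t_t F1_def v_def)
    have "\<bar>(\<integral>z. F z \<partial>bigauss a ?c (v + s\<^sup>2)) - T0\<bar> \<le> C' * (\<bar>a - 1\<bar> + \<bar>?c - q\<bar> + \<bar>v + s\<^sup>2 - 1\<bar>)"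
      using a b cs' by (intro L) auto
    also have "\<dots> \<le> C' * (\<bar>a - 1\<bar> + \<bar>?c - q\<bar> + \<rho>)"
      using v b C'0 by (intro mult_left_mono) auto
    finally show "\<bar>(\<integral>g. f (dotp (t \<sigma>) g) * h (dotp m g) \<partial>M) - T0\<bar> \<le> C' * (\<bar>a - 1\<bar> + \<bar>?c - q\<bar> + \<rho>)"
      using dotp_integral(1)[OF F1m, of "t \<sigma>" m] noise(2) that by (simp add: dotp_t_t F1_def v_def)
  qed

  \<comment> \<open>Both factors smoothed by independent noises, added one after the other:
    \<open>(v + s^2, v, v + s^2)\<close>. The independence keeps the off-diagonal entry at
    \<open>v\<close>, close to \<open>q\<close>.\<close>
  have T3: "integrable M (\<lambda>g. h (dotp m g) * h (dotp m g))"
    "\<bar>(\<integral>g. h (dotp m g) * h (dotp m g) \<partial>M) - T0\<bar> \<le> C' * (3 * \<rho>)"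
  proof -
    have cs: "v\<^sup>2 \<le> (v + s\<^sup>2) * v"
      using v by (simp add: power2_eq_square mult_right_mono)
    have cs': "v\<^sup>2 \<le> (v + s\<^sup>2) * (v + s\<^sup>2)"
      using v by (simp add: power2_eq_square mult_mono)
    have i: "integrable (bigauss ((v + s\<^sup>2) + 0\<^sup>2) (v + 0 * s) (v + s\<^sup>2)) F"
      using b cs' by (intro iF) auto
    note noise = bigauss_noise[OF b(1) v(1) cs Fm i, unfolded F1]
    have vv: "v\<^sup>2 \<le> v * v" by (simp add: power2_eq_square)
    have i2: "integrable (bigauss (v + s\<^sup>2) (v + s * 0) (v + 0\<^sup>2)) F1"
      using noise(1) by simp
    define F2 where "F2 = (\<lambda>z :: real \<times> real. h (fst z) * h (snd z))"
    have F2m [measurable]: "F2 \<in> borel_measurable (borel \<Otimes>\<^sub>M borel)" unfolding F2_def by measurable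
    have F2: "(\<integral>z. F1 (fst p + s * z, snd p + 0 * z) \<partial>gauss) = F2 p" for p
      by (simp add: F1_def F2_def h_def gauss_smooth_def)
    note noise2 = bigauss_noise[OF v(1) v(1) vv F1m i2, unfolded F2]
    show "integrable M (\<lambda>g. h (dotp m g) * h (dotp m g))"
      using dotp_integral(2)[OF F2m, of m m] noise2(1) by (simp add: F2_def v_def)
    have "\<bar>(\<integral>z. F z \<partial>bigauss (v + s\<^sup>2) v (v + s\<^sup>2)) - T0\<bar> \<le> C' * (\<bar>v + s\<^sup>2 - 1\<bar> + \<bar>v - q\<bar> + \<bar>v + s\<^sup>2 - 1\<bar>)"
      using b cs' by (intro L) auto
    also have "\<dots> \<le> C' * (3 * \<rho>)"
      using v b C'0 by (intro mult_left_mono) auto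
    finally show "\<bar>(\<integral>g. h (dotp m g) * h (dotp m g) \<partial>M) - T0\<bar> \<le> C' * (3 * \<rho>)"
      using dotp_integral(1)[OF F2m, of m m] noise(2) noise2(2) by (simp add: F2_def v_def)
  qed

  have sq: "((\<Sum>\<sigma>\<in>S. G \<sigma> * f (dotp (t \<sigma>) g)) - h (dotp m g))\<^sup>2
    = (\<Sum>\<sigma>\<in>S. \<Sum>\<tau>\<in>S. G \<sigma> * G \<tau> * (f (dotp (t \<sigma>) g) * f (dotp (t \<tau>) g)
        - f (dotp (t \<sigma>) g) * h (dotp m g) - f (dotp (t \<tau>) g) * h (dotp m g) + h (dotp m g) * h (dotp m g)))" for g
  proof -
    have "(\<Sum>\<sigma>\<in>S. G \<sigma> * f (dotp (t \<sigma>) g)) - h (dotp m g) = (\<Sum>\<sigma>\<in>S. G \<sigma> * (f (dotp (t \<sigma>) g) - h (dotp m g)))"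
      using G(2) by (simp add: right_diff_distrib sum_subtractf flip: sum_distrib_right)
    then show ?thesis by (simp only: square_sum_eq) (simp add: algebra_simps)
  qed
  have int: "integrable M (\<lambda>g. G \<sigma> * G \<tau> * (f (dotp (t \<sigma>) g) * f (dotp (t \<tau>) g)
        - f (dotp (t \<sigma>) g) * h (dotp m g) - f (dotp (t \<tau>) g) * h (dotp m g) + h (dotp m g) * h (dotp m g)))"
    if "\<sigma> \<in> S" "\<tau> \<in> S" for \<sigma> \<tau>
    using that by (intro integrable_mult_right Bochner_Integration.integrable_add Bochner_Integration.integrable_diff T1 T2 T3)
  show ?int
    unfolding s_def[symmetric] h_def[symmetric] sq
    by (intro Bochner_Integration.integrable_sum int)
  have "(\<integral>g. ((\<Sum>\<sigma>\<in>S. G \<sigma> * f (dotp (t \<sigma>) g)) - h (dotp m g))\<^sup>2 \<partial>M)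
    = (\<Sum>\<sigma>\<in>S. \<Sum>\<tau>\<in>S. G \<sigma> * G \<tau> * ((\<integral>g. f (dotp (t \<sigma>) g) * f (dotp (t \<tau>) g) \<partial>M)
      - (\<integral>g. f (dotp (t \<sigma>) g) * h (dotp m g) \<partial>M) - (\<integral>g. f (dotp (t \<tau>) g) * h (dotp m g) \<partial>M)
      + (\<integral>g. h (dotp m g) * h (dotp m g) \<partial>M)))"
    unfolding sq using int T1(1) T2(1) T3(1)
    by (subst Bochner_Integration.integral_sum)
      (auto simp: Bochner_Integration.integral_sum intro!: sum.cong Bochner_Integration.integrable_sum)
  \<comment> \<open>\<open>T1\<close> and the two uses of \<open>T2\<close> contribute
    \<open>2 + 1 + 1\<close> multiples of \<open>|a - 1|\<close>; the two uses of \<open>T2\<close>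
    and \<open>T3\<close> contribute \<open>1 + 1 + 3\<close> of \<open>\<rho>\<close>, and the
    averaged deviations three more.\<close>
  also have "\<dots> \<le> C' * (4 * \<bar>a - 1\<bar> + 5 * \<rho>) + (C' + 2 * C') * \<rho>"
  proof (rule double_sum_bound)
    fix \<sigma> \<tau> assume st: "\<sigma> \<in> S" "\<tau> \<in> S"
    have *: "x - y - z + w \<le> e1 + e2 + e3 + e4"
      if "\<bar>x - T0\<bar> \<le> e1" "\<bar>y - T0\<bar> \<le> e2" "\<bar>z - T0\<bar> \<le> e3" "\<bar>w - T0\<bar> \<le> e4" for x y z w e1 e2 e3 e4
      using that unfolding abs_le_iff by linarith
    show "(\<integral>g. f (dotp (t \<sigma>) g) * f (dotp (t \<tau>) g) \<partial>M)
      - (\<integral>g. f (dotp (t \<sigma>) g) * h (dotp m g) \<partial>M) - (\<integral>g. f (dotp (t \<tau>) g) * h (dotp m g) \<partial>M)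
      + (\<integral>g. h (dotp m g) * h (dotp m g) \<partial>M)
      \<le> C' * (4 * \<bar>a - 1\<bar> + 5 * \<rho>) + C' * \<bar>dotp (t \<sigma>) (t \<tau>) - q\<bar>
        + C' * \<bar>dotp (t \<sigma>) m - q\<bar> + C' * \<bar>dotp (t \<tau>) m - q\<bar>"
      by (rule order_trans[OF *[OF T1(2)[OF st] T2(2)[OF st(1)] T2(2)[OF st(2)] T3(2)]]) (simp add: algebra_simps)
  qed (use C'0 in auto)
  also have "\<dots> \<le> 8 * C' * (\<bar>a - 1\<bar> + \<rho>)"
    using C'0 by (simp add: algebra_simps)
  finally show ?bd
    unfolding s_def[symmetric] h_def[symmetric] C'_def by (simp add: mult.assoc)
qed

section \<open>Exact moments under exponential tilts\<close>

lemma integral_square_exp_dotp: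
  "has_bochner_integral M (\<lambda>g. (dotp x g - k)\<^sup>2 * exp (dotp y g))
    (exp (dotp y y / 2) * (dotp x x + (dotp x y - k)\<^sup>2))"
proof -
  have "has_bochner_integral (bigauss (dotp x x) (dotp x y) (dotp y y)) (\<lambda>z. (fst z - k)\<^sup>2 * exp (snd z))
    (exp (dotp y y / 2) * (dotp x x + (dotp x y - k)\<^sup>2))"
    by (rule has_bochner_integral_bigauss_square_exp[OF dotp_nonneg dotp_nonneg dotp_cauchy_schwarz])
  then show ?thesis
    using dotp_integral[of "\<lambda>z. (fst z - k)\<^sup>2 * exp (snd z)" x y]
    by (simp add: has_bochner_integral_iff)
qed

lemma integral_exp_dotp:
  "has_bochner_integral M (\<lambda>g. exp (dotp x g)) (exp (dotp x x / 2))"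
proof -
  have "has_bochner_integral (bigauss (dotp x x) (dotp x x) (dotp x x)) (\<lambda>z. exp (1 * fst z + 0 * snd z))
    (exp ((1\<^sup>2 * dotp x x + 2 * 1 * 0 * dotp x x + 0\<^sup>2 * dotp x x) / 2))"
    by (rule has_bochner_integral_bigauss_exp[OF dotp_nonneg dotp_nonneg dotp_cauchy_schwarz])
  then show ?thesis
    using dotp_integral[of "\<lambda>z. exp (fst z)" x x]
    by (simp add: has_bochner_integral_iff)
qed

text \<open>Polarisation: the product is a quarter of the difference of two squares, in which the
  constants combine to \<open>2 * k\<close> and \<open>0\<close>.\<close>

lemma integral_product_exp_dotp:
  "has_bochner_integral M (\<lambda>g. (dotp x g - k) * (dotp y g - k) * exp (dotp z g))
    (exp (dotp z z / 2) * (dotp x y + (dotp x z - k) * (dotp y z - k)))"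
proof -
  have eq: "(dotp x g - k) * (dotp y g - k) * exp (dotp z g)
    = (1 / 4) * ((dotp (\<lambda>j. x j + y j) g - 2 * k)\<^sup>2 * exp (dotp z g) - (dotp (\<lambda>j. x j - y j) g - 0)\<^sup>2 * exp (dotp z g))" for g
    by (simp add: dotp_add_left dotp_diff_left power2_eq_square algebra_simps)
  have "has_bochner_integral M (\<lambda>g. (dotp x g - k) * (dotp y g - k) * exp (dotp z g))
    ((1 / 4) * (exp (dotp z z / 2) * (dotp (\<lambda>j. x j + y j) (\<lambda>j. x j + y j) + (dotp (\<lambda>j. x j + y j) z - 2 * k)\<^sup>2)
      - exp (dotp z z / 2) * (dotp (\<lambda>j. x j - y j) (\<lambda>j. x j - y j) + (dotp (\<lambda>j. x j - y j) z - 0)\<^sup>2)))"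
    unfolding eq by (intro has_bochner_integral_mult_right has_bochner_integral_diff integral_square_exp_dotp)
  also have "(1 / 4) * (exp (dotp z z / 2) * (dotp (\<lambda>j. x j + y j) (\<lambda>j. x j + y j) + (dotp (\<lambda>j. x j + y j) z - 2 * k)\<^sup>2)
      - exp (dotp z z / 2) * (dotp (\<lambda>j. x j - y j) (\<lambda>j. x j - y j) + (dotp (\<lambda>j. x j - y j) z - 0)\<^sup>2))
    = exp (dotp z z / 2) * (dotp x y + (dotp x z - k) * (dotp y z - k))"
    by (simp add: dotp_add_left dotp_diff_left dotp_add_right dotp_diff_right dotp_commute[of y x] power2_eq_square algebra_simps)
  finally show ?thesis .
qed

text \<open>The field minus its mean is nearly normal with variance \<open>1 - q\<close> and
  independent of the mean, so the weight \<open>exp (\<kappa> * x)\<close> shifts it by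
  \<open>\<kappa> * (1 - q)\<close>. The integrand involves both the field and its mean in explicit
  form, so the second moment is computed exactly and every entry is then compared with its value at
  overlap \<open>q\<close>.\<close>

lemma tilted_field_approx:
  shows "integrable M (\<lambda>g. (\<Sum>\<sigma>\<in>S. G \<sigma> * ((dotp (t \<sigma>) g - dotp m g - \<kappa> * (1 - q)) * exp (\<kappa> * dotp (t \<sigma>) g)))\<^sup>2)" (is ?int)
    and "(\<integral>g. (\<Sum>\<sigma>\<in>S. G \<sigma> * ((dotp (t \<sigma>) g - dotp m g - \<kappa> * (1 - q)) * exp (\<kappa> * dotp (t \<sigma>) g)))\<^sup>2 \<partial>M)
      \<le> exp (2 * \<kappa>\<^sup>2) * (4 + 18 * \<kappa>\<^sup>2) * (\<bar>a - 1\<bar> + \<rho>)" (is ?bd)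
proof -
  define p where "p = (\<lambda>\<sigma> j. t \<sigma> j - m j)"
  define T where "T = (\<lambda>\<sigma> \<tau> j. \<kappa> * (t \<sigma> j + t \<tau> j))"
  define k where "k = \<kappa> * (1 - q)"
  define I where "I = (\<lambda>\<sigma> \<tau>. exp (dotp (T \<sigma> \<tau>) (T \<sigma> \<tau>) / 2) *
     (dotp (p \<sigma>) (p \<tau>) + (dotp (p \<sigma>) (T \<sigma> \<tau>) - k) * (dotp (p \<tau>) (T \<sigma> \<tau>) - k)))"
  have sq: "(\<Sum>\<sigma>\<in>S. G \<sigma> * ((dotp (t \<sigma>) g - dotp m g - \<kappa> * (1 - q)) * exp (\<kappa> * dotp (t \<sigma>) g)))\<^sup>2
    = (\<Sum>\<sigma>\<in>S. \<Sum>\<tau>\<in>S. G \<sigma> * G \<tau> * ((dotp (p \<sigma>) g - k) * (dotp (p \<tau>) g - k) * exp (dotp (T \<sigma> \<tau>) g)))" for g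
    unfolding square_sum_eq
    by (intro sum.cong refl) (simp add: p_def T_def k_def dotp_scale_left dotp_add_left dotp_diff_left
      distrib_left exp_add mult_ac)
  have hb: "has_bochner_integral M (\<lambda>g. (\<Sum>\<sigma>\<in>S. \<Sum>\<tau>\<in>S. G \<sigma> * G \<tau> *
      ((dotp (p \<sigma>) g - k) * (dotp (p \<tau>) g - k) * exp (dotp (T \<sigma> \<tau>) g)))) (\<Sum>\<sigma>\<in>S. \<Sum>\<tau>\<in>S. G \<sigma> * G \<tau> * I \<sigma> \<tau>)"
    unfolding I_def by (intro has_bochner_integral_sum has_bochner_integral_mult_right integral_product_exp_dotp)
  from hb show ?int unfolding sq by (simp add: has_bochner_integral_iff)
  have bdI: "I \<sigma> \<tau> \<le> exp (2 * \<kappa>\<^sup>2) * (\<rho> + 6 * \<kappa>\<^sup>2 * \<bar>a - 1\<bar>) + exp (2 * \<kappa>\<^sup>2) * (1 + 6 * \<kappa>\<^sup>2) * \<bar>dotp (t \<sigma>) (t \<tau>) - q\<bar>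
      + exp (2 * \<kappa>\<^sup>2) * (1 + 6 * \<kappa>\<^sup>2) * \<bar>dotp (t \<sigma>) m - q\<bar> + exp (2 * \<kappa>\<^sup>2) * (1 + 6 * \<kappa>\<^sup>2) * \<bar>dotp (t \<tau>) m - q\<bar>"
    if st: "\<sigma> \<in> S" "\<tau> \<in> S" for \<sigma> \<tau>
  proof -
    define R c c' v where "R = dotp (t \<sigma>) (t \<tau>)" "c = dotp (t \<sigma>) m" "c' = dotp (t \<tau>) m" "v = dotp m m"
    have le1: "\<bar>R\<bar> \<le> 1" "\<bar>c\<bar> \<le> 1" "\<bar>c'\<bar> \<le> 1"
      unfolding R_c_c'_v_def using st a by (auto intro!: abs_dotp_le1 simp: dotp_t_t dotp_m_m_le)
    \<comment> \<open>Either replica, tilted by the sum of both exponents, is shifted by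
      \<open>\<kappa> * (a + R - c - c')\<close>; \<open>\<kappa> * X\<close> is the excess over
      \<open>\<kappa> * (1 - q)\<close>, the same for both.\<close>
    define X where "X = (a - 1) + (R - q) - (c - q) - (c' - q)"
    have pp: "dotp (p \<sigma>) (p \<tau>) = (R - q) - (c - q) - (c' - q) + (v - q)"
      by (simp add: p_def R_c_c'_v_def dotp_diff_left dotp_diff_right dotp_commute[of m "t \<tau>"])
    have pT: "dotp (p \<sigma>) (T \<sigma> \<tau>) - k = \<kappa> * X" "dotp (p \<tau>) (T \<sigma> \<tau>) - k = \<kappa> * X"
      using st by (simp_all add: p_def T_def k_def X_def R_c_c'_v_def dotp_diff_left dotp_scale_right dotp_add_right
        dotp_t_t dotp_commute[of m] dotp_commute[of "t \<tau>" "t \<sigma>"] algebra_simps)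
    have TT: "dotp (T \<sigma> \<tau>) (T \<sigma> \<tau>) = \<kappa>\<^sup>2 * (2 * a + 2 * R)"
      using st by (simp add: T_def R_c_c'_v_def dotp_scale_left dotp_scale_right dotp_add_left dotp_add_right
        dotp_t_t dotp_commute[of "t \<tau>" "t \<sigma>"] power2_eq_square algebra_simps)
    have "dotp (T \<sigma> \<tau>) (T \<sigma> \<tau>) \<le> \<kappa>\<^sup>2 * 4"
      unfolding TT using a le1 by (intro mult_left_mono) auto
    then have e: "exp (dotp (T \<sigma> \<tau>) (T \<sigma> \<tau>) / 2) \<le> exp (2 * \<kappa>\<^sup>2)" by simp
    have tri: "\<bar>(s - q) - (t' - q) - (u - q) + (w - q)\<bar> \<le> \<bar>s - q\<bar> + \<bar>t' - q\<bar> + \<bar>u - q\<bar> + \<bar>w - q\<bar>" for s t' u w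
      by simp
    have A1: "\<bar>dotp (p \<sigma>) (p \<tau>)\<bar> \<le> \<bar>R - q\<bar> + \<bar>c - q\<bar> + \<bar>c' - q\<bar> + \<rho>"
      unfolding pp using tri[of R c c' v] dotp_m_m_diff unfolding R_c_c'_v_def by linarith
    have X1: "\<bar>X\<bar> \<le> 6"
      using le1 a q unfolding X_def abs_le_iff by linarith
    have tri2: "\<bar>w + (s - q) - (t' - q) - (u - q)\<bar> \<le> \<bar>w\<bar> + \<bar>s - q\<bar> + \<bar>t' - q\<bar> + \<bar>u - q\<bar>" for s t' u w
      by simp
    have X2: "\<bar>X\<bar> \<le> \<bar>a - 1\<bar> + \<bar>R - q\<bar> + \<bar>c - q\<bar> + \<bar>c' - q\<bar>"
      unfolding X_def by (rule tri2)
    \<comment> \<open>Boundedness of \<open>X\<close> turns its square into a linear expression in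
      the deviations, so \<open>\<rho>\<close> alone suffices.\<close>
    have "X\<^sup>2 = \<bar>X\<bar> * \<bar>X\<bar>" by (simp add: power2_eq_square)
    also have "\<dots> \<le> 6 * (\<bar>a - 1\<bar> + \<bar>R - q\<bar> + \<bar>c - q\<bar> + \<bar>c' - q\<bar>)"
      using X1 X2 by (intro mult_mono) auto
    finally have XX: "\<kappa>\<^sup>2 * X\<^sup>2 \<le> \<kappa>\<^sup>2 * (6 * (\<bar>a - 1\<bar> + \<bar>R - q\<bar> + \<bar>c - q\<bar> + \<bar>c' - q\<bar>))"
      by (intro mult_left_mono) auto
    have "I \<sigma> \<tau> = exp (dotp (T \<sigma> \<tau>) (T \<sigma> \<tau>) / 2) * (dotp (p \<sigma>) (p \<tau>) + \<kappa>\<^sup>2 * X\<^sup>2)"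
      unfolding I_def pT by (simp add: power2_eq_square)
    also have "\<dots> \<le> exp (dotp (T \<sigma> \<tau>) (T \<sigma> \<tau>) / 2) * (\<bar>R - q\<bar> + \<bar>c - q\<bar> + \<bar>c' - q\<bar> + \<rho>
        + \<kappa>\<^sup>2 * (6 * (\<bar>a - 1\<bar> + \<bar>R - q\<bar> + \<bar>c - q\<bar> + \<bar>c' - q\<bar>)))"
      by (intro mult_left_mono add_mono[OF abs_le_D1[OF A1] XX]) simp
    also have "\<dots> \<le> exp (2 * \<kappa>\<^sup>2) * (\<bar>R - q\<bar> + \<bar>c - q\<bar> + \<bar>c' - q\<bar> + \<rho>
        + \<kappa>\<^sup>2 * (6 * (\<bar>a - 1\<bar> + \<bar>R - q\<bar> + \<bar>c - q\<bar> + \<bar>c' - q\<bar>)))"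
      using \<rho>_nonneg by (intro mult_right_mono e) auto
    finally show ?thesis
      unfolding R_c_c'_v_def by (simp add: algebra_simps)
  qed
  have "(\<integral>g. (\<Sum>\<sigma>\<in>S. G \<sigma> * ((dotp (t \<sigma>) g - dotp m g - \<kappa> * (1 - q)) * exp (\<kappa> * dotp (t \<sigma>) g)))\<^sup>2 \<partial>M)
    = (\<Sum>\<sigma>\<in>S. \<Sum>\<tau>\<in>S. G \<sigma> * G \<tau> * I \<sigma> \<tau>)"
    unfolding sq using hb by (simp add: has_bochner_integral_iff)
  also have "\<dots> \<le> exp (2 * \<kappa>\<^sup>2) * (\<rho> + 6 * \<kappa>\<^sup>2 * \<bar>a - 1\<bar>)
     + (exp (2 * \<kappa>\<^sup>2) * (1 + 6 * \<kappa>\<^sup>2) + 2 * (exp (2 * \<kappa>\<^sup>2) * (1 + 6 * \<kappa>\<^sup>2))) * \<rho>"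
    by (rule double_sum_bound[OF bdI]) auto
  also have "\<dots> \<le> exp (2 * \<kappa>\<^sup>2) * (4 + 18 * \<kappa>\<^sup>2) * (\<bar>a - 1\<bar> + \<rho>)"
    using \<rho>_nonneg by (simp add: algebra_simps)
  finally show ?bd .
qed

end

section \<open>Tilted normal laws\<close>

lemma integrable_bounded_normal_density:
  fixes u :: "real \<Rightarrow> real"
  assumes [measurable]: "u \<in> borel_measurable borel" and u: "\<And>x. \<bar>u x\<bar> \<le> U" and "s > 0"
  shows "integrable lborel (\<lambda>x. u x * normal_density \<mu> s x)"
proof (rule Bochner_Integration.integrable_bound)
  show "integrable lborel (\<lambda>x. U * normal_density \<mu> s x)" using \<open>s > 0\<close> by simp
  show "AE x in lborel. norm (u x * normal_density \<mu> s x) \<le> norm (U * normal_density \<mu> s x)"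
    using order_trans[OF u abs_ge_self[of U]] by (auto simp: abs_mult intro!: mult_right_mono)
qed measurable

lemma abs_integral_normal_density_le:
  fixes u :: "real \<Rightarrow> real"
  assumes m [measurable]: "u \<in> borel_measurable borel" and u: "\<And>x. \<bar>u x\<bar> \<le> U" and "s > 0"
  shows "\<bar>\<integral>x. u x * normal_density \<mu> s x \<partial>lborel\<bar> \<le> U"
proof -
  have "\<bar>\<integral>x. u x * normal_density \<mu> s x \<partial>lborel\<bar> \<le> (\<integral>x. \<bar>u x * normal_density \<mu> s x\<bar> \<partial>lborel)"
    by (rule integral_abs_bound)
  also have "\<dots> \<le> (\<integral>x. U * normal_density \<mu> s x \<partial>lborel)"
    using \<open>s > 0\<close> u
    by (intro integral_mono integrable_abs integrable_bounded_normal_density[OF assms])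
      (auto simp: abs_mult intro!: mult_right_mono)
  finally show ?thesis using \<open>s > 0\<close> by simp
qed

text \<open>Lipschitz dependence on the mean in total variation. For means more than
  \<open>1\<close> apart the trivial bound \<open>2 * U\<close> suffices; otherwise the exponents
  differ by an expression linear in \<open>x\<close>, and a first absolute moment closes the
  estimate.\<close>

lemma integral_normal_density_lipschitz:
  fixes u :: "real \<Rightarrow> real"
  assumes m [measurable]: "u \<in> borel_measurable borel" and u: "\<And>x. \<bar>u x\<bar> \<le> U" and "s > 0"
  shows "\<bar>(\<integral>x. u x * normal_density \<mu> s x \<partial>lborel) - (\<integral>x. u x * normal_density \<nu> s x \<partial>lborel)\<bar>
    \<le> (2 + (2 * s + 1) / s\<^sup>2) * U * \<bar>\<mu> - \<nu>\<bar>" (is "\<bar>?I \<mu> - ?I \<nu>\<bar> \<le> _")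
proof -
  have U: "0 \<le> U" using order_trans[OF abs_ge_zero u[of 0]] .
  let ?n = "\<lambda>\<mu>. normal_density \<mu> s"
  note i = integrable_bounded_normal_density[OF assms]
  show ?thesis
  proof (cases "\<bar>\<mu> - \<nu>\<bar> \<le> 1")
    case False
    have "\<bar>?I \<mu> - ?I \<nu>\<bar> \<le> 2 * U"
      using abs_integral_normal_density_le[OF assms, of \<mu>] abs_integral_normal_density_le[OF assms, of \<nu>] by linarith
    also have "\<dots> \<le> 2 * U * \<bar>\<mu> - \<nu>\<bar>" using False U mult_left_mono[of 1 "\<bar>\<mu> - \<nu>\<bar>" "2 * U"] by simp
    also have "\<dots> \<le> (2 + (2 * s + 1) / s\<^sup>2) * U * \<bar>\<mu> - \<nu>\<bar>"
      using U \<open>s > 0\<close> by (intro mult_right_mono) auto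
    finally show ?thesis .
  next
    case True
    define c where "c = U * \<bar>\<mu> - \<nu>\<bar> / (2 * s\<^sup>2)"
    have c: "0 \<le> c" using U by (simp add: c_def)
    \<comment> \<open>For means at most \<open>1\<close> apart,
      \<open>|(x - \<mu>) + (x - \<nu>)|\<close> is at most \<open>2 * |x - \<mu>| + 1\<close>, and
      likewise with \<open>\<nu>\<close>; \<open>b\<close> majorises the difference through one mean
      at a time.\<close>
    define b where "b = (\<lambda>\<mu> x. ?n \<mu> x * (2 * \<bar>x - \<mu>\<bar> + 1))"
    have ib: "integrable lborel (b \<mu>)" "(\<integral>x. b \<mu> x \<partial>lborel) \<le> 2 * s + 1" for \<mu>
    proof -
      have mom: "integrable lborel (\<lambda>x. ?n \<mu> x * \<bar>x - \<mu>\<bar>)" "(\<integral>x. ?n \<mu> x * \<bar>x - \<mu>\<bar> \<partial>lborel) = s * sqrt (2 / pi)"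
        using integrable_normal_moment_abs[OF \<open>s > 0\<close>, of \<mu> 1] integral_normal_moment_abs_odd[OF \<open>s > 0\<close>, of \<mu> 0]
        by simp_all
      have "b \<mu> = (\<lambda>x. 2 * (?n \<mu> x * \<bar>x - \<mu>\<bar>) + ?n \<mu> x)"
        by (auto simp: b_def algebra_simps)
      then have "integrable lborel (b \<mu>)" "(\<integral>x. b \<mu> x \<partial>lborel) = 2 * (s * sqrt (2 / pi)) + 1"
        using mom \<open>s > 0\<close> by simp_all
      moreover have "sqrt (2 / pi) \<le> 1" using pi_gt3 by simp
      then have "s * sqrt (2 / pi) \<le> s" using \<open>s > 0\<close> by simp
      ultimately show "integrable lborel (b \<mu>)" "(\<integral>x. b \<mu> x \<partial>lborel) \<le> 2 * s + 1" by simp_all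
    qed
    have ptw: "\<bar>u x * ?n \<mu> x - u x * ?n \<nu> x\<bar> \<le> c * (b \<mu> x + b \<nu> x)" for x
    proof -
      define k where "k = ln (s\<^sup>2) / 2 + ln (2 * pi) / 2"
      have ne: "?n \<mu> x = exp (- (x - \<mu>)\<^sup>2 / (2 * s\<^sup>2) - k)" for \<mu>
        using normal_density_eq_exp[of "s\<^sup>2" \<mu> x] \<open>s > 0\<close> by (simp add: k_def)
      have "(- (x - \<mu>)\<^sup>2 / (2 * s\<^sup>2) - k) - (- (x - \<nu>)\<^sup>2 / (2 * s\<^sup>2) - k)
        = (\<mu> - \<nu>) * ((x - \<mu>) + (x - \<nu>)) / (2 * s\<^sup>2)"
        using \<open>s > 0\<close> by (simp add: field_simps) (simp add: power2_eq_square algebra_simps)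
      then have ed: "\<bar>?n \<mu> x - ?n \<nu> x\<bar> \<le> \<bar>(\<mu> - \<nu>) * ((x - \<mu>) + (x - \<nu>)) / (2 * s\<^sup>2)\<bar> * (?n \<mu> x + ?n \<nu> x)"
        unfolding ne using abs_exp_diff_le by metis
      have "\<bar>u x * ?n \<mu> x - u x * ?n \<nu> x\<bar> = \<bar>u x\<bar> * \<bar>?n \<mu> x - ?n \<nu> x\<bar>"
        by (simp add: right_diff_distrib flip: abs_mult)
      also have "\<dots> \<le> U * (\<bar>(\<mu> - \<nu>) * ((x - \<mu>) + (x - \<nu>)) / (2 * s\<^sup>2)\<bar> * (?n \<mu> x + ?n \<nu> x))"
        by (intro mult_mono u ed U) auto
      also have "\<dots> = c * (\<bar>(x - \<mu>) + (x - \<nu>)\<bar> * ?n \<mu> x + \<bar>(x - \<mu>) + (x - \<nu>)\<bar> * ?n \<nu> x)"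
      proof -
        have "\<bar>(\<mu> - \<nu>) * S / (2 * s\<^sup>2)\<bar> = \<bar>\<mu> - \<nu>\<bar> * \<bar>S\<bar> / (2 * s\<^sup>2)" for S
          by (simp add: abs_mult)
        then show ?thesis
          unfolding c_def by (simp only:) (simp add: distrib_left distrib_right add_divide_distrib mult_ac)
      qed
      also have "\<dots> \<le> c * (b \<mu> x + b \<nu> x)"
      proof (intro mult_left_mono add_mono c)
        have d: "\<bar>(x - \<mu>) + (x - \<nu>)\<bar> \<le> 2 * \<bar>x - \<mu>\<bar> + 1" "\<bar>(x - \<mu>) + (x - \<nu>)\<bar> \<le> 2 * \<bar>x - \<nu>\<bar> + 1"
          using True by (auto simp: abs_if split: if_splits)
        show "\<bar>(x - \<mu>) + (x - \<nu>)\<bar> * ?n \<mu> x \<le> b \<mu> x" "\<bar>(x - \<mu>) + (x - \<nu>)\<bar> * ?n \<nu> x \<le> b \<nu> x"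
          unfolding b_def using mult_left_mono[OF d(1), of "?n \<mu> x"] mult_left_mono[OF d(2), of "?n \<nu> x"]
          by (simp_all add: mult.commute)
      qed
      finally show ?thesis .
    qed
    have "\<bar>?I \<mu> - ?I \<nu>\<bar> = \<bar>\<integral>x. u x * ?n \<mu> x - u x * ?n \<nu> x \<partial>lborel\<bar>"
      by (simp add: i)
    also have "\<dots> \<le> (\<integral>x. \<bar>u x * ?n \<mu> x - u x * ?n \<nu> x\<bar> \<partial>lborel)"
      by (rule integral_abs_bound)
    also have "\<dots> \<le> (\<integral>x. c * (b \<mu> x + b \<nu> x) \<partial>lborel)"
      using ptw ib i by (intro integral_mono) auto
    also have "\<dots> = c * ((\<integral>x. b \<mu> x \<partial>lborel) + (\<integral>x. b \<nu> x \<partial>lborel))"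
      using ib by simp
    also have "\<dots> \<le> c * ((2 * s + 1) + (2 * s + 1))"
      by (intro mult_left_mono add_mono ib c)
    also have "\<dots> = (2 * s + 1) / s\<^sup>2 * U * \<bar>\<mu> - \<nu>\<bar>"
      using \<open>s > 0\<close> by (simp add: c_def divide_simps)
    also have "\<dots> \<le> (2 + (2 * s + 1) / s\<^sup>2) * U * \<bar>\<mu> - \<nu>\<bar>"
      using U by (intro mult_right_mono) auto
    finally show ?thesis .
  qed
qed

text \<open>Over the common denominator the numerator is \<open>exp (x - y) - exp (y - x)\<close>,
  while the expanded denominator contains the sum of these exponentials, so
  \<open>abs_exp_diff_le\<close> applies.\<close>

lemma logistic_lipschitz:
  fixes x y :: real
  shows "\<bar>exp x / (exp x + exp (- x)) - exp y / (exp y + exp (- y))\<bar> \<le> 2 * \<bar>x - y\<bar>"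
proof -
  define d where "d = (exp x + exp (- x)) * (exp y + exp (- y))"
  have d: "d > 0" unfolding d_def by (intro mult_pos_pos add_pos_pos) auto
  have nz: "exp x + exp (- x) \<noteq> 0" "exp y + exp (- y) \<noteq> 0"
    using add_pos_pos[of "exp x" "exp (- x)"] add_pos_pos[of "exp y" "exp (- y)"] by auto
  have "exp x / (exp x + exp (- x)) - exp y / (exp y + exp (- y)) = (exp x * exp (- y) - exp y * exp (- x)) / d"
    using nz by (simp add: d_def field_simps)
  also have "exp x * exp (- y) = exp (x - y)" by (simp flip: exp_add)
  also have "exp y * exp (- x) = exp (y - x)" by (simp flip: exp_add)
  finally have "\<bar>exp x / (exp x + exp (- x)) - exp y / (exp y + exp (- y))\<bar> = \<bar>exp (x - y) - exp (y - x)\<bar> / d"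
    using d by simp
  also have "\<dots> \<le> (2 * \<bar>x - y\<bar> * d) / d"
  proof (rule divide_right_mono)
    have "\<bar>exp (x - y) - exp (y - x)\<bar> \<le> \<bar>(x - y) - (y - x)\<bar> * (exp (x - y) + exp (y - x))"
      by (rule abs_exp_diff_le)
    also have "\<dots> \<le> 2 * \<bar>x - y\<bar> * d"
    proof (rule mult_mono)
      have "d = (exp (x - y) + exp (y - x)) + (exp (x + y) + exp (- x - y))"
        unfolding d_def by (simp add: algebra_simps flip: exp_add)
      then show "exp (x - y) + exp (y - x) \<le> d" by simp
      show "\<bar>(x - y) - (y - x)\<bar> \<le> 2 * \<bar>x - y\<bar>" by (auto simp: abs_if)
    qed (auto intro: add_nonneg_nonneg)
    finally show "\<bar>exp (x - y) - exp (y - x)\<bar> \<le> 2 * \<bar>x - y\<bar> * d" .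
  qed (use d in simp)
  finally show ?thesis using d by simp
qed

section \<open>The two-component mixture as a tilted normal law\<close>

text \<open>\<open>cavity_p\<close>, with the centre \<open>r\<close> as a free argument; in the
  same way \<open>mix_density\<close> frees the centre in \<open>nu_density\<close>. The mixture is
  needed at two centres, \<open>cavity_r\<close> and the mean field of the cavity measure.\<close>

definition mix_weight :: "real \<Rightarrow> real \<Rightarrow> real \<Rightarrow> real" where
  "mix_weight \<beta> h r = exp (\<beta> * r + h) / (exp (\<beta> * r + h) + exp (- \<beta> * r - h))"

definition mix_density :: "real \<Rightarrow> real \<Rightarrow> real \<Rightarrow> real \<Rightarrow> real \<Rightarrow> real" where
  "mix_density \<beta> h s r x = mix_weight \<beta> h r * normal_density (r + \<beta> * s\<^sup>2) s x
     + (1 - mix_weight \<beta> h r) * normal_density (r - \<beta> * s\<^sup>2) s x"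

definition mix_integral :: "real \<Rightarrow> real \<Rightarrow> real \<Rightarrow> (real \<Rightarrow> real) \<Rightarrow> real \<Rightarrow> real" where
  "mix_integral \<beta> h s u r = (\<integral>x. u x * mix_density \<beta> h s r x \<partial>lborel)"

lemma mix_weight_bounds: "0 \<le> mix_weight \<beta> h r" "mix_weight \<beta> h r \<le> 1"
  unfolding mix_weight_def by (simp_all add: add_pos_pos add_nonneg_nonneg divide_le_eq_1)

lemma normal_density_times_exp:
  assumes "s > 0"
  shows "normal_density r s x * exp (\<epsilon> * x) = exp (\<epsilon> * r + \<epsilon>\<^sup>2 * s\<^sup>2 / 2) * normal_density (r + \<epsilon> * s\<^sup>2) s x"
proof -
  have "- (x - r)\<^sup>2 / (2 * A) + \<epsilon> * x = (\<epsilon> * r + \<epsilon>\<^sup>2 * A / 2) + (- (x - (r + \<epsilon> * A))\<^sup>2 / (2 * A))"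
    if "A > 0" for A
    using that by (simp add: field_simps) (simp add: power2_eq_square algebra_simps)
  from this[of "s\<^sup>2"] have "exp (- (x - r)\<^sup>2 / (2 * s\<^sup>2)) * exp (\<epsilon> * x)
    = exp (\<epsilon> * r + \<epsilon>\<^sup>2 * s\<^sup>2 / 2) * exp (- (x - (r + \<epsilon> * s\<^sup>2))\<^sup>2 / (2 * s\<^sup>2))"
    using assms by (simp flip: exp_add)
  then show ?thesis unfolding normal_density_def by (simp add: mult.assoc)
qed

text \<open>The two exponentials in \<open>cosh\<close> shift the mean by plus and minus
  \<open>\<beta> * s^2\<close>, with relative masses \<open>exp (\<beta> * r + h)\<close> and
  \<open>exp (- \<beta> * r - h)\<close>. Their normalised versions are the mixture weights, and the
  factor in front is the total mass.\<close>

lemma tilted_normal_density: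
  assumes "s > 0"
  shows "normal_density r s x * cosh (\<beta> * x + h)
    = exp (\<beta>\<^sup>2 * s\<^sup>2 / 2) * cosh (\<beta> * r + h) * mix_density \<beta> h s r x"
proof -
  define c where "c = exp (\<beta>\<^sup>2 * s\<^sup>2 / 2)"
  define e where "e = exp (\<beta> * r + h) + exp (- \<beta> * r - h)"
  have e: "e > 0" unfolding e_def by (intro add_pos_pos) auto
  have w1: "exp (\<beta> * r + h) = e * mix_weight \<beta> h r"
    using e by (simp only: mix_weight_def e_def[symmetric]) simp
  have "exp (- \<beta> * r - h) = e - exp (\<beta> * r + h)" by (simp add: e_def)
  then have w2: "exp (- \<beta> * r - h) = e * (1 - mix_weight \<beta> h r)"
    unfolding w1 by (simp add: right_diff_distrib)
  have "normal_density r s x * cosh (\<beta> * x + h)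
    = (exp h * (normal_density r s x * exp (\<beta> * x)) + exp (- h) * (normal_density r s x * exp (- \<beta> * x))) / 2"
    by (simp add: cosh_field_def exp_add exp_diff algebra_simps exp_minus field_simps)
  also have "\<dots> = c * (exp (\<beta> * r + h) * normal_density (r + \<beta> * s\<^sup>2) s x
       + exp (- \<beta> * r - h) * normal_density (r - \<beta> * s\<^sup>2) s x) / 2"
  proof -
    have 1: "exp h * exp (\<beta> * r + \<beta>\<^sup>2 * s\<^sup>2 / 2) = c * exp (\<beta> * r + h)"
      by (simp add: c_def add_ac flip: exp_add)
    have 2: "exp (- h) * exp (- \<beta> * r + (- \<beta>)\<^sup>2 * s\<^sup>2 / 2) = c * exp (- \<beta> * r - h)"
      by (simp add: c_def add_ac flip: exp_add)
    show ?thesis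
      unfolding normal_density_times_exp[OF assms] mult.assoc[symmetric] 1 2
      by (simp add: distrib_left mult.assoc)
  qed
  also have "\<dots> = c * (e / 2) * mix_density \<beta> h s r x"
    unfolding w1 w2 mix_density_def by (simp add: field_simps)
  also have "e / 2 = cosh (\<beta> * r + h)" by (simp add: e_def cosh_field_def)
  finally show ?thesis by (simp add: c_def)
qed

context
  fixes s U :: real and u :: "real \<Rightarrow> real"
  assumes s: "s > 0" and u_meas [measurable]: "u \<in> borel_measurable borel" and u_bound: "\<And>x. \<bar>u x\<bar> \<le> U"
begin

lemma mix_integral_eq:
  "mix_integral \<beta> h s u r = mix_weight \<beta> h r * (\<integral>x. u x * normal_density (r + \<beta> * s\<^sup>2) s x \<partial>lborel)
     + (1 - mix_weight \<beta> h r) * (\<integral>x. u x * normal_density (r - \<beta> * s\<^sup>2) s x \<partial>lborel)"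
proof -
  have "mix_integral \<beta> h s u r = (\<integral>x. mix_weight \<beta> h r * (u x * normal_density (r + \<beta> * s\<^sup>2) s x)
     + (1 - mix_weight \<beta> h r) * (u x * normal_density (r - \<beta> * s\<^sup>2) s x) \<partial>lborel)"
    unfolding mix_integral_def mix_density_def by (simp add: algebra_simps)
  then show ?thesis
    using integrable_bounded_normal_density[OF u_meas u_bound s] by simp
qed

lemma abs_mix_integral_le: "\<bar>mix_integral \<beta> h s u r\<bar> \<le> U"
proof -
  note w = mix_weight_bounds[of \<beta> h r]
  have "\<bar>mix_integral \<beta> h s u r\<bar> \<le> mix_weight \<beta> h r * U + (1 - mix_weight \<beta> h r) * U"
    unfolding mix_integral_eq using w abs_integral_normal_density_le[OF u_meas u_bound s]
    by (intro order_trans[OF abs_triangle_ineq] add_mono) (auto simp: abs_mult intro!: mult_left_mono)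
  then show ?thesis by (simp add: algebra_simps)
qed

text \<open>Moving the components costs the Lipschitz constant of the normal law. Moving the weight
  costs \<open>2 * |\<beta>|\<close> from the logistic function times the gap \<open>2 * U\<close>
  between the components.\<close>

lemma mix_integral_lipschitz:
  "\<bar>mix_integral \<beta> h s u r - mix_integral \<beta> h s u r'\<bar> \<le> (2 + (2 * s + 1) / s\<^sup>2 + 4 * \<bar>\<beta>\<bar>) * U * \<bar>r - r'\<bar>"
proof -
  define I where "I = (\<lambda>\<mu>. \<integral>x. u x * normal_density \<mu> s x \<partial>lborel)"
  have I_eq: "(\<integral>x. u x * normal_density \<mu> s x \<partial>lborel) = I \<mu>" for \<mu> by (simp add: I_def)
  define p p' where "p = mix_weight \<beta> h r" "p' = mix_weight \<beta> h r'"
  define c where "c = (2 + (2 * s + 1) / s\<^sup>2) * U * \<bar>r - r'\<bar>"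
  have p: "0 \<le> p" "p \<le> 1" using mix_weight_bounds unfolding p_p'_def by auto
  have I: "\<bar>I \<mu>\<bar> \<le> U" for \<mu>
    unfolding I_def by (rule abs_integral_normal_density_le[OF u_meas u_bound s])
  have Id: "\<bar>I (r + k) - I (r' + k)\<bar> \<le> c" for k
    using integral_normal_density_lipschitz[OF u_meas u_bound s, of "r + k" "r' + k"]
    by (simp add: I_def c_def)
  have "\<bar>p - p'\<bar> \<le> 2 * \<bar>(\<beta> * r + h) - (\<beta> * r' + h)\<bar>"
    using logistic_lipschitz[of "\<beta> * r + h" "\<beta> * r' + h"] by (simp add: p_p'_def mix_weight_def)
  also have "(\<beta> * r + h) - (\<beta> * r' + h) = \<beta> * (r - r')" by (simp add: algebra_simps)
  finally have pd: "\<bar>p - p'\<bar> \<le> 2 * \<bar>\<beta>\<bar> * \<bar>r - r'\<bar>" by (simp add: abs_mult)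
  have "mix_integral \<beta> h s u r - mix_integral \<beta> h s u r'
    = p * (I (r + \<beta> * s\<^sup>2) - I (r' + \<beta> * s\<^sup>2)) + (1 - p) * (I (r - \<beta> * s\<^sup>2) - I (r' - \<beta> * s\<^sup>2))
      + (p - p') * (I (r' + \<beta> * s\<^sup>2) - I (r' - \<beta> * s\<^sup>2))"
    unfolding mix_integral_eq p_p'_def[symmetric] I_eq by (simp add: algebra_simps)
  also have "\<bar>\<dots>\<bar> \<le> p * c + (1 - p) * c + (2 * \<bar>\<beta>\<bar> * \<bar>r - r'\<bar>) * (2 * U)"
  proof (intro order_trans[OF abs_triangle_ineq] add_mono)
    show "\<bar>p * (I (r + \<beta> * s\<^sup>2) - I (r' + \<beta> * s\<^sup>2))\<bar> \<le> p * c"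
      using Id[of "\<beta> * s\<^sup>2"] p by (simp add: abs_mult mult_left_mono)
    show "\<bar>(1 - p) * (I (r - \<beta> * s\<^sup>2) - I (r' - \<beta> * s\<^sup>2))\<bar> \<le> (1 - p) * c"
      using Id[of "- (\<beta> * s\<^sup>2)"] p by (simp add: abs_mult mult_left_mono)
    have "\<bar>I (r' + \<beta> * s\<^sup>2) - I (r' - \<beta> * s\<^sup>2)\<bar> \<le> 2 * U"
      using I[of "r' + \<beta> * s\<^sup>2"] I[of "r' - \<beta> * s\<^sup>2"] by linarith
    then show "\<bar>(p - p') * (I (r' + \<beta> * s\<^sup>2) - I (r' - \<beta> * s\<^sup>2))\<bar> \<le> (2 * \<bar>\<beta>\<bar> * \<bar>r - r'\<bar>) * (2 * U)"
      unfolding abs_mult using pd by (intro mult_mono) auto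
  qed
  also have "\<dots> = c + 4 * \<bar>\<beta>\<bar> * U * \<bar>r - r'\<bar>" by (simp add: algebra_simps)
  also have "\<dots> = (2 + (2 * s + 1) / s\<^sup>2 + 4 * \<bar>\<beta>\<bar>) * U * \<bar>r - r'\<bar>"
    by (simp add: c_def distrib_right)
  finally show ?thesis .
qed

lemma gauss_smooth_tilted:
  "gauss_smooth s (\<lambda>x. u x * cosh (\<beta> * x + h)) r = exp (\<beta>\<^sup>2 * s\<^sup>2 / 2) * cosh (\<beta> * r + h) * mix_integral \<beta> h s u r"
proof -
  have [measurable]: "(\<lambda>x :: real. cosh (\<beta> * x + h)) \<in> borel_measurable borel"
    by (intro borel_measurable_continuous_onI continuous_intros)
  have "gauss_smooth s (\<lambda>x. u x * cosh (\<beta> * x + h)) r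
    = (\<integral>x. u x * (normal_density r s x * cosh (\<beta> * x + h)) \<partial>lborel)"
    by (subst gauss_smooth_eq) (simp_all add: s, simp add: mult_ac)
  also have "\<dots> = (\<integral>x. exp (\<beta>\<^sup>2 * s\<^sup>2 / 2) * cosh (\<beta> * r + h) * (u x * mix_density \<beta> h s r x) \<partial>lborel)"
    unfolding tilted_normal_density[OF s] by (simp add: mult_ac)
  finally show ?thesis by (simp add: mix_integral_def)
qed

end

lemma mix_integral_one:
  assumes "s > 0"
  shows "mix_integral \<beta> h s (\<lambda>_. 1) r = 1"
  using mix_integral_eq[of s "\<lambda>_. 1" 1 \<beta> h r] assms by simp

text \<open>The smoothed numerator is exactly \<open>B * V\<close>, with \<open>B\<close> the
  smoothed denominator and \<open>V\<close> the mixture average. Hence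
  \<open>a / b - V = ((a - B * V) - V * (b - B)) / b\<close>, and \<open>b \<ge> 1\<close> removes
  the only division.\<close>

lemma tilted_quotient_diff:
  fixes a b U :: real
  assumes s: "s > 0" and u: "u \<in> borel_measurable borel" "\<And>x. \<bar>u x\<bar> \<le> U" and b: "b \<ge> 1"
  shows "\<bar>a / b - mix_integral \<beta> h s u r\<bar>
    \<le> \<bar>a - gauss_smooth s (\<lambda>x. u x * cosh (\<beta> * x + h)) r\<bar> + U * \<bar>b - gauss_smooth s (\<lambda>x. cosh (\<beta> * x + h)) r\<bar>"
proof -
  define V where "V = mix_integral \<beta> h s u r"
  define B where "B = gauss_smooth s (\<lambda>x. cosh (\<beta> * x + h)) r"
  have B: "B = exp (\<beta>\<^sup>2 * s\<^sup>2 / 2) * cosh (\<beta> * r + h)"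
    using gauss_smooth_tilted[OF s, of "\<lambda>_. 1" 1 \<beta> h r] by (simp add: B_def mix_integral_one[OF s])
  have BV: "gauss_smooth s (\<lambda>x. u x * cosh (\<beta> * x + h)) r = B * V"
    unfolding B V_def by (rule gauss_smooth_tilted[OF s u])
  have V: "\<bar>V\<bar> \<le> U" unfolding V_def by (rule abs_mix_integral_le[OF s u])
  have "a / b - V = ((a - B * V) - V * (b - B)) / b" using b by (simp add: field_simps)
  also have "\<bar>\<dots>\<bar> = \<bar>(a - B * V) - V * (b - B)\<bar> / b" using b by simp
  also have "\<dots> \<le> \<bar>(a - B * V) - V * (b - B)\<bar> / 1" using b by (intro divide_left_mono) auto
  also have "\<dots> \<le> \<bar>a - B * V\<bar> + \<bar>V\<bar> * \<bar>b - B\<bar>"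
    using abs_triangle_ineq4[of "a - B * V" "V * (b - B)"] by (simp add: abs_mult)
  also have "\<dots> \<le> \<bar>a - B * V\<bar> + U * \<bar>b - B\<bar>"
    using V by (intro add_left_mono mult_right_mono) auto
  finally show ?thesis unfolding V_def[symmetric] B_def[symmetric] BV .
qed

section \<open>Gibbs averages and overlaps\<close>

lemma finite_pairs [simp]: "finite (pairs N)"
  by (rule finite_subset[of _ "{1..N} \<times> {1..N}"]) (auto simp: pairs_def)

lemma disorder_eq: "disorder N = PiM (pairs N) (\<lambda>_. gauss)"
  by (simp add: disorder_def gauss_def)

lemma prob_space_disorder: "prob_space (disorder N)"
  unfolding disorder_eq by (rule prob_space_PiM[OF prob_space_gauss])

lemma finite_spins [simp]: "finite (spins N)"
  unfolding spins_def by (rule finite_PiE) auto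

lemma spins_nonempty [simp]: "spins N \<noteq> {}"
  unfolding spins_def by (simp add: PiE_eq_empty_iff)

lemma spin_values: "\<sigma> \<in> spins N \<Longrightarrow> k \<in> {1..N} \<Longrightarrow> \<sigma> k = 1 \<or> \<sigma> k = - 1"
  unfolding spins_def by (auto dest!: PiE_mem)

lemma partition_fn_pos: "partition_fn N \<beta> h g > 0"
  unfolding partition_fn_def by (rule sum_pos) auto

lemma gibbs_nonneg: "0 \<le> gibbs N \<beta> h g \<sigma>"
  using partition_fn_pos[of N \<beta> h g] by (simp add: gibbs_def)

lemma sum_gibbs: "(\<Sum>\<sigma>\<in>spins N. gibbs N \<beta> h g \<sigma>) = 1"
  using partition_fn_pos[of N \<beta> h g] unfolding gibbs_def partition_fn_def
  by (simp flip: sum_divide_distrib)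

lemma measurable_hamil [measurable]: "(\<lambda>g. hamil N \<beta> h g \<sigma>) \<in> borel_measurable (disorder N)"
  unfolding hamil_def disorder_eq
  by (intro borel_measurable_add borel_measurable_times borel_measurable_const borel_measurable_sum)
    (auto simp: case_prod_beta' intro!: borel_measurable_times measurable_component_singleton)

lemma measurable_gibbs [measurable]: "(\<lambda>g. gibbs N \<beta> h g \<sigma>) \<in> borel_measurable (disorder N)"
  unfolding gibbs_def partition_fn_def by measurable

lemma measurable_gavg2 [measurable]: "(\<lambda>g. gavg2 N \<beta> h g f) \<in> borel_measurable (disorder N)"
  unfolding gavg2_def by measurable

lemma gavg2_mono:
  assumes "\<And>\<sigma> \<tau>. \<sigma> \<in> spins N \<Longrightarrow> \<tau> \<in> spins N \<Longrightarrow> f \<sigma> \<tau> \<le> f' \<sigma> \<tau>"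
  shows "gavg2 N \<beta> h g f \<le> gavg2 N \<beta> h g f'"
  unfolding gavg2_def mult.assoc
  by (intro sum_mono mult_right_mono assms) (auto intro!: mult_nonneg_nonneg gibbs_nonneg)

lemma gavg2_affine:
  "gavg2 N \<beta> h g (\<lambda>\<sigma> \<tau>. c + k * f \<sigma> \<tau>) = c + k * gavg2 N \<beta> h g f"
proof -
  have "gavg2 N \<beta> h g (\<lambda>\<sigma> \<tau>. c + k * f \<sigma> \<tau>)
    = c * ((\<Sum>\<sigma>\<in>spins N. gibbs N \<beta> h g \<sigma>) * (\<Sum>\<sigma>\<in>spins N. gibbs N \<beta> h g \<sigma>)) + k * gavg2 N \<beta> h g f"
    unfolding gavg2_def sum_product
    by (simp add: sum.distrib sum_distrib_left algebra_simps)
  then show ?thesis by (simp add: sum_gibbs)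
qed

lemma gavg2_le_const:
  assumes "\<And>\<sigma> \<tau>. \<sigma> \<in> spins N \<Longrightarrow> \<tau> \<in> spins N \<Longrightarrow> f \<sigma> \<tau> \<le> c"
  shows "gavg2 N \<beta> h g f \<le> c"
  using gavg2_mono[of N f "\<lambda>_ _. c" \<beta> h g] assms gavg2_affine[of N \<beta> h g c 0 f] by simp

lemma abs_overlap_le1:
  assumes "\<sigma> \<in> spins N" "\<tau> \<in> spins N"
  shows "\<bar>overlap N \<sigma> \<tau>\<bar> \<le> 1"
proof -
  have "\<bar>\<Sum>i\<in>{1..N}. \<sigma> i * \<tau> i\<bar> \<le> (\<Sum>i\<in>{1..N}. \<bar>\<sigma> i * \<tau> i\<bar>)" by (rule sum_abs)
  also have "\<dots> = (\<Sum>i\<in>{1..N}. 1)"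
    by (intro sum.cong refl) (use spin_values[OF assms(1)] spin_values[OF assms(2)] in \<open>fastforce simp: abs_mult\<close>)
  finally show ?thesis unfolding overlap_def abs_divide by (cases "N = 0") (auto simp: divide_le_eq)
qed

lemma integrable_overlap_moment:
  "integrable (disorder N) (\<lambda>g. gavg2 N \<beta> h g (\<lambda>\<sigma> \<tau>. (overlap N \<sigma> \<tau> - q) ^ 4))"
    and gavg2_overlap_nonneg: "0 \<le> gavg2 N \<beta> h g (\<lambda>\<sigma> \<tau>. (overlap N \<sigma> \<tau> - q) ^ 4)"
proof -
  interpret prob_space "disorder N" by (rule prob_space_disorder)
  show nn: "0 \<le> gavg2 N \<beta> h g (\<lambda>\<sigma> \<tau>. (overlap N \<sigma> \<tau> - q) ^ 4)" for g
    unfolding gavg2_def by (intro sum_nonneg mult_nonneg_nonneg gibbs_nonneg) auto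
  have "gavg2 N \<beta> h g (\<lambda>\<sigma> \<tau>. (overlap N \<sigma> \<tau> - q) ^ 4) \<le> (1 + \<bar>q\<bar>) ^ 4" for g
  proof (rule gavg2_le_const)
    fix \<sigma> \<tau> assume "\<sigma> \<in> spins N" "\<tau> \<in> spins N"
    then have "\<bar>overlap N \<sigma> \<tau> - q\<bar> \<le> 1 + \<bar>q\<bar>" using abs_overlap_le1[of \<sigma> N \<tau>] by linarith
    then have "\<bar>overlap N \<sigma> \<tau> - q\<bar> ^ 4 \<le> (1 + \<bar>q\<bar>) ^ 4" by (rule power_mono) simp
    then show "(overlap N \<sigma> \<tau> - q) ^ 4 \<le> (1 + \<bar>q\<bar>) ^ 4" by (simp add: power_even_abs_numeral)
  qed
  then show "integrable (disorder N) (\<lambda>g. gavg2 N \<beta> h g (\<lambda>\<sigma> \<tau>. (overlap N \<sigma> \<tau> - q) ^ 4))"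
    using nn by (intro integrable_const_bound[where B="(1 + \<bar>q\<bar>) ^ 4"]) auto
qed

text \<open>Independence of the replicas turns the mean overlap into the average over sites of the
  squared magnetisations.\<close>

lemma gavg2_overlap: "0 \<le> gavg2 N \<beta> h g (overlap N)"
proof -
  have "gavg2 N \<beta> h g (overlap N) = (\<Sum>\<sigma>\<in>spins N. \<Sum>\<tau>\<in>spins N. \<Sum>i\<in>{1..N}.
      (\<sigma> i * gibbs N \<beta> h g \<sigma>) * (\<tau> i * gibbs N \<beta> h g \<tau>) / real N)"
    unfolding gavg2_def overlap_def sum_divide_distrib sum_distrib_right
    by (intro sum.cong refl) (simp add: mult_ac)
  also have "\<dots> = (\<Sum>i\<in>{1..N}. \<Sum>\<sigma>\<in>spins N. \<Sum>\<tau>\<in>spins N.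
      (\<sigma> i * gibbs N \<beta> h g \<sigma>) * (\<tau> i * gibbs N \<beta> h g \<tau>) / real N)"
    by (subst sum.swap, subst sum.swap[of _ "{1..N}"]) (intro sum.cong refl sum.swap)
  also have "\<dots> = (\<Sum>i\<in>{1..N}. (\<Sum>\<sigma>\<in>spins N. \<sigma> i * gibbs N \<beta> h g \<sigma>)\<^sup>2 / real N)"
    by (simp add: power2_eq_square sum_product sum_divide_distrib)
  also have "\<dots> \<ge> 0" by (intro sum_nonneg) simp
  finally show ?thesis .
qed

text \<open>The mean overlap is nonnegative, so it cannot concentrate at a negative value.\<close>

lemma overlap_limit_nonneg:
  assumes "\<forall>N::nat. N \<ge> 1 \<longrightarrow>
      (\<integral>g. gavg2 N \<beta> h g (\<lambda>\<sigma>1 \<sigma>2. (overlap N \<sigma>1 \<sigma>2 - q) ^ 4) \<partial>disorder N) \<le> C0 / (real N)\<^sup>2"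
  shows "0 \<le> q"
proof (rule ccontr)
  assume "\<not> 0 \<le> q"
  define c where "c = - q"
  have c: "c > 0" using \<open>\<not> 0 \<le> q\<close> by (simp add: c_def)
  have lower: "c ^ 4 \<le> C0 / (real N)\<^sup>2" if "N \<ge> 1" for N :: nat
  proof -
    interpret prob_space "disorder N" by (rule prob_space_disorder)
    have "c ^ 4 \<le> gavg2 N \<beta> h g (\<lambda>\<sigma> \<tau>. (overlap N \<sigma> \<tau> - q) ^ 4)" for g
    proof -
      have "c ^ 4 \<le> c ^ 4 + 4 * c ^ 3 * gavg2 N \<beta> h g (overlap N)"
        using c gavg2_overlap by simp
      also have "\<dots> = gavg2 N \<beta> h g (\<lambda>\<sigma> \<tau>. c ^ 4 + 4 * c ^ 3 * overlap N \<sigma> \<tau>)"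
        by (rule gavg2_affine[symmetric])
      also have "\<dots> \<le> gavg2 N \<beta> h g (\<lambda>\<sigma> \<tau>. (overlap N \<sigma> \<tau> - q) ^ 4)"
      \<comment> \<open>Convexity: the fourth power lies above its tangent at overlap
        \<open>0\<close>, where its argument is \<open>c\<close>.\<close>
      proof (rule gavg2_mono)
        fix \<sigma> \<tau> :: "nat \<Rightarrow> real"
        define R where "R = overlap N \<sigma> \<tau>"
        have "(R + c) ^ 4 - (c ^ 4 + 4 * c ^ 3 * R) = R\<^sup>2 * ((R + 2 * c)\<^sup>2 + 2 * c\<^sup>2)"
          by (simp add: power2_eq_square power3_eq_cube power4_eq_xxxx algebra_simps)
        also have "\<dots> \<ge> 0" by (intro mult_nonneg_nonneg add_nonneg_nonneg) auto
        finally show "c ^ 4 + 4 * c ^ 3 * overlap N \<sigma> \<tau> \<le> (overlap N \<sigma> \<tau> - q) ^ 4"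
          by (simp add: R_def c_def)
      qed
      finally show ?thesis .
    qed
    then have "(\<integral>g. c ^ 4 \<partial>disorder N) \<le> (\<integral>g. gavg2 N \<beta> h g (\<lambda>\<sigma> \<tau>. (overlap N \<sigma> \<tau> - q) ^ 4) \<partial>disorder N)"
      by (intro integral_mono integrable_overlap_moment) auto
    then show ?thesis using assms that by (simp add: prob_space) (meson order_trans)
  qed
  \<comment> \<open>A lower bound independent of the system size contradicts the decay
    \<open>1 / N^2\<close> for large \<open>N\<close>.\<close>
  obtain n :: nat where n: "C0 / c ^ 4 < real n" using reals_Archimedean2 by blast
  define N where "N = Suc n"
  have "c ^ 4 * (real N)\<^sup>2 \<le> C0" using lower[of N] by (simp add: N_def field_simps)
  moreover have "real n \<le> (real N)\<^sup>2" by (simp add: N_def power2_eq_square algebra_simps)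
  then have "C0 / c ^ 4 < (real N)\<^sup>2" using n by linarith
  then have "C0 < c ^ 4 * (real N)\<^sup>2" using c by (simp add: field_simps)
  ultimately show False by simp
qed

section \<open>The cavity measure\<close>

locale cavity =
  fixes N i :: nat and \<beta> h :: real
  assumes i: "i \<in> {1..N}"
begin

definition site_pairs :: "(nat \<times> nat) set" where
  "site_pairs = {e \<in> pairs N. fst e = i \<or> snd e = i}"

definition other_pairs :: "(nat \<times> nat) set" where
  "other_pairs = pairs N - site_pairs"

text \<open>\<open>pairs\<close> lists each pair with the smaller index first, so a coupling at site
  \<open>i\<close> may carry \<open>i\<close> in either position; \<open>edge\<close> and
  \<open>partner\<close> translate between such couplings and the other sites.\<close>

definition edge :: "nat \<Rightarrow> nat \<times> nat" where "edge k = (min i k, max i k)"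

definition partner :: "nat \<times> nat \<Rightarrow> nat" where
  "partner e = (if fst e = i then snd e else fst e)"

text \<open>The coefficient of \<open>g e\<close> in the local field, indexed by edges so that the
  field is a linear functional in the sense of \<open>linear_replicas\<close>.\<close>

definition coupling :: "(nat \<Rightarrow> real) \<Rightarrow> nat \<times> nat \<Rightarrow> real" where
  "coupling \<sigma> e = \<sigma> (partner e) / sqrt (real N)"

definition field :: "(nat \<times> nat \<Rightarrow> real) \<Rightarrow> (nat \<Rightarrow> real) \<Rightarrow> real" where
  "field g \<sigma> = (\<Sum>e\<in>site_pairs. coupling \<sigma> e * g e)"

text \<open>The normalisation stays at \<open>sqrt N\<close> instead of \<open>sqrt (N - 1)\<close>,
  which makes the splitting of \<open>hamil\<close> exact.\<close>

definition cav_hamil :: "(nat \<times> nat \<Rightarrow> real) \<Rightarrow> (nat \<Rightarrow> real) \<Rightarrow> real" where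
  "cav_hamil g \<sigma> = \<beta> / sqrt (real N) * (\<Sum>(j, k)\<in>other_pairs. g (j, k) * \<sigma> j * \<sigma> k)
     + h * (\<Sum>j\<in>{1..N} - {i}. \<sigma> j)"

definition cav_partition :: "(nat \<times> nat \<Rightarrow> real) \<Rightarrow> real" where
  "cav_partition g = (\<Sum>\<sigma>\<in>spins N. exp (cav_hamil g \<sigma>))"

text \<open>The cavity measure is kept on all of \<open>spins N\<close>; under it the spin at site \<open>i\<close> is a fair sign
  independent of the other spins.\<close>

definition cav :: "(nat \<times> nat \<Rightarrow> real) \<Rightarrow> (nat \<Rightarrow> real) \<Rightarrow> real" where
  "cav g \<sigma> = exp (cav_hamil g \<sigma>) / cav_partition g"

definition cav_avg :: "(nat \<times> nat \<Rightarrow> real) \<Rightarrow> (real \<Rightarrow> real) \<Rightarrow> real" where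
  "cav_avg g f = (\<Sum>\<sigma>\<in>spins N. cav g \<sigma> * f (field g \<sigma>))"

lemma N_pos: "N > 0" using i by auto

lemma finite_site_pairs [simp]: "finite site_pairs" and finite_other_pairs [simp]: "finite other_pairs"
  and pairs_split: "pairs N = other_pairs \<union> site_pairs" "other_pairs \<inter> site_pairs = {}"
  by (auto simp: site_pairs_def other_pairs_def)

lemma partner_edge: "partner (edge k) = k"
  by (auto simp: partner_def edge_def min_def max_def)

lemma bij_edge: "bij_betw edge ({1..N} - {i}) site_pairs"
proof (rule bij_betwI[where g=partner])
  show "edge \<in> {1..N} - {i} \<rightarrow> site_pairs"
    using i by (auto simp: edge_def site_pairs_def pairs_def min_def max_def)
  show "partner \<in> site_pairs \<rightarrow> {1..N} - {i}"
    by (auto simp: partner_def site_pairs_def pairs_def)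
  show "edge (partner e) = e" if "e \<in> site_pairs" for e
    using that by (auto simp: partner_def edge_def site_pairs_def pairs_def)
qed (rule partner_edge)

lemma sum_site_pairs: "(\<Sum>e\<in>site_pairs. F e) = (\<Sum>k\<in>{1..N} - {i}. F (edge k))"
  by (rule sum.reindex_bij_betw[OF bij_edge, symmetric])

lemma local_field_eq: "local_field N g i \<sigma> = field g \<sigma>"
  unfolding local_field_def field_def sum_site_pairs sum_divide_distrib coupling_def partner_edge
  by (simp add: gs_def edge_def mult.commute)

text \<open>The covariance of two local fields lacks the term of site \<open>i\<close>; since the
  hypothesis concerns the full overlap, this costs a correction of modulus
  \<open>1 / N\<close>.\<close>

lemma coupling_product:
  assumes "\<sigma> \<in> spins N" "\<tau> \<in> spins N"
  shows "(\<Sum>e\<in>site_pairs. coupling \<sigma> e * coupling \<tau> e) = overlap N \<sigma> \<tau> - \<sigma> i * \<tau> i / real N"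
proof -
  have "(\<Sum>e\<in>site_pairs. coupling \<sigma> e * coupling \<tau> e) = (\<Sum>k\<in>{1..N} - {i}. \<sigma> k * \<tau> k) / real N"
    unfolding sum_site_pairs coupling_def partner_edge by (simp add: sum_divide_distrib)
  also have "(\<Sum>k\<in>{1..N} - {i}. \<sigma> k * \<tau> k) = (\<Sum>k\<in>{1..N}. \<sigma> k * \<tau> k) - \<sigma> i * \<tau> i"
    using i by (simp add: sum_diff1)
  finally show ?thesis by (simp add: overlap_def diff_divide_distrib)
qed

lemma coupling_norm:
  assumes "\<sigma> \<in> spins N"
  shows "(\<Sum>e\<in>site_pairs. (coupling \<sigma> e)\<^sup>2) = 1 - 1 / real N"
proof -
  have sq: "\<sigma> k * \<sigma> k = 1" if "k \<in> {1..N}" for k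
    using spin_values[OF assms that] by auto
  then have "overlap N \<sigma> \<sigma> = 1" using N_pos by (simp add: overlap_def)
  then show ?thesis using coupling_product[OF assms assms] sq[OF i] by (simp add: power2_eq_square)
qed

section \<open>The Gibbs measure as a tilt of the cavity measure\<close>

lemma hamil_eq: "hamil N \<beta> h g \<sigma> = cav_hamil g \<sigma> + \<sigma> i * (\<beta> * field g \<sigma> + h)"
proof -
  have "(\<Sum>(j, k)\<in>site_pairs. g (j, k) * \<sigma> j * \<sigma> k) = (\<Sum>e\<in>site_pairs. \<sigma> i * (\<sigma> (partner e) * g e))"
    by (intro sum.cong) (auto simp: site_pairs_def partner_def)
  then have 1: "(\<Sum>(j, k)\<in>pairs N. g (j, k) * \<sigma> j * \<sigma> k)
    = (\<Sum>(j, k)\<in>other_pairs. g (j, k) * \<sigma> j * \<sigma> k) + \<sigma> i * (\<Sum>e\<in>site_pairs. \<sigma> (partner e) * g e)"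
    unfolding pairs_split(1) by (subst sum.union_disjoint) (use pairs_split(2) in \<open>auto simp: sum_distrib_left\<close>)
  have 2: "(\<Sum>j\<in>{1..N}. \<sigma> j) = (\<Sum>j\<in>{1..N} - {i}. \<sigma> j) + \<sigma> i"
    using i by (simp add: sum_diff1)
  have 3: "field g \<sigma> = (\<Sum>e\<in>site_pairs. \<sigma> (partner e) * g e) / sqrt (real N)"
    by (simp add: field_def coupling_def sum_divide_distrib)
  show ?thesis unfolding hamil_def cav_hamil_def 1 2 3 by (simp add: algebra_simps)
qed

lemma cav_partition_pos: "cav_partition g > 0"
  unfolding cav_partition_def by (rule sum_pos) auto

lemma cav_nonneg: "0 \<le> cav g \<sigma>"
  using cav_partition_pos[of g] by (simp add: cav_def)

lemma sum_cav: "(\<Sum>\<sigma>\<in>spins N. cav g \<sigma>) = 1"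
  using cav_partition_pos[of g] unfolding cav_def cav_partition_def
  by (simp flip: sum_divide_distrib)

text \<open>Cavity weights see only couplings away from site \<open>i\<close>: this is the
  independence on which the conditioning rests.\<close>

lemma cav_merge: "cav (merge other_pairs site_pairs (x, y)) \<sigma> = cav x \<sigma>"
proof -
  have "cav_hamil (merge other_pairs site_pairs (x, y)) \<sigma> = cav_hamil x \<sigma>" for \<sigma>
    unfolding cav_hamil_def
    by (intro arg_cong2[where f="(+)"] arg_cong2[where f="(*)"] refl sum.cong) (auto simp: merge_def)
  then show ?thesis by (simp add: cav_def cav_partition_def)
qed

lemma field_merge: "field (merge other_pairs site_pairs (x, y)) \<sigma> = (\<Sum>e\<in>site_pairs. coupling \<sigma> e * y e)"
  unfolding field_def by (intro sum.cong) (use pairs_split(2) in \<open>auto simp: merge_def\<close>)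

definition flip :: "(nat \<Rightarrow> real) \<Rightarrow> nat \<Rightarrow> real" where "flip \<sigma> = \<sigma>(i := - \<sigma> i)"

lemma sum_flip: "(\<Sum>\<sigma>\<in>spins N. F (flip \<sigma>)) = (\<Sum>\<sigma>\<in>spins N. F \<sigma>)"
proof (rule sum.reindex_bij_witness[where i=flip and j=flip])
  show "flip \<sigma> \<in> spins N" if "\<sigma> \<in> spins N" for \<sigma>
    using that i unfolding spins_def flip_def by (auto simp: PiE_iff extensional_def)
  then show "flip \<sigma> \<in> spins N" if "\<sigma> \<in> spins N" for \<sigma> using that .
qed (auto simp: flip_def)

lemma field_flip: "field g (flip \<sigma>) = field g \<sigma>"
  unfolding field_def coupling_def
  by (intro sum.cong refl) (auto simp: flip_def site_pairs_def pairs_def partner_def)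

lemma cav_flip: "cav g (flip \<sigma>) = cav g \<sigma>"
proof -
  have "cav_hamil g (flip \<sigma>) = cav_hamil g \<sigma>"
    unfolding cav_hamil_def
    by (intro arg_cong2[where f="(+)"] arg_cong2[where f="(*)"] refl sum.cong)
      (auto simp: flip_def other_pairs_def site_pairs_def)
  then show ?thesis by (simp add: cav_def)
qed

text \<open>Reversing the spin at \<open>i\<close> preserves both the weight and the field, so the
  sum may be averaged with its reversed version.\<close>

lemma cav_sum_spin:
  "(\<Sum>\<sigma>\<in>spins N. cav g \<sigma> * F (field g \<sigma>) (\<sigma> i)) = cav_avg g (\<lambda>x. (F x 1 + F x (- 1)) / 2)"
proof -
  have "(\<Sum>\<sigma>\<in>spins N. cav g \<sigma> * F (field g \<sigma>) (\<sigma> i)) = (\<Sum>\<sigma>\<in>spins N. cav g \<sigma> * F (field g \<sigma>) (- \<sigma> i))"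
    by (subst sum_flip[symmetric]) (simp add: field_flip cav_flip, simp add: flip_def)
  then have "(\<Sum>\<sigma>\<in>spins N. cav g \<sigma> * F (field g \<sigma>) (\<sigma> i))
    = (\<Sum>\<sigma>\<in>spins N. cav g \<sigma> * F (field g \<sigma>) (\<sigma> i) / 2 + cav g \<sigma> * F (field g \<sigma>) (- \<sigma> i) / 2)"
    by (simp add: sum.distrib flip: sum_divide_distrib)
  also have "\<dots> = cav_avg g (\<lambda>x. (F x 1 + F x (- 1)) / 2)"
    unfolding cav_avg_def
    by (intro sum.cong refl) (use spin_values[OF _ i] in \<open>fastforce simp: field_simps\<close>)
  finally show ?thesis .
qed

abbreviation W :: "real \<Rightarrow> real" where "W \<equiv> \<lambda>x. cosh (\<beta> * x + h)"

lemma cav_avg_ge_1: "1 \<le> cav_avg g (\<lambda>x. cosh (f x))"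
proof -
  have "(\<Sum>\<sigma>\<in>spins N. cav g \<sigma> * 1) \<le> cav_avg g (\<lambda>x. cosh (f x))"
    unfolding cav_avg_def by (intro sum_mono mult_left_mono cav_nonneg cosh_real_ge_1)
  then show ?thesis by (simp add: sum_cav)
qed

text \<open>The first identity normalises the tilt from the cavity to the Gibbs measure; the second
  serves the reverse change in \<open>cav_overlap2_le\<close>.\<close>

lemma cav_sum_exp: "(\<Sum>\<sigma>\<in>spins N. cav g \<sigma> * exp (\<sigma> i * (\<beta> * field g \<sigma> + h))) = cav_avg g W"
  "(\<Sum>\<sigma>\<in>spins N. cav g \<sigma> * exp (- (\<sigma> i * (\<beta> * field g \<sigma> + h)))) = cav_avg g W"
  using cav_sum_spin[of g "\<lambda>x s. exp (s * (\<beta> * x + h))"] cav_sum_spin[of g "\<lambda>x s. exp (- (s * (\<beta> * x + h)))"]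
  by (simp_all add: cosh_field_def add.commute)

lemma gibbs_eq: "gibbs N \<beta> h g \<sigma> = cav g \<sigma> * exp (\<sigma> i * (\<beta> * field g \<sigma> + h)) / cav_avg g W"
proof -
  have "cav_partition g * cav_avg g W = partition_fn N \<beta> h g"
    unfolding cav_sum_exp(1)[symmetric] partition_fn_def hamil_eq exp_add cav_def
    using cav_partition_pos[of g] by (simp add: sum_distrib_left)
  then have "partition_fn N \<beta> h g = cav_partition g * cav_avg g W" by simp
  then show ?thesis
    unfolding gibbs_def hamil_eq exp_add cav_def by simp
qed

lemma gavg_eq: "gavg N \<beta> h g (\<lambda>\<sigma>. F (field g \<sigma>) (\<sigma> i))
  = cav_avg g (\<lambda>x. (F x 1 * exp (\<beta> * x + h) + F x (- 1) * exp (- (\<beta> * x + h))) / 2) / cav_avg g W"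
proof -
  have "gavg N \<beta> h g (\<lambda>\<sigma>. F (field g \<sigma>) (\<sigma> i))
    = (\<Sum>\<sigma>\<in>spins N. cav g \<sigma> * (F (field g \<sigma>) (\<sigma> i) * exp (\<sigma> i * (\<beta> * field g \<sigma> + h)))) / cav_avg g W"
    unfolding gavg_def gibbs_eq sum_divide_distrib by (simp add: mult_ac)
  then show ?thesis
    using cav_sum_spin[of g "\<lambda>x s. F x s * exp (s * (\<beta> * x + h))"] by simp
qed

lemma gavg_field: "gavg N \<beta> h g (\<lambda>\<sigma>. u (local_field N g i \<sigma>)) = cav_avg g (\<lambda>x. u x * W x) / cav_avg g W"
  unfolding local_field_eq gavg_eq[where F="\<lambda>x _. u x"]
  by (simp add: cosh_field_def distrib_left)

lemma gavg_spin: "gavg N \<beta> h g (\<lambda>\<sigma>. \<sigma> i) = cav_avg g (\<lambda>x. sinh (\<beta> * x + h)) / cav_avg g W"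
  using gavg_eq[where F="\<lambda>_ s. s"] by (simp add: sinh_field_def)

lemma gavg_sum: "(\<Sum>k\<in>A. c k * gavg N \<beta> h g (f k)) = gavg N \<beta> h g (\<lambda>\<sigma>. \<Sum>k\<in>A. c k * f k \<sigma>)"
  unfolding gavg_def sum_distrib_left sum_distrib_right by (subst sum.swap) (simp add: mult_ac)

text \<open>By linearity the first part of \<open>cavity_r\<close> is the Gibbs average of the local
  field itself, so all of it becomes a quotient of cavity averages over the same denominator as in
  \<open>gavg_field\<close>.\<close>

lemma cavity_r_eq:
  "cavity_r N \<beta> h q g i = (cav_avg g (\<lambda>x. x * W x) - \<beta> * (1 - q) * cav_avg g (\<lambda>x. sinh (\<beta> * x + h))) / cav_avg g W"
proof -
  have "(\<Sum>j\<in>{1..N} - {i}. gs g i j * gavg N \<beta> h g (\<lambda>\<sigma>. \<sigma> j)) / sqrt (real N)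
    = gavg N \<beta> h g (\<lambda>\<sigma>. local_field N g i \<sigma>)"
    unfolding gavg_sum local_field_def unfolding gavg_def by (subst sum_divide_distrib) simp
  then show ?thesis
    unfolding cavity_r_def gavg_field[where u="\<lambda>x. x"] gavg_spin by (simp add: diff_divide_distrib)
qed

lemma measurable_component_site [measurable]: "e \<in> pairs N \<Longrightarrow> (\<lambda>g. g e) \<in> borel_measurable (disorder N)"
  unfolding disorder_eq by measurable

lemma measurable_field [measurable]: "(\<lambda>g. field g \<sigma>) \<in> borel_measurable (disorder N)"
  unfolding field_def
  by (intro borel_measurable_sum borel_measurable_times borel_measurable_const measurable_component_site)
    (simp add: site_pairs_def)

lemma measurable_cav [measurable]: "(\<lambda>g. cav g \<sigma>) \<in> borel_measurable (disorder N)"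
proof -
  have [measurable]: "(\<lambda>g. cav_hamil g \<sigma>) \<in> borel_measurable (disorder N)" for \<sigma>
    unfolding cav_hamil_def
    by (intro borel_measurable_add borel_measurable_times borel_measurable_const borel_measurable_sum)
      (auto simp: case_prod_beta' other_pairs_def intro!: borel_measurable_times measurable_component_site)
  show ?thesis unfolding cav_def cav_partition_def by measurable
qed

lemma measurable_cav_avg [measurable]:
  assumes [measurable]: "f \<in> borel_measurable borel"
  shows "(\<lambda>g. cav_avg g f) \<in> borel_measurable (disorder N)"
  unfolding cav_avg_def by measurable

lemma cav_avg_square_le: "(cav_avg g f)\<^sup>2 \<le> cav_avg g (\<lambda>x. (f x)\<^sup>2)"
proof -
  have "(cav_avg g f)\<^sup>2 = (\<Sum>\<sigma>\<in>spins N. sqrt (cav g \<sigma>) * (sqrt (cav g \<sigma>) * f (field g \<sigma>)))\<^sup>2"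
    unfolding cav_avg_def by (simp add: cav_nonneg flip: mult.assoc)
  also have "\<dots> \<le> (\<Sum>\<sigma>\<in>spins N. (sqrt (cav g \<sigma>))\<^sup>2) * (\<Sum>\<sigma>\<in>spins N. (sqrt (cav g \<sigma>) * f (field g \<sigma>))\<^sup>2)"
    by (rule Cauchy_Schwarz_ineq_sum)
  also have "\<dots> = cav_avg g (\<lambda>x. (f x)\<^sup>2)"
    by (simp add: cav_nonneg sum_cav power_mult_distrib cav_avg_def)
  finally show ?thesis .
qed

lemma cav_avg_mono: "(\<And>x. f x \<le> f' x) \<Longrightarrow> cav_avg g f \<le> cav_avg g f'"
  unfolding cav_avg_def by (intro sum_mono mult_left_mono cav_nonneg)

lemma cav_avg_cosh_square: "(cav_avg g (\<lambda>x. cosh (f x)))\<^sup>2 \<le> cav_avg g (\<lambda>x. cosh (2 * f x))"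
proof -
  have "(cosh (f x))\<^sup>2 \<le> cosh (2 * f x)" for x unfolding cosh_double by simp
  then show ?thesis by (intro order_trans[OF cav_avg_square_le] cav_avg_mono)
qed

section \<open>Overlap concentration under the cavity measure\<close>

definition cav_overlap2 :: "real \<Rightarrow> (nat \<times> nat \<Rightarrow> real) \<Rightarrow> real" where
  "cav_overlap2 q g = (\<Sum>\<sigma>\<in>spins N. \<Sum>\<tau>\<in>spins N. cav g \<sigma> * cav g \<tau> * (overlap N \<sigma> \<tau> - q)\<^sup>2)"

text \<open>Passing from the cavity measure to the Gibbs measure costs a density, which Young's inequality
  separates from the overlap; this is why a fourth moment is needed to control a second one.\<close>

lemma cav_overlap2_le:
  "cav_overlap2 q g \<le> real N / 2 * gavg2 N \<beta> h g (\<lambda>\<sigma> \<tau>. (overlap N \<sigma> \<tau> - q) ^ 4)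
     + 1 / (2 * real N) * cav_avg g (\<lambda>x. cosh (4 * (\<beta> * x + h)))"
proof -
  define Z where "Z = cav_avg g W"
  have Z: "Z \<ge> 1" unfolding Z_def by (rule cav_avg_ge_1)
  define e where "e = (\<lambda>\<sigma>. exp (- (\<sigma> i * (\<beta> * field g \<sigma> + h))))"
  define b where "b = gibbs N \<beta> h g"
  have b0: "0 \<le> b \<sigma>" for \<sigma> unfolding b_def by (rule gibbs_nonneg)
  have cb: "cav g \<sigma> = Z * e \<sigma> * b \<sigma>" for \<sigma>
  proof -
    have "e \<sigma> * exp (\<sigma> i * (\<beta> * field g \<sigma> + h)) = 1"
      unfolding e_def by (simp flip: exp_add)
    then show ?thesis
      using Z unfolding b_def gibbs_eq Z_def[symmetric] by (simp add: mult.commute mult.left_commute)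
  qed
  \<comment> \<open>Second moment of the reverse density: one factor \<open>Z * e \<sigma>\<close>
    returns to the cavity measure, and \<open>cav_sum_exp(2)\<close> evaluates the remaining
    average.\<close>
  have Ze: "(\<Sum>\<sigma>\<in>spins N. Z * (b \<sigma> * (e \<sigma>)\<^sup>2)) = Z"
  proof -
    have "(\<Sum>\<sigma>\<in>spins N. cav g \<sigma> * e \<sigma>) = Z"
      using cav_sum_exp(2)[of g] by (simp add: e_def Z_def)
    then show ?thesis
      unfolding cb by (simp add: power2_eq_square mult_ac)
  qed
  \<comment> \<open>The weight \<open>N\<close> balances the two sides: a fourth moment of order
    \<open>1 / N^2\<close> and a bounded density term both contribute order
    \<open>1 / N\<close>.\<close>
  have young: "x\<^sup>2 * y \<le> real N / 2 * x ^ 4 + 1 / (2 * real N) * y\<^sup>2" for x y :: real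
  proof -
    have "0 \<le> (real N * x\<^sup>2 - y)\<^sup>2 / (2 * real N)" by simp
    also have "\<dots> = real N / 2 * x ^ 4 + 1 / (2 * real N) * y\<^sup>2 - x\<^sup>2 * y"
      using N_pos by (simp add: power2_eq_square power4_eq_xxxx field_simps)
    finally show ?thesis by simp
  qed
  have "cav_overlap2 q g = (\<Sum>\<sigma>\<in>spins N. \<Sum>\<tau>\<in>spins N. b \<sigma> * b \<tau> * ((overlap N \<sigma> \<tau> - q)\<^sup>2 * (Z\<^sup>2 * e \<sigma> * e \<tau>)))"
    unfolding cav_overlap2_def cb by (simp add: power2_eq_square mult_ac)
  also have "\<dots> \<le> (\<Sum>\<sigma>\<in>spins N. \<Sum>\<tau>\<in>spins N. b \<sigma> * b \<tau> * (real N / 2 * (overlap N \<sigma> \<tau> - q) ^ 4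
      + 1 / (2 * real N) * (Z\<^sup>2 * e \<sigma> * e \<tau>)\<^sup>2))"
    by (intro sum_mono mult_left_mono young mult_nonneg_nonneg b0)
  also have "\<dots> = real N / 2 * gavg2 N \<beta> h g (\<lambda>\<sigma> \<tau>. (overlap N \<sigma> \<tau> - q) ^ 4)
      + 1 / (2 * real N) * (\<Sum>\<sigma>\<in>spins N. \<Sum>\<tau>\<in>spins N. b \<sigma> * b \<tau> * (Z\<^sup>2 * e \<sigma> * e \<tau>)\<^sup>2)"
    unfolding gavg2_def b_def[symmetric] by (simp add: distrib_left sum.distrib sum_distrib_left mult_ac)
  also have "(\<Sum>\<sigma>\<in>spins N. \<Sum>\<tau>\<in>spins N. b \<sigma> * b \<tau> * (Z\<^sup>2 * e \<sigma> * e \<tau>)\<^sup>2)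
      = Z\<^sup>2 * (\<Sum>\<sigma>\<in>spins N. \<Sum>\<tau>\<in>spins N. (Z * (b \<sigma> * (e \<sigma>)\<^sup>2)) * (Z * (b \<tau> * (e \<tau>)\<^sup>2)))"
    unfolding sum_distrib_left
    by (intro sum.cong refl) (simp add: power2_eq_square mult_ac)
  also have "\<dots> = ((cav_avg g W)\<^sup>2)\<^sup>2"
    unfolding sum_product[symmetric] Ze by (simp add: Z_def power2_eq_square)
  also have "real N / 2 * gavg2 N \<beta> h g (\<lambda>\<sigma> \<tau>. (overlap N \<sigma> \<tau> - q) ^ 4) + 1 / (2 * real N) * ((cav_avg g W)\<^sup>2)\<^sup>2
    \<le> real N / 2 * gavg2 N \<beta> h g (\<lambda>\<sigma> \<tau>. (overlap N \<sigma> \<tau> - q) ^ 4)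
      + 1 / (2 * real N) * cav_avg g (\<lambda>x. cosh (4 * (\<beta> * x + h)))"
  proof -
    \<comment> \<open>The squared density averages to the fourth power of the partition ratio; two
      applications of Jensen with \<open>cosh^2 x \<le> cosh (2 * x)\<close> replace it by one
      linear cavity average, whose disorder average is computable.\<close>
    have "((cav_avg g W)\<^sup>2)\<^sup>2 \<le> (cav_avg g (\<lambda>x. cosh (2 * (\<beta> * x + h))))\<^sup>2"
      by (intro power_mono cav_avg_cosh_square) simp
    also have "\<dots> \<le> cav_avg g (\<lambda>x. cosh (4 * (\<beta> * x + h)))"
      using cav_avg_cosh_square[of g "\<lambda>x. 2 * (\<beta> * x + h)"] by (simp add: mult.assoc[symmetric] del: distrib_left_numeral)
    finally show ?thesis using N_pos by (intro add_left_mono mult_left_mono) auto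
  qed
  finally show ?thesis .
qed

section \<open>Error terms, conditionally on the couplings away from the site\<close>

lemma nn_integral_disorder_split:
  assumes "F \<in> borel_measurable (disorder N)"
  shows "(\<integral>\<^sup>+g. F g \<partial>disorder N)
    = (\<integral>\<^sup>+x. \<integral>\<^sup>+y. F (merge other_pairs site_pairs (x, y)) \<partial>PiM site_pairs (\<lambda>_. gauss) \<partial>PiM other_pairs (\<lambda>_. gauss))"
  using assms unfolding disorder_eq pairs_split(1)
  by (intro gauss_fam.product_nn_integral_fold pairs_split(2)) auto

lemma linear_replicas_cav:
  assumes "0 \<le> q" "q < 1"
  shows "linear_replicas site_pairs (spins N) (cav x) coupling (1 - 1 / real N) q"
  using assms N_pos by unfold_locales (auto simp: cav_nonneg sum_cav coupling_norm)

definition smooth_error :: "real \<Rightarrow> (real \<Rightarrow> real) \<Rightarrow> (nat \<times> nat \<Rightarrow> real) \<Rightarrow> real" where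
  "smooth_error s f g = cav_avg g f - gauss_smooth s f (cav_avg g (\<lambda>x. x))"

text \<open>The difference between \<open>cavity_r\<close> and the mean field of the cavity measure,
  multiplied by \<open>cav_avg g W\<close>. Gaussian integration by parts would make it zero if the
  field were exactly normal about its mean with variance \<open>1 - q\<close>.\<close>

definition tilt_error :: "real \<Rightarrow> (nat \<times> nat \<Rightarrow> real) \<Rightarrow> real" where
  "tilt_error q g = cav_avg g (\<lambda>x. (x - cav_avg g (\<lambda>x. x)) * W x - \<beta> * (1 - q) * sinh (\<beta> * x + h))"

lemma tilt_error_eq:
  "tilt_error q g = cav_avg g (\<lambda>x. x * W x) - cav_avg g (\<lambda>x. x) * cav_avg g W
    - \<beta> * (1 - q) * cav_avg g (\<lambda>x. sinh (\<beta> * x + h))"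
proof -
  have "cav_avg g (\<lambda>x. (x - r) * W x - c * S x) = cav_avg g (\<lambda>x. x * W x) - r * cav_avg g W - c * cav_avg g S" for r c S
    unfolding cav_avg_def sum_distrib_left sum_subtractf[symmetric]
    by (intro sum.cong refl) (simp only: left_diff_distrib right_diff_distrib mult_ac)
  then show ?thesis unfolding tilt_error_def .
qed

lemma measurable_W [measurable]: "W \<in> borel_measurable borel"
  "(\<lambda>x. sinh (\<beta> * x + h)) \<in> borel_measurable borel"
  "(\<lambda>x. cosh (k * (\<beta> * x + h))) \<in> borel_measurable borel"
  by (intro borel_measurable_continuous_onI continuous_intros)+

lemma measurable_smooth_error [measurable]:
  assumes [measurable]: "f \<in> borel_measurable borel"
  shows "smooth_error s f \<in> borel_measurable (disorder N)"
  unfolding smooth_error_def[abs_def] by measurable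

lemma measurable_tilt_error [measurable]: "tilt_error q \<in> borel_measurable (disorder N)"
  unfolding tilt_error_eq[abs_def] by measurable

text \<open>Two replacements, valid for each disorder: the Gibbs average by the mixture average at
  the cavity mean \<open>r0\<close>, costing the smoothing errors of numerator and denominator; then
  \<open>r0\<close> by \<open>cavity_r\<close>, costing the Lipschitz constant \<open>L * U\<close>
  times the tilt error, as the denominator is at least \<open>1\<close>.\<close>

lemma local_law_error_le:
  assumes q: "q < 1" and u: "u \<in> borel_measurable borel" "\<And>x. \<bar>u x\<bar> \<le> U"
  defines "s \<equiv> sqrt (1 - q)"
  defines "L \<equiv> 2 + (2 * s + 1) / s\<^sup>2 + 4 * \<bar>\<beta>\<bar>"
  shows "(gavg N \<beta> h g (\<lambda>\<sigma>. u (local_field N g i \<sigma>)) - (\<integral>x. u x * nu_density N \<beta> h q g i x \<partial>lborel))\<^sup>2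
    \<le> 3 * ((smooth_error s (\<lambda>x. u x * W x) g)\<^sup>2 + U\<^sup>2 * (smooth_error s W g)\<^sup>2 + (L * U)\<^sup>2 * (tilt_error q g)\<^sup>2)"
proof -
  have s: "s > 0" "s\<^sup>2 = 1 - q" using q by (auto simp: s_def)
  define r r0 where "r = cavity_r N \<beta> h q g i" "r0 = cav_avg g (\<lambda>x. x)"
  define V where "V = mix_integral \<beta> h s u"
  have U: "0 \<le> U" using order_trans[OF abs_ge_zero u(2)[of 0]] .
  have L: "0 \<le> L" unfolding L_def using s(1) by (intro add_nonneg_nonneg) auto
  have nu: "(\<integral>x. u x * nu_density N \<beta> h q g i x \<partial>lborel) = V r"
    unfolding V_def mix_integral_def mix_density_def mix_weight_def nu_density_def cavity_p_def Let_def s(2) r_r0_def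
    by (simp add: s_def)
  have W1: "1 \<le> cav_avg g W" by (rule cav_avg_ge_1)
  have "r - r0 = tilt_error q g / cav_avg g W"
    using W1 unfolding r_r0_def cavity_r_eq tilt_error_eq by (simp add: field_simps)
  then have "\<bar>r - r0\<bar> = \<bar>tilt_error q g\<bar> / cav_avg g W" using W1 by simp
  also have "\<dots> \<le> \<bar>tilt_error q g\<bar> / 1" using W1 by (intro divide_left_mono) auto
  finally have rr: "\<bar>r0 - r\<bar> \<le> \<bar>tilt_error q g\<bar>" by simp
  have "\<bar>V r0 - V r\<bar> \<le> L * U * \<bar>r0 - r\<bar>"
    unfolding V_def L_def by (rule mix_integral_lipschitz[OF s(1) u])
  also have "\<dots> \<le> L * U * \<bar>tilt_error q g\<bar>" using rr U L by (intro mult_left_mono) auto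
  finally have 1: "\<bar>V r0 - V r\<bar> \<le> L * U * \<bar>tilt_error q g\<bar>" .
  have 2: "\<bar>cav_avg g (\<lambda>x. u x * W x) / cav_avg g W - V r0\<bar>
    \<le> \<bar>smooth_error s (\<lambda>x. u x * W x) g\<bar> + U * \<bar>smooth_error s W g\<bar>"
    unfolding V_def smooth_error_def r_r0_def by (rule tilted_quotient_diff[OF s(1) u W1])
  have three: "(a + b + c)\<^sup>2 \<le> 3 * (a\<^sup>2 + b\<^sup>2 + c\<^sup>2)" for a b c :: real
    using sum_squares_ge_zero[of "a - b" "b - c"] zero_le_square[of "a - c"]
    by (simp add: power2_eq_square algebra_simps)
  have "\<bar>cav_avg g (\<lambda>x. u x * W x) / cav_avg g W - V r\<bar>
    \<le> \<bar>smooth_error s (\<lambda>x. u x * W x) g\<bar> + U * \<bar>smooth_error s W g\<bar> + L * U * \<bar>tilt_error q g\<bar>"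
    using 1 2 by linarith
  then have "\<bar>cav_avg g (\<lambda>x. u x * W x) / cav_avg g W - V r\<bar>\<^sup>2
    \<le> (\<bar>smooth_error s (\<lambda>x. u x * W x) g\<bar> + U * \<bar>smooth_error s W g\<bar> + L * U * \<bar>tilt_error q g\<bar>)\<^sup>2"
    by (rule power_mono) simp
  also have "\<dots> \<le> 3 * (\<bar>smooth_error s (\<lambda>x. u x * W x) g\<bar>\<^sup>2 + (U * \<bar>smooth_error s W g\<bar>)\<^sup>2 + (L * U * \<bar>tilt_error q g\<bar>)\<^sup>2)"
    by (rule three)
  finally show ?thesis
    unfolding gavg_field nu by (simp add: power_mult_distrib)
qed

lemma cosh_le_exp_abs:
  assumes "0 \<le> \<beta>"
  shows "W x \<le> exp \<bar>h\<bar> * exp (\<beta> * \<bar>x\<bar>)"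
proof -
  have "\<beta> * x \<le> \<beta> * \<bar>x\<bar>" "\<beta> * - x \<le> \<beta> * \<bar>x\<bar>" using assms by (intro mult_left_mono; simp)+
  then have "exp (\<beta> * x + h) \<le> exp (\<bar>h\<bar> + \<beta> * \<bar>x\<bar>)" "exp (- (\<beta> * x + h)) \<le> exp (\<bar>h\<bar> + \<beta> * \<bar>x\<bar>)"
    by simp_all
  then have "W x \<le> exp (\<bar>h\<bar> + \<beta> * \<bar>x\<bar>)" unfolding cosh_field_def by (simp only: field_simps)
  then show ?thesis by (simp add: exp_add)
qed

lemma smooth_error_merge:
  "smooth_error s f (merge other_pairs site_pairs (x, y))
    = (\<Sum>\<sigma>\<in>spins N. cav x \<sigma> * f (\<Sum>e\<in>site_pairs. coupling \<sigma> e * y e))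
      - gauss_smooth s f (\<Sum>\<sigma>\<in>spins N. cav x \<sigma> * (\<Sum>e\<in>site_pairs. coupling \<sigma> e * y e))"
  by (simp add: smooth_error_def cav_avg_def cav_merge field_merge)

text \<open>With \<open>x\<close> frozen, the smoothing errors are instances of
  \<open>replica_average_approx\<close> and the tilt error of \<open>tilted_field_approx\<close>;
  all are linear in \<open>\<Delta>\<close>, which is then bounded by the squared overlap
  deviation.\<close>

lemma conditional_error_le:
  assumes \<beta>: "0 \<le> \<beta>" and q: "0 \<le> q" "q < 1" and lip: "bigauss_lip q \<beta> C"
    and u [measurable]: "u \<in> borel_measurable borel" and ub: "\<And>x. \<bar>u x\<bar> \<le> U"
  defines "s \<equiv> sqrt (1 - q)"
  shows "(\<integral>\<^sup>+y. ennreal (3 * ((smooth_error s (\<lambda>x. u x * W x) (merge other_pairs site_pairs (x, y)))\<^sup>2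
      + U\<^sup>2 * (smooth_error s W (merge other_pairs site_pairs (x, y)))\<^sup>2
      + (L * U)\<^sup>2 * (tilt_error q (merge other_pairs site_pairs (x, y)))\<^sup>2)) \<partial>PiM site_pairs (\<lambda>_. gauss))
    \<le> ennreal (3 * (16 * C * exp (2 * \<bar>h\<bar>) + L\<^sup>2 * (cosh (2 * h) * (exp (2 * \<beta>\<^sup>2) * (4 + 18 * \<beta>\<^sup>2)))) * U\<^sup>2
      * (5 / (2 * sqrt (real N)) + sqrt (real N) / 2 * cav_overlap2 q x))"
proof -
  interpret R: linear_replicas site_pairs "spins N" "cav x" coupling "1 - 1 / real N" q
    by (rule linear_replicas_cav[OF q])
  let ?mg = "\<lambda>y. merge other_pairs site_pairs (x, y)"
  have C0: "0 \<le> C" using lip by (simp add: bigauss_lip_def)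
  have U0: "0 \<le> U" using order_trans[OF abs_ge_zero ub[of 0]] .
  define \<Delta> where "\<Delta> = 1 / real N + R.\<rho>"
  have \<Delta>0: "0 \<le> \<Delta>" using R.\<rho>_nonneg by (simp add: \<Delta>_def)
  have r: "(\<Sum>\<sigma>\<in>spins N. cav x \<sigma> * R.dotp (coupling \<sigma>) y) = R.dotp R.m y" for y
    by (rule R.dotp_m_left[symmetric])
  have sm: "smooth_error s f (?mg y)
    = (\<Sum>\<sigma>\<in>spins N. cav x \<sigma> * f (R.dotp (coupling \<sigma>) y)) - gauss_smooth s f (R.dotp R.m y)" for f y
    unfolding smooth_error_merge R.dotp_def[symmetric] r ..
  have S: "integrable R.M (\<lambda>y. (smooth_error s f (?mg y))\<^sup>2)"
    "(\<integral>y. (smooth_error s f (?mg y))\<^sup>2 \<partial>R.M) \<le> 8 * C * K\<^sup>2 * \<Delta>"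
    if "f \<in> borel_measurable borel" "\<And>x. \<bar>f x\<bar> \<le> K * exp (\<beta> * \<bar>x\<bar>)" for f K
    using R.replica_average_approx[OF lip that, folded s_def] unfolding sm \<Delta>_def by auto
  have S1: "integrable R.M (\<lambda>y. (smooth_error s (\<lambda>x. u x * W x) (?mg y))\<^sup>2)"
    "(\<integral>y. (smooth_error s (\<lambda>x. u x * W x) (?mg y))\<^sup>2 \<partial>R.M) \<le> 8 * C * (U * exp \<bar>h\<bar>)\<^sup>2 * \<Delta>"
  proof -
    have "\<bar>u x * W x\<bar> \<le> U * exp \<bar>h\<bar> * exp (\<beta> * \<bar>x\<bar>)" for x
      unfolding abs_mult mult.assoc using cosh_le_exp_abs[OF \<beta>, of x] U0 by (intro mult_mono ub) auto
    from S[OF _ this] show "integrable R.M (\<lambda>y. (smooth_error s (\<lambda>x. u x * W x) (?mg y))\<^sup>2)"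
      "(\<integral>y. (smooth_error s (\<lambda>x. u x * W x) (?mg y))\<^sup>2 \<partial>R.M) \<le> 8 * C * (U * exp \<bar>h\<bar>)\<^sup>2 * \<Delta>" by simp_all
  qed
  have S2: "integrable R.M (\<lambda>y. (smooth_error s W (?mg y))\<^sup>2)"
    "(\<integral>y. (smooth_error s W (?mg y))\<^sup>2 \<partial>R.M) \<le> 8 * C * (exp \<bar>h\<bar>)\<^sup>2 * \<Delta>"
  proof -
    have "\<bar>W x\<bar> \<le> exp \<bar>h\<bar> * exp (\<beta> * \<bar>x\<bar>)" for x
      using cosh_le_exp_abs[OF \<beta>, of x] by simp
    from S[OF _ this] show "integrable R.M (\<lambda>y. (smooth_error s W (?mg y))\<^sup>2)"
      "(\<integral>y. (smooth_error s W (?mg y))\<^sup>2 \<partial>R.M) \<le> 8 * C * (exp \<bar>h\<bar>)\<^sup>2 * \<Delta>" by simp_all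
  qed
  define T where "T = (\<lambda>\<kappa> y. \<Sum>\<sigma>\<in>spins N. cav x \<sigma> *
     ((R.dotp (coupling \<sigma>) y - R.dotp R.m y - \<kappa> * (1 - q)) * exp (\<kappa> * R.dotp (coupling \<sigma>) y)))"
  define E where "E = exp (2 * \<beta>\<^sup>2) * (4 + 18 * \<beta>\<^sup>2)"
  have T: "integrable R.M (\<lambda>y. (T \<kappa> y)\<^sup>2)" "(\<integral>y. (T \<kappa> y)\<^sup>2 \<partial>R.M) \<le> E * \<Delta>" if "\<kappa>\<^sup>2 = \<beta>\<^sup>2" for \<kappa>
    using R.tilted_field_approx[of \<kappa>] that unfolding T_def E_def \<Delta>_def by auto
  \<comment> \<open>Splitting \<open>cosh\<close> and \<open>sinh\<close> into exponentials makes
    the subtracted shift \<open>\<kappa> * (1 - q)\<close> change sign together with the exponent,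
    so both halves have the form treated before.\<close>
  have te: "tilt_error q (?mg y) = (exp h * T \<beta> y + exp (- h) * T (- \<beta>) y) / 2" for y
  proof -
    have "tilt_error q (?mg y) = (\<Sum>\<sigma>\<in>spins N. cav x \<sigma> * ((R.dotp (coupling \<sigma>) y - R.dotp R.m y) * W (R.dotp (coupling \<sigma>) y)
        - \<beta> * (1 - q) * sinh (\<beta> * R.dotp (coupling \<sigma>) y + h)))"
      unfolding tilt_error_def cav_avg_def cav_merge field_merge R.dotp_def[symmetric] r ..
    also have "\<dots> = (\<Sum>\<sigma>\<in>spins N. (exp h * (cav x \<sigma> *
     ((R.dotp (coupling \<sigma>) y - R.dotp R.m y - \<beta> * (1 - q)) * exp (\<beta> * R.dotp (coupling \<sigma>) y)))
       + exp (- h) * (cav x \<sigma> * ((R.dotp (coupling \<sigma>) y - R.dotp R.m y - (- \<beta>) * (1 - q)) *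
           exp (- \<beta> * R.dotp (coupling \<sigma>) y)))) / 2)"
    proof (rule sum.cong[OF refl])
      fix \<sigma>
      define l m where "l = R.dotp (coupling \<sigma>) y" "m = R.dotp R.m y"
      have e: "exp (\<beta> * l + h) = exp h * exp (\<beta> * l)" "exp (- (\<beta> * l + h)) = exp (- h) * exp (- \<beta> * l)"
        by (simp_all flip: exp_add)
      have "(l - m) * W l - \<beta> * (1 - q) * sinh (\<beta> * l + h)
        = (exp h * ((l - m - \<beta> * (1 - q)) * exp (\<beta> * l)) + exp (- h) * ((l - m - (- \<beta>) * (1 - q)) * exp (- \<beta> * l))) / 2"
        unfolding cosh_field_def sinh_field_def e by (simp add: field_simps)
      then have "cav x \<sigma> * ((l - m) * W l - \<beta> * (1 - q) * sinh (\<beta> * l + h))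
        = cav x \<sigma> * ((exp h * ((l - m - \<beta> * (1 - q)) * exp (\<beta> * l)) + exp (- h) * ((l - m - (- \<beta>) * (1 - q)) * exp (- \<beta> * l))) / 2)"
        by (rule arg_cong)
      then show "cav x \<sigma> * ((R.dotp (coupling \<sigma>) y - R.dotp R.m y) * W (R.dotp (coupling \<sigma>) y)
        - \<beta> * (1 - q) * sinh (\<beta> * R.dotp (coupling \<sigma>) y + h)) = (exp h * (cav x \<sigma> *
     ((R.dotp (coupling \<sigma>) y - R.dotp R.m y - \<beta> * (1 - q)) * exp (\<beta> * R.dotp (coupling \<sigma>) y)))
       + exp (- h) * (cav x \<sigma> * ((R.dotp (coupling \<sigma>) y - R.dotp R.m y - (- \<beta>) * (1 - q)) *
           exp (- \<beta> * R.dotp (coupling \<sigma>) y)))) / 2"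
        unfolding l_m_def[symmetric] by (simp only: distrib_left times_divide_eq_right mult.left_commute[of "cav x \<sigma>"])
    qed
    also have "\<dots> = (exp h * T \<beta> y + exp (- h) * T (- \<beta>) y) / 2"
      unfolding T_def sum_distrib_left sum.distrib[symmetric] sum_divide_distrib ..
    finally show ?thesis .
  qed
  have S3: "integrable R.M (\<lambda>y. (tilt_error q (?mg y))\<^sup>2)"
    "(\<integral>y. (tilt_error q (?mg y))\<^sup>2 \<partial>R.M) \<le> cosh (2 * h) * E * \<Delta>"
  proof -
    \<comment> \<open>Convexity of the square separates the two halves; their weights
      \<open>exp (2 * h)\<close> and \<open>exp (- (2 * h))\<close> average to
      \<open>cosh (2 * h)\<close>.\<close>
    define B where "B = (\<lambda>y. (exp (2 * h) * (T \<beta> y)\<^sup>2 + exp (- (2 * h)) * (T (- \<beta>) y)\<^sup>2) / 2)"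
    have iB: "integrable R.M B" unfolding B_def using T[of \<beta>] T[of "- \<beta>"] by simp
    have le: "(tilt_error q (?mg y))\<^sup>2 \<le> B y" for y
    proof -
      have "((a + b) / 2)\<^sup>2 \<le> (a\<^sup>2 + b\<^sup>2) / 2" for a b :: real
        using zero_le_square[of "a - b"] by (simp add: power2_eq_square field_simps)
      from this[of "exp h * T \<beta> y" "exp (- h) * T (- \<beta>) y"]
      show ?thesis unfolding te B_def power_mult_distrib by (simp add: exp_double[symmetric])
    qed
    show i: "integrable R.M (\<lambda>y. (tilt_error q (?mg y))\<^sup>2)"
    proof (rule Bochner_Integration.integrable_bound[OF iB])
      show "(\<lambda>y. (tilt_error q (?mg y))\<^sup>2) \<in> borel_measurable R.M"
        unfolding te T_def by measurable
    qed (use le in \<open>auto intro!: AE_I2 order_trans[OF le abs_ge_self]\<close>)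
    have "(\<integral>y. (tilt_error q (?mg y))\<^sup>2 \<partial>R.M) \<le> (\<integral>y. B y \<partial>R.M)"
      by (rule integral_mono[OF i iB le])
    also have "\<dots> = (exp (2 * h) * (\<integral>y. (T \<beta> y)\<^sup>2 \<partial>R.M) + exp (- (2 * h)) * (\<integral>y. (T (- \<beta>) y)\<^sup>2 \<partial>R.M)) / 2"
      unfolding B_def using T[of \<beta>] T[of "- \<beta>"] by simp
    also have "\<dots> \<le> (exp (2 * h) * (E * \<Delta>) + exp (- (2 * h)) * (E * \<Delta>)) / 2"
      using T(2)[of \<beta>] T(2)[of "- \<beta>"] by (intro divide_right_mono add_mono mult_left_mono) auto
    also have "\<dots> = cosh (2 * h) * E * \<Delta>" by (simp add: cosh_field_def field_simps)
    finally show "(\<integral>y. (tilt_error q (?mg y))\<^sup>2 \<partial>R.M) \<le> cosh (2 * h) * E * \<Delta>" .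
  qed
  define Y where "Y = (\<lambda>y. 3 * ((smooth_error s (\<lambda>x. u x * W x) (?mg y))\<^sup>2 + U\<^sup>2 * (smooth_error s W (?mg y))\<^sup>2
      + (L * U)\<^sup>2 * (tilt_error q (?mg y))\<^sup>2))"
  have iY: "integrable R.M Y" unfolding Y_def using S1(1) S2(1) S3(1) by simp
  have Y0: "0 \<le> Y y" for y unfolding Y_def by (intro mult_nonneg_nonneg add_nonneg_nonneg) auto
  have "(\<integral>y. Y y \<partial>R.M) = 3 * ((\<integral>y. (smooth_error s (\<lambda>x. u x * W x) (?mg y))\<^sup>2 \<partial>R.M)
    + U\<^sup>2 * (\<integral>y. (smooth_error s W (?mg y))\<^sup>2 \<partial>R.M) + (L * U)\<^sup>2 * (\<integral>y. (tilt_error q (?mg y))\<^sup>2 \<partial>R.M))"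
    unfolding Y_def using S1(1) S2(1) S3(1) by simp
  also have "\<dots> \<le> 3 * (8 * C * (U * exp \<bar>h\<bar>)\<^sup>2 * \<Delta> + U\<^sup>2 * (8 * C * (exp \<bar>h\<bar>)\<^sup>2 * \<Delta>) + (L * U)\<^sup>2 * (cosh (2 * h) * E * \<Delta>))"
    by (intro mult_left_mono add_mono S1(2) S2(2) S3(2)) auto
  also have "\<dots> = 3 * (16 * C * exp (2 * \<bar>h\<bar>) + L\<^sup>2 * (cosh (2 * h) * E)) * U\<^sup>2 * \<Delta>"
  proof -
    have eh: "exp (2 * \<bar>h\<bar>) = (exp \<bar>h\<bar>)\<^sup>2" by (rule exp_double)
    show ?thesis unfolding eh power_mult_distrib by (simp add: algebra_simps)
  qed
  also have "\<dots> \<le> 3 * (16 * C * exp (2 * \<bar>h\<bar>) + L\<^sup>2 * (cosh (2 * h) * E)) * U\<^sup>2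
      * (5 / (2 * sqrt (real N)) + sqrt (real N) / 2 * cav_overlap2 q x)"
  proof (rule mult_left_mono)
    have sN: "sqrt (real N) \<ge> 1" "sqrt (real N) * sqrt (real N) = real N" using N_pos by auto
    have N1: "1 / real N \<le> 1 / sqrt (real N)"
    proof (rule divide_left_mono)
      show "sqrt (real N) \<le> real N" using mult_right_mono[OF sN(1), of "sqrt (real N)"] sN by simp
    qed (use N_pos in auto)
    \<comment> \<open>\<open>1 / sqrt N\<close> majorises the correction \<open>1 / N\<close> from
      site \<open>i\<close>, and half as much comes from Young's inequality for the absolute
      deviation. Adding \<open>|a - 1| = 1 / N\<close> later gives the constant
      \<open>5 / 2\<close>.\<close>
    define k where "k = 3 / (2 * sqrt (real N))"
    have ptw: "\<bar>R.dotp (coupling \<sigma>) (coupling \<tau>) - q\<bar> \<le> k + sqrt (real N) / 2 * (overlap N \<sigma> \<tau> - q)\<^sup>2"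
      if st: "\<sigma> \<in> spins N" "\<tau> \<in> spins N" for \<sigma> \<tau>
    proof -
      define w where "w = overlap N \<sigma> \<tau> - q"
      have "\<bar>\<sigma> i * \<tau> i / real N\<bar> = 1 / real N"
        using spin_values[OF st(1) i] spin_values[OF st(2) i] by (auto simp: abs_mult)
      then have 1: "\<bar>R.dotp (coupling \<sigma>) (coupling \<tau>) - q\<bar> \<le> \<bar>w\<bar> + 1 / real N"
        unfolding R.dotp_def coupling_product[OF st] w_def by linarith
      \<comment> \<open>Linearising at scale \<open>1 / sqrt N\<close>, the order of a deviation
        whose second moment is of order \<open>1 / N\<close>.\<close>
      have "0 \<le> (sqrt (real N) * \<bar>w\<bar> - 1)\<^sup>2 / (2 * sqrt (real N))" by simp
      also have "\<dots> = sqrt (real N) / 2 * w\<^sup>2 + 1 / (2 * sqrt (real N)) - \<bar>w\<bar>"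
        using sN by (simp add: power2_diff power_mult_distrib field_simps power2_eq_square)
      finally show ?thesis using 1 N1 unfolding k_def w_def[symmetric] by (simp add: field_simps)
    qed
    have "R.\<rho> \<le> (\<Sum>\<sigma>\<in>spins N. \<Sum>\<tau>\<in>spins N. cav x \<sigma> * cav x \<tau> * (k + sqrt (real N) / 2 * (overlap N \<sigma> \<tau> - q)\<^sup>2))"
      unfolding R.\<rho>_def by (intro sum_mono mult_left_mono ptw) (auto intro: mult_nonneg_nonneg cav_nonneg)
    also have "\<dots> = k * ((\<Sum>\<sigma>\<in>spins N. cav x \<sigma>) * (\<Sum>\<sigma>\<in>spins N. cav x \<sigma>)) + sqrt (real N) / 2 * cav_overlap2 q x"
      unfolding sum_product cav_overlap2_def by (simp add: distrib_left sum.distrib sum_distrib_left mult_ac)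
    finally have "R.\<rho> \<le> k + sqrt (real N) / 2 * cav_overlap2 q x" by (simp add: sum_cav)
    then show "\<Delta> \<le> 5 / (2 * sqrt (real N)) + sqrt (real N) / 2 * cav_overlap2 q x"
      using N1 unfolding \<Delta>_def k_def by (simp add: field_simps)
  qed (use C0 in \<open>auto simp: E_def intro!: mult_nonneg_nonneg add_nonneg_nonneg\<close>)
  finally have "(\<integral>y. Y y \<partial>R.M) \<le> 3 * (16 * C * exp (2 * \<bar>h\<bar>) + L\<^sup>2 * (cosh (2 * h) * E)) * U\<^sup>2
      * (5 / (2 * sqrt (real N)) + sqrt (real N) / 2 * cav_overlap2 q x)" .
  then show ?thesis
    using nn_integral_eq_integral[OF iY] Y0 unfolding Y_def E_def by (simp add: ennreal_leI)
qed

text \<open>Given the other couplings, every configuration has a centred normal field of variance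
  \<open>1 - 1 / N\<close>, whatever its cavity weight. The moment generating function at
  \<open>4 * \<beta>\<close> gives \<open>exp (8 * \<beta>^2)\<close>, uniformly in
  \<open>N\<close>.\<close>

lemma nn_integral_cosh_field:
  "(\<integral>\<^sup>+g. ennreal (cav_avg g (\<lambda>x. cosh (4 * (\<beta> * x + h)))) \<partial>disorder N) \<le> ennreal (exp (8 * \<beta>\<^sup>2) * cosh (4 * h))"
proof -
  have m: "(\<lambda>g. ennreal (cav_avg g (\<lambda>x. cosh (4 * (\<beta> * x + h))))) \<in> borel_measurable (disorder N)"
    by measurable
  have "(\<integral>\<^sup>+y. ennreal (cav_avg (merge other_pairs site_pairs (x, y)) (\<lambda>x. cosh (4 * (\<beta> * x + h)))) \<partial>PiM site_pairs (\<lambda>_. gauss))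
    \<le> ennreal (exp (8 * \<beta>\<^sup>2) * cosh (4 * h))" for x
  proof -
    interpret R: linear_replicas site_pairs "spins N" "cav x" coupling "1 - 1 / real N" 0
      by (rule linear_replicas_cav) auto
    have ce: "cosh (4 * (\<beta> * l + h)) = (exp (4 * h) * exp (4 * \<beta> * l) + exp (- (4 * h)) * exp (- (4 * \<beta>) * l)) / 2" for l
      by (simp add: cosh_field_def algebra_simps flip: exp_add)
    have E: "has_bochner_integral R.M (\<lambda>y. exp (k * R.dotp (coupling \<sigma>) y)) (exp (k\<^sup>2 * (1 - 1 / real N) / 2))"
      if "\<sigma> \<in> spins N" for \<sigma> k
      using R.integral_exp_dotp[of "\<lambda>e. k * coupling \<sigma> e"] that
      by (simp add: R.dotp_scale_left R.dotp_scale_right R.dotp_t_t power2_eq_square mult.assoc)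
    have "has_bochner_integral R.M (\<lambda>y. \<Sum>\<sigma>\<in>spins N. cav x \<sigma> * ((exp (4 * h) * exp (4 * \<beta> * R.dotp (coupling \<sigma>) y)
        + exp (- (4 * h)) * exp (- (4 * \<beta>) * R.dotp (coupling \<sigma>) y)) / 2))
      (\<Sum>\<sigma>\<in>spins N. cav x \<sigma> * ((exp (4 * h) * exp ((4 * \<beta>)\<^sup>2 * (1 - 1 / real N) / 2)
        + exp (- (4 * h)) * exp ((- (4 * \<beta>))\<^sup>2 * (1 - 1 / real N) / 2)) / 2))"
      by (intro has_bochner_integral_sum has_bochner_integral_mult_right has_bochner_integral_divide_zero
        has_bochner_integral_add E)
    moreover have "(\<Sum>\<sigma>\<in>spins N. cav x \<sigma> * ((exp (4 * h) * exp ((4 * \<beta>)\<^sup>2 * (1 - 1 / real N) / 2)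
        + exp (- (4 * h)) * exp ((- (4 * \<beta>))\<^sup>2 * (1 - 1 / real N) / 2)) / 2))
        = exp (8 * \<beta>\<^sup>2 * (1 - 1 / real N)) * cosh (4 * h)"
    proof -
      have k: "(4 * \<beta>)\<^sup>2 * (1 - 1 / real N) / 2 = 8 * \<beta>\<^sup>2 * (1 - 1 / real N)"
        by (simp add: power_mult_distrib)
      show ?thesis
        unfolding sum_distrib_right[symmetric] sum_cav power2_minus k
        by (simp add: cosh_field_def add_divide_distrib distrib_left mult.commute)
    qed
    moreover have "exp (8 * \<beta>\<^sup>2 * (1 - 1 / real N)) * cosh (4 * h) \<le> exp (8 * \<beta>\<^sup>2) * cosh (4 * h)"
      using mult_left_mono[of "1 - 1 / real N" 1 "8 * \<beta>\<^sup>2"] by (intro mult_right_mono) auto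
    ultimately have i: "integrable R.M (\<lambda>y. cav_avg (merge other_pairs site_pairs (x, y)) (\<lambda>x. cosh (4 * (\<beta> * x + h))))"
      "(\<integral>y. cav_avg (merge other_pairs site_pairs (x, y)) (\<lambda>x. cosh (4 * (\<beta> * x + h))) \<partial>R.M) \<le> exp (8 * \<beta>\<^sup>2) * cosh (4 * h)"
      unfolding cav_avg_def cav_merge field_merge R.dotp_def[symmetric] ce by (auto simp: has_bochner_integral_iff)
    then show ?thesis
      by (subst nn_integral_eq_integral) (auto intro!: ennreal_leI AE_I2 order_trans[OF zero_le_one cav_avg_ge_1])
  qed
  then have "(\<integral>\<^sup>+x. \<integral>\<^sup>+y. ennreal (cav_avg (merge other_pairs site_pairs (x, y)) (\<lambda>x. cosh (4 * (\<beta> * x + h))))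
      \<partial>PiM site_pairs (\<lambda>_. gauss) \<partial>PiM other_pairs (\<lambda>_. gauss))
    \<le> (\<integral>\<^sup>+x. ennreal (exp (8 * \<beta>\<^sup>2) * cosh (4 * h)) \<partial>PiM other_pairs (\<lambda>_. gauss))"
    by (intro nn_integral_mono)
  also have "\<dots> = ennreal (exp (8 * \<beta>\<^sup>2) * cosh (4 * h))"
    by (simp add: prob_space.emeasure_space_1[OF prob_space_PiM[OF prob_space_gauss]])
  finally show ?thesis
    unfolding nn_integral_disorder_split[OF m] .
qed

text \<open>Both sides of Young's inequality are of order \<open>1 / N\<close>: \<open>N / 2\<close>
  times \<open>C0 / N^2\<close>, and \<open>1 / (2 * N)\<close> times the exponential
  moment.\<close>

lemma nn_integral_cav_overlap2:
  assumes "(\<integral>g. gavg2 N \<beta> h g (\<lambda>\<sigma> \<tau>. (overlap N \<sigma> \<tau> - q) ^ 4) \<partial>disorder N) \<le> C0 / (real N)\<^sup>2"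
  shows "(\<integral>\<^sup>+g. ennreal (cav_overlap2 q g) \<partial>disorder N) \<le> ennreal ((C0 + exp (8 * \<beta>\<^sup>2) * cosh (4 * h)) / (2 * real N))"
proof -
  let ?Q = "\<lambda>g. gavg2 N \<beta> h g (\<lambda>\<sigma> \<tau>. (overlap N \<sigma> \<tau> - q) ^ 4)"
  let ?c = "\<lambda>g. cav_avg g (\<lambda>x. cosh (4 * (\<beta> * x + h)))"
  have Q0: "0 \<le> ?Q g" for g by (rule gavg2_overlap_nonneg)
  have c0: "0 \<le> ?c g" for g by (rule order_trans[OF zero_le_one cav_avg_ge_1])
  have mQ: "(\<lambda>g. ennreal (?Q g)) \<in> borel_measurable (disorder N)" by measurable
  have mc: "(\<lambda>g. ennreal (?c g)) \<in> borel_measurable (disorder N)" by measurable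
  have "0 \<le> (\<integral>g. ?Q g \<partial>disorder N)" using Q0 by (intro integral_nonneg_AE AE_I2)
  then have "0 \<le> C0 / (real N)\<^sup>2" using assms by linarith
  then have C0: "0 \<le> C0" using N_pos by (simp add: zero_le_divide_iff)
  have "(\<integral>\<^sup>+g. ennreal (cav_overlap2 q g) \<partial>disorder N)
    \<le> (\<integral>\<^sup>+g. ennreal (real N / 2) * ennreal (?Q g) + ennreal (1 / (2 * real N)) * ennreal (?c g) \<partial>disorder N)"
    by (intro nn_integral_mono)
      (use cav_overlap2_le Q0 c0 in \<open>simp add: ennreal_mult[symmetric] ennreal_plus[symmetric] ennreal_leI del: ennreal_plus\<close>)
  also have "\<dots> = ennreal (real N / 2) * (\<integral>\<^sup>+g. ennreal (?Q g) \<partial>disorder N)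
      + ennreal (1 / (2 * real N)) * (\<integral>\<^sup>+g. ennreal (?c g) \<partial>disorder N)"
    unfolding nn_integral_cmult[OF mQ, symmetric] nn_integral_cmult[OF mc, symmetric]
    by (rule nn_integral_add) (use mQ mc in measurable)
  also have "\<dots> \<le> ennreal (real N / 2) * ennreal (C0 / (real N)\<^sup>2)
      + ennreal (1 / (2 * real N)) * ennreal (exp (8 * \<beta>\<^sup>2) * cosh (4 * h))"
  proof (intro add_mono mult_left_mono nn_integral_cosh_field)
    show "(\<integral>\<^sup>+g. ennreal (?Q g) \<partial>disorder N) \<le> ennreal (C0 / (real N)\<^sup>2)"
      using assms Q0 by (subst nn_integral_eq_integral[OF integrable_overlap_moment]) (auto intro!: ennreal_leI)
  qed auto
  also have "\<dots> = ennreal (real N / 2 * (C0 / (real N)\<^sup>2) + 1 / (2 * real N) * (exp (8 * \<beta>\<^sup>2) * cosh (4 * h)))"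
    using C0 by (simp add: ennreal_mult[symmetric] ennreal_plus[symmetric] del: ennreal_plus)
  also have "real N / 2 * (C0 / (real N)\<^sup>2) + 1 / (2 * real N) * (exp (8 * \<beta>\<^sup>2) * cosh (4 * h))
    = (C0 + exp (8 * \<beta>\<^sup>2) * cosh (4 * h)) / (2 * real N)"
    using N_pos by (simp add: field_simps power2_eq_square)
  finally show ?thesis .
qed

end

section \<open>Assembly over the full disorder\<close>

theorem theorem1p1:
  fixes \<beta> h q C0 :: real
  assumes "\<beta> > 0"
    and "q < 1"
    and "\<forall>N::nat. N \<ge> 1 \<longrightarrow>
      (\<integral>g. gavg2 N \<beta> h g (\<lambda>\<sigma>1 \<sigma>2. (overlap N \<sigma>1 \<sigma>2 - q) ^ 4) \<partial>disorder N)
        \<le> C0 / (real N)\<^sup>2"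
  shows "\<exists>C::real. \<forall>N::nat. \<forall>u::real \<Rightarrow> real. \<forall>i::nat.
      N \<ge> 1 \<longrightarrow> u \<in> borel_measurable borel \<longrightarrow> bounded (range u) \<longrightarrow> i \<in> {1..N} \<longrightarrow>
      (\<integral>g. (gavg N \<beta> h g (\<lambda>\<sigma>. u (local_field N g i \<sigma>))
              - (\<integral>x. u x * nu_density N \<beta> h q g i x \<partial>lborel))\<^sup>2 \<partial>disorder N)
        \<le> C * (sup_norm u)\<^sup>2 / sqrt (real N)"
proof -
  have q: "0 \<le> q" "q < 1" using overlap_limit_nonneg[OF assms(3)] assms(2) by auto
  then obtain C where lip: "bigauss_lip q \<beta> C" using bigauss_lip_exists[of q \<beta>] by auto
  define s where "s = sqrt (1 - q)"
  define L where "L = 2 + (2 * s + 1) / s\<^sup>2 + 4 * \<bar>\<beta>\<bar>"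
  \<comment> \<open>The prefactor of \<open>conditional_error_le\<close>, fixed here before
    \<open>N\<close>, \<open>u\<close> and \<open>i\<close>.\<close>
  define Cf where "Cf = 3 * (16 * C * exp (2 * \<bar>h\<bar>) + L\<^sup>2 * (cosh (2 * h) * (exp (2 * \<beta>\<^sup>2) * (4 + 18 * \<beta>\<^sup>2))))"
  define K where "K = C0 + exp (8 * \<beta>\<^sup>2) * cosh (4 * h)"
  have Cf: "0 \<le> Cf" using lip unfolding Cf_def bigauss_lip_def by (auto intro!: mult_nonneg_nonneg add_nonneg_nonneg)
  have main: "(\<integral>g. (gavg N \<beta> h g (\<lambda>\<sigma>. u (local_field N g i \<sigma>))
              - (\<integral>x. u x * nu_density N \<beta> h q g i x \<partial>lborel))\<^sup>2 \<partial>disorder N)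
        \<le> Cf * (5 / 2 + K / 4) * (sup_norm u)\<^sup>2 / sqrt (real N)"
    if N: "N \<ge> 1" and u [measurable]: "u \<in> borel_measurable borel" and b: "bounded (range u)" and i: "i \<in> {1..N}" for N u i
  proof -
    interpret cavity N i \<beta> h by unfold_locales (rule i)
    define U where "U = sup_norm u"
    have ub: "\<bar>u x\<bar> \<le> U" for x
    proof -
      obtain B where "\<And>x. \<bar>u x\<bar> \<le> B" using b by (auto simp: bounded_iff)
      then have "bdd_above (range (\<lambda>x. \<bar>u x\<bar>))" by (auto intro!: bdd_aboveI)
      then show ?thesis unfolding U_def sup_norm_def by (intro cSUP_upper) auto
    qed
    have U0: "0 \<le> U" using order_trans[OF abs_ge_zero ub[of 0]] .
    have hyp: "(\<integral>g. gavg2 N \<beta> h g (\<lambda>\<sigma> \<tau>. (overlap N \<sigma> \<tau> - q) ^ 4) \<partial>disorder N) \<le> C0 / (real N)\<^sup>2"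
      using assms(3) N by blast
    define Y where "Y = (\<lambda>g. 3 * ((smooth_error s (\<lambda>x. u x * cosh (\<beta> * x + h)) g)\<^sup>2
      + U\<^sup>2 * (smooth_error s (\<lambda>x. cosh (\<beta> * x + h)) g)\<^sup>2 + (L * U)\<^sup>2 * (tilt_error q g)\<^sup>2))"
    have Ym [measurable]: "Y \<in> borel_measurable (disorder N)" unfolding Y_def by measurable
    have k0: "0 \<le> cav_overlap2 q g" for g
      unfolding cav_overlap2_def by (intro sum_nonneg mult_nonneg_nonneg cav_nonneg) auto
    have km [measurable]: "cav_overlap2 q \<in> borel_measurable (disorder N)"
      unfolding cav_overlap2_def[abs_def] by measurable
    define b where "b = (\<lambda>g. Cf * U\<^sup>2 * (5 / (2 * sqrt (real N)) + sqrt (real N) / 2 * cav_overlap2 q g))"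
    have bm [measurable]: "b \<in> borel_measurable (disorder N)" unfolding b_def by measurable
    have bmerge: "b (merge other_pairs site_pairs (x, y)) = b x" for x y
      unfolding b_def cav_overlap2_def by (simp add: cav_merge)
    define k1 k2 where "k1 = Cf * U\<^sup>2 * (5 / (2 * sqrt (real N)))" and "k2 = Cf * U\<^sup>2 * (sqrt (real N) / 2)"
    have k12: "0 \<le> k1" "0 \<le> k2" using Cf by (auto simp: k1_def k2_def)
    have b_eq: "b g = k1 + k2 * cav_overlap2 q g" for g
      by (simp add: b_def k1_def k2_def algebra_simps)
    have "(\<integral>\<^sup>+g. ennreal ((gavg N \<beta> h g (\<lambda>\<sigma>. u (local_field N g i \<sigma>))
              - (\<integral>x. u x * nu_density N \<beta> h q g i x \<partial>lborel))\<^sup>2) \<partial>disorder N) \<le> (\<integral>\<^sup>+g. ennreal (Y g) \<partial>disorder N)"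
      unfolding Y_def s_def L_def by (intro nn_integral_mono ennreal_leI local_law_error_le[OF q(2) u ub])
    also have "\<dots> = (\<integral>\<^sup>+x. \<integral>\<^sup>+y. ennreal (Y (merge other_pairs site_pairs (x, y)))
        \<partial>PiM site_pairs (\<lambda>_. gauss) \<partial>PiM other_pairs (\<lambda>_. gauss))"
      by (rule nn_integral_disorder_split) measurable
    also have "\<dots> \<le> (\<integral>\<^sup>+x. ennreal (b x) \<partial>PiM other_pairs (\<lambda>_. gauss))"
      unfolding Y_def b_def Cf_def s_def
      by (intro nn_integral_mono conditional_error_le[OF _ q lip u ub]) (use assms(1) in simp)
    \<comment> \<open>The bound is constant in the couplings at site \<open>i\<close>, so these can
      be reinserted; the overlap estimate is stated for the full disorder.\<close>
    also have "\<dots> = (\<integral>\<^sup>+x. \<integral>\<^sup>+y. ennreal (b (merge other_pairs site_pairs (x, y)))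
        \<partial>PiM site_pairs (\<lambda>_. gauss) \<partial>PiM other_pairs (\<lambda>_. gauss))"
      by (simp add: bmerge prob_space.emeasure_space_1[OF prob_space_PiM[OF prob_space_gauss]])
    also have "\<dots> = (\<integral>\<^sup>+g. ennreal (b g) \<partial>disorder N)"
      by (rule nn_integral_disorder_split[symmetric]) measurable
    also have "\<dots> = (\<integral>\<^sup>+g. ennreal k1 + ennreal k2 * ennreal (cav_overlap2 q g) \<partial>disorder N)"
      unfolding b_eq using k0 k12 by (simp add: ennreal_plus ennreal_mult)
    also have "\<dots> = ennreal k1 + ennreal k2 * (\<integral>\<^sup>+g. ennreal (cav_overlap2 q g) \<partial>disorder N)"
      by (subst nn_integral_add) (auto simp: nn_integral_cmult prob_space.emeasure_space_1[OF prob_space_disorder])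
    also have "\<dots> \<le> ennreal k1 + ennreal k2 * ennreal (K / (2 * real N))"
      unfolding K_def by (intro add_left_mono mult_left_mono nn_integral_cav_overlap2 hyp) simp
    finally have nn: "(\<integral>\<^sup>+g. ennreal ((gavg N \<beta> h g (\<lambda>\<sigma>. u (local_field N g i \<sigma>))
              - (\<integral>x. u x * nu_density N \<beta> h q g i x \<partial>lborel))\<^sup>2) \<partial>disorder N)
      \<le> ennreal k1 + ennreal k2 * ennreal (K / (2 * real N))" .
    have "0 \<le> (\<integral>g. gavg2 N \<beta> h g (\<lambda>\<sigma> \<tau>. (overlap N \<sigma> \<tau> - q) ^ 4) \<partial>disorder N)"
      by (intro integral_nonneg_AE AE_I2 gavg2_overlap_nonneg)
    then have "0 \<le> C0 / (real N)\<^sup>2" using hyp by linarith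
    then have "0 \<le> C0" using N by (simp add: zero_le_divide_iff)
    then have K0: "0 \<le> K" by (simp add: K_def)
    have "(\<integral>g. (gavg N \<beta> h g (\<lambda>\<sigma>. u (local_field N g i \<sigma>))
              - (\<integral>x. u x * nu_density N \<beta> h q g i x \<partial>lborel))\<^sup>2 \<partial>disorder N) \<le> k1 + k2 * (K / (2 * real N))"
    \<comment> \<open>A finite bound on the nonnegative integral transfers directly to the Bochner
      integral in the conclusion.\<close>
    proof (rule integral_real_bounded)
      show "0 \<le> k1 + k2 * (K / (2 * real N))" using k12 K0 by simp
      show "(\<integral>\<^sup>+g. ennreal ((gavg N \<beta> h g (\<lambda>\<sigma>. u (local_field N g i \<sigma>))
              - (\<integral>x. u x * nu_density N \<beta> h q g i x \<partial>lborel))\<^sup>2) \<partial>disorder N) \<le> ennreal (k1 + k2 * (K / (2 * real N)))"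
        using nn k12 K0 by (simp flip: ennreal_mult ennreal_plus)
    qed
    also have "k1 + k2 * (K / (2 * real N)) = Cf * (5 / 2 + K / 4) * U\<^sup>2 / sqrt (real N)"
    proof -
      have "sqrt (real N) / real N = 1 / sqrt (real N)"
        using N by (simp add: field_simps)
      moreover have "k2 * (K / (2 * real N)) = Cf * U\<^sup>2 * (K / 4) * (sqrt (real N) / real N)"
        unfolding k2_def by simp
      ultimately have "k2 * (K / (2 * real N)) = Cf * U\<^sup>2 * (K / 4) * (1 / sqrt (real N))"
        by (simp only:)
      then show ?thesis unfolding k1_def using N_pos by (simp add: field_simps)
    qed
    finally show ?thesis by (simp add: U_def)
  qed
  then show ?thesis by blast
qed

end
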